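(* Let $\mathsf{PTDF}=(\mathsf{PTDF.KG},\mathsf{PTDF.Eval},\mathsf{PTDF.Inv},\mathsf{PTDF.Puncture},\mathsf{PTDF.PuncInv})$ be a puncturable trapdoor function mapping $\{0,1\}^{n(\lambda)}$ to $\{0,1\}^{m(\lambda)}$, and let $\mathsf{UPO}=(\mathsf{UPO.Obf},\mathsf{UPO.Eval})$ be an unclonable puncturable obfuscation (UPO), both as defined in the context. Define $\mathsf{TDFCP}=(\mathsf{Setup},\mathsf{KG},\mathsf{Eval},\mathsf{Inv})$ by: - $\mathsf{Setup}(1^\lambda)\to(\mathsf{ek},\mathsf{td})$: run $(\mathsf{ek},\mathsf{td})\leftarrow\mathsf{PTDF.KG}(1^\lambda)$; - $\mathsf{KG}(\mathsf{td})\to\widehat{\mathsf{td}}$ (a quantum state): run $\widehat{\mathsf{td}}\leftarrow\mathsf{UPO.Obf}(1^\lambda,\mathsf{PTDF.Inv}(\mathsf{td},\cdot))$; - $\mathsf{Eval}(\mathsf{ek},x)\to y$: run $y\leftarrow\mathsf{PTDF.Eval}(\mathsf{ek},x)$; - $\mathsf{Inv}(\widehat{\mathsf{td}},y)\to(x,\widehat{\mathsf{td}}')$: run $(x,\widehat{\mathsf{td}}')\leftarrow\mathsf{UPO.Eval}(\widehat{\mathsf{td}},y)$. Then $\mathsf{TDFCP}$ is search anti-piracy secure: every QPT adversary $(A,B,C)$ wins the search anti-piracy game for $\mathsf{TDFCP}$ with probability at most $\mathrm{negl}(\lambda)$.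
   Context: Conventions. $\lambda$ is the security parameter; QPT means quantum polynomial time; adversaries are non-uniform QPT; $\mathrm{negl}$ is an unspecified negligible function; $x\leftarrow S$ is uniform sampling from a finite set $S$; $n,m$ are polynomials. Search anti-piracy game for a tuple $(\mathsf{Setup},\mathsf{KG},\mathsf{Eval},\mathsf{Inv})$ with domain $\{0,1\}^{n(\lambda)}$ and adversary $(A,B,C)$: (1) the challenger runs $(\mathsf{ek},\mathsf{td})\leftarrow\mathsf{Setup}(1^\lambda)$, $\widehat{\mathsf{td}}\leftarrow\mathsf{KG}(\mathsf{td})$, samples $x_B\leftarrow\{0,1\}^{n(\lambda)}$, $x_C\leftarrow\{0,1\}^{n(\lambda)}$ and sends $(\mathsf{ek},\widehat{\mathsf{td}})$ to $A$; (2) $A$ generates a bipartite state over registers $R_B,R_C$ and sends $R_B$ to $B$ and $R_C$ to $C$; (3) the challenger sends $y_B=\mathsf{Eval}(\mathsf{ek},x_B)$ to $B$ and $y_C=\mathsf{Eval}(\mathsf{ek},x_C)$ to $C$; (4) $B$ and $C$ output $x_B'$ and $x_C'$ respectively; the adversary wins iff $x_B'=x_B$ and $x_C'=x_C$. Puncturable TDF mapping $\{0,1\}^{n(\lambda)}$ to $\{0,1\}^{m(\lambda)}$: algorithms $\mathsf{KG}(1^\lambda)\to(\mathsf{ek},\mathsf{td})$; deterministic $\mathsf{Eval}(\mathsf{ek},x)\to y\in\{0,1\}^{m(\lambda)}$ for $x\in\{0,1\}^{n(\lambda)}$; deterministic $\mathsf{Inv}(\mathsf{td},y)\to x'$; $\mathsf{Puncture}(\mathsf{td},(y_1,y_2))\to\mathsf{td}_{y_1,y_2}$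 for $y_1,y_2\in\{0,1\}^{m(\lambda)}$; deterministic $\mathsf{PuncInv}(\mathsf{td}_{y_1,y_2},y)\to x'$; such that: - (almost-all-keys inversion correctness) $\Pr_{(\mathsf{ek},\mathsf{td})\leftarrow\mathsf{KG}(1^\lambda)}[\forall x\in\{0,1\}^{n(\lambda)},\ \mathsf{Inv}(\mathsf{td},\mathsf{Eval}(\mathsf{ek},x))=x]\ge1-\mathrm{negl}(\lambda)$; - (puncturing correctness) for any $y_1,y_2\in\{0,1\}^{m(\lambda)}$, with probability $\ge1-\mathrm{negl}(\lambda)$ over $(\mathsf{ek},\mathsf{td})\leftarrow\mathsf{KG}(1^\lambda)$ and $\mathsf{td}_{y_1,y_2}\leftarrow\mathsf{Puncture}(\mathsf{td},(y_1,y_2))$, for all $y\in\{0,1\}^{m(\lambda)}$ one has $\mathsf{PuncInv}(\mathsf{td}_{y_1,y_2},y)=\mathsf{Inv}(\mathsf{td},y)$ if $y\notin\{y_1,y_2\}$ and $=\bot$ if $y\in\{y_1,y_2\}$; - (one-wayness at punctured points) for every QPT $A$, if $(\mathsf{ek},\mathsf{td})\leftarrow\mathsf{KG}(1^\lambda)$, $x_j^*\leftarrow\{0,1\}^{n(\lambda)}$ and $y_j^*=\mathsf{Eval}(\mathsf{ek},x_j^* )$ for $j=1,2$, $\mathsf{td}_{y_1^*,y_2^*}\leftarrow\mathsf{Puncture}(\mathsf{td},(y_1^*,y_2^* ))$ and $(x_1',x_2')\leftarrow A(\mathsf{ek},\mathsf{td}_{y_1^*,y_2^*},y_1^*,y_2^*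 )$, then $\Pr[x_1'=x_1^*\lor x_2'=x_2^*]\le\mathrm{negl}(\lambda)$. UPO for a circuit class $\{\mathcal C_\lambda\}$ of circuits $\{0,1\}^{\ell_{in}}\to\{0,1\}^{\ell_{out}}$: QPT algorithms $\mathsf{Obf}(1^\lambda,C)\to p$ (a quantum state) and $\mathsf{Eval}(p,x)\to(y,p')$ such that: - (almost-all-keys correctness) for any $C\in\mathcal C_\lambda$, with probability $\ge1-\mathrm{negl}(\lambda)$ over $p\leftarrow\mathsf{Obf}(1^\lambda,C)$, for all $x$, $\mathsf{Eval}(p,x)$ outputs $y=C(x)$ with probability $\ge1-\mathrm{negl}(\lambda)$; - ($\mathcal D$-UPO security, for a distribution $\mathcal D$ on pairs of inputs) every QPT $(A,B,C')$ wins the following game with probability at most $\frac12+\mathrm{negl}(\lambda)$: $A$ sends $C\in\mathcal C_\lambda$; the challenger samples $b\leftarrow\{0,1\}$, $(x_B,x_{C'})\leftarrow\mathcal D$ and sends $A$ the state $\mathsf{Obf}(1^\lambda,C)$ if $b=0$, or $\mathsf{Obf}(1^\lambda,C^* )$ if $b=1$, where $C^*(x)=C(x)$ for $x\notin\{x_B,x_{C'}\}$ and $C^*(x)=\bot$ for $x\in\{x_B,x_{C'}\}$; $A$ generates a bipartite state and sends one register to $B$ and the other to $C'$; $B$ receives $x_B$ and $C'$ receives $x_{C'}$; they output bits $b_B,b_{C'}$ and win iff $b=b_B=b_{C'}$. The setting in which UPO is used: the existence of indistinguishability obfuscation (iO) and the LWE assumption are assumed; under these, for every constant $c>0$ and all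 polynomials $\ell_{in},\ell_{out}$ there is a UPO for the class of circuits $\{0,1\}^{\ell_{in}}\to\{0,1\}^{\ell_{out}}$ with $\mathcal D$-UPO security for every QPT-samplable product distribution $\mathcal D=\mathcal D_B\times\mathcal D_{C'}$ whose factors have min-entropy at least $\lambda^c$, and "UPO" refers to such an object (the constant $c>0$ being free to choose). Without loss of generality the UPO is also taken to be secure as an iO: obfuscations of two equal-size, functionally equivalent circuits are indistinguishable to QPT adversaries.
   Formalization: Puncturing correctness is assumed also for points y1,y2 that may depend on the keys (ek,td), as Eval(ek,x) does; with y1,y2 fixed before the keys the claim fails, e.g. when all images carry a random tag from ek and Puncture errs exactly on that tag. *)

theory Defs
  imports Complex_Main "HOL-Computational_Algebra.Polynomial"
begin

section \<open>Asymptotics and bitstrings\<close>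

type_synonym bits = "bool list"

definition bitstrings :: "nat \<Rightarrow> bits set" where
  "bitstrings k = {x. length x = k}"

definition polynomial :: "(nat \<Rightarrow> nat) \<Rightarrow> bool" where
  "polynomial f \<longleftrightarrow> (\<exists>p :: real poly. \<forall>\<kappa>. real (f \<kappa>) = poly p (real \<kappa>))"

definition poly_bounded :: "(nat \<Rightarrow> nat) \<Rightarrow> bool" where
  "poly_bounded f \<longleftrightarrow> (\<exists>k. \<forall>\<kappa>. f \<kappa> \<le> \<kappa> ^ k + k)"

definition negligible :: "(nat \<Rightarrow> real) \<Rightarrow> bool" where
  "negligible \<epsilon> \<longleftrightarrow> (\<forall>k. eventually (\<lambda>\<kappa>. \<bar>\<epsilon> \<kappa>\<bar> < 1 / real \<kappa> ^ k) sequentially)"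

definition min_entropy :: "nat \<Rightarrow> (bits \<Rightarrow> real) \<Rightarrow> real" where
  "min_entropy k p = - log 2 (Max (p ` bitstrings k))"


section \<open>Boolean circuits\<close>

text \<open>
  A circuit is a straight-line program with a list of output wires.  The inputs occupy the
  wires from 0 on, and each gate adds one new wire at the end.
\<close>

datatype bgate = ConstG bool | NotG nat | AndG nat nat | OrG nat nat

type_synonym bcirc = "bgate list \<times> nat list"

fun gate_ok :: "nat \<Rightarrow> bgate \<Rightarrow> bool" where
  "gate_ok w (ConstG b) \<longleftrightarrow> True"
| "gate_ok w (NotG i) \<longleftrightarrow> i < w"
| "gate_ok w (AndG i j) \<longleftrightarrow> i < w \<and> j < w"
| "gate_ok w (OrG i j) \<longleftrightarrow> i < w \<and> j < w"

fun gate_val :: "bits \<Rightarrow> bgate \<Rightarrow> bool" where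
  "gate_val ws (ConstG b) = b"
| "gate_val ws (NotG i) = (\<not> ws ! i)"
| "gate_val ws (AndG i j) = (ws ! i \<and> ws ! j)"
| "gate_val ws (OrG i j) = (ws ! i \<or> ws ! j)"

definition bsize :: "bcirc \<Rightarrow> nat" where
  "bsize C = length (fst C)"

definition wf_circ :: "nat \<Rightarrow> nat \<Rightarrow> bcirc \<Rightarrow> bool" where
  "wf_circ lin lout C \<longleftrightarrow>
     (\<forall>k < length (fst C). gate_ok (lin + k) (fst C ! k)) \<and>
     (\<forall>i \<in> set (snd C). i < lin + length (fst C)) \<and> length (snd C) = lout"

definition beval :: "bcirc \<Rightarrow> bits \<Rightarrow> bits" where
  "beval C x = (let ws = foldl (\<lambda>ws g. ws @ [gate_val ws g]) x (fst C) in map (\<lambda>i. ws ! i) (snd C))"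

definition circuits :: "nat \<Rightarrow> nat \<Rightarrow> nat \<Rightarrow> bcirc set" where
  "circuits lin lout s = {C. wf_circ lin lout C \<and> bsize C = s}"

definition pad :: "nat \<Rightarrow> bcirc \<Rightarrow> bcirc" where
  "pad s C = (fst C @ replicate (s - bsize C) (ConstG False), snd C)"

text \<open>
  If \<open>C\<close> computes a function of \<open>y @ key\<close>, then \<open>hardwire key C\<close> computes the function of \<open>y\<close>
  alone: the constant gates produce exactly the wires on which \<open>C\<close> expects the key, so no wire
  has to be renumbered.
\<close>

definition hardwire :: "bits \<Rightarrow> bcirc \<Rightarrow> bcirc" where
  "hardwire key C = (map ConstG key @ fst C, snd C)"

text \<open>
  Values in \<open>{0,1}\<^sup>n \<union> {\<bottom>}\<close> are encoded in \<open>n + 1\<close> bits: \<open>x\<close> as \<open>1x\<close> and \<open>\<bottom>\<close> as the all-zero string.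
\<close>

definition val :: "bits \<Rightarrow> bits" where
  "val x = True # x"

definition bot_out :: "nat \<Rightarrow> bits" where
  "bot_out lout = replicate lout False"

text \<open>
  \<open>eq_gates w z\<close>, placed at wire \<open>w\<close> of a circuit with \<open>length z\<close> inputs, tests whether the input is
  \<open>z\<close>: first one literal per input bit, then the running conjunctions.  The result is on
  wire \<open>w + 2 * length z\<close>.
\<close>

definition eq_gates :: "nat \<Rightarrow> bits \<Rightarrow> bgate list" where
  "eq_gates w z =
     map (\<lambda>i. if z ! i then AndG i i else NotG i) [0..<length z] @
     [ConstG True] @
     map (\<lambda>i. AndG (w + length z + i) (w + i)) [0..<length z]"

text \<open>
  The punctured circuit \<open>C\<^sup>*\<close>, for inputs of length \<open>lin\<close>: every output bit is masked by
  the bit saying that the input is neither of the two points.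
\<close>

definition puncture_circ :: "nat \<Rightarrow> bcirc \<Rightarrow> bits \<Rightarrow> bits \<Rightarrow> bcirc" where
  "puncture_circ lin C z1 z2 =
     (let w1 = lin + bsize C;
          w2 = w1 + 2 * lin + 1;
          w3 = w2 + 2 * lin + 1
      in (fst C @ eq_gates w1 z1 @ eq_gates w2 z2 @
            [OrG (w1 + 2 * lin) (w2 + 2 * lin), NotG w3] @
            map (\<lambda>i. AndG i (w3 + 1)) (snd C),
          [w3 + 2 ..< w3 + 2 + length (snd C)]))"

definition puncture_overhead :: "nat \<Rightarrow> nat \<Rightarrow> nat" where
  "puncture_overhead lin lout = 4 * lin + lout + 4"

text \<open>Binary description of a circuit, with wires in one-hot encoding.\<close>

definition onehot :: "nat \<Rightarrow> nat \<Rightarrow> bits" where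
  "onehot w i = map (\<lambda>k. k = i) [0..<w]"

fun gate_code :: "nat \<Rightarrow> bgate \<Rightarrow> bits" where
  "gate_code w (ConstG b) = [False, False, b] @ replicate (2 * w) False"
| "gate_code w (NotG i) = [False, True, False] @ onehot w i @ replicate w False"
| "gate_code w (AndG i j) = [True, False, False] @ onehot w i @ onehot w j"
| "gate_code w (OrG i j) = [True, True, False] @ onehot w i @ onehot w j"

definition code :: "nat \<Rightarrow> bcirc \<Rightarrow> bits" where
  "code lin C = (let w = lin + bsize C in
     concat (map (gate_code w) (fst C)) @ concat (map (onehot w) (snd C)))"

definition code_len :: "nat \<Rightarrow> nat \<Rightarrow> nat \<Rightarrow> nat" where
  "code_len lin lout s = s * (3 + 2 * (lin + s)) + lout * (lin + s)"


section \<open>Quantum circuits\<close>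

text \<open>
  Mixed-state quantum circuits in the sense of Aharonov, Kitaev and Nisan.  An operator on
  \<open>k\<close> qubits is given by its matrix entries in the computational basis, indexed by bitstrings of length
  \<open>k\<close>; the entries at other lengths carry no meaning.  Operators need not be normalised: the
  trace of an unnormalised state is the probability of the branch it describes.

  The gates are X, H, T, CNOT and Toffoli, together with insertion of a fresh qubit in state 0
  at a given position and tracing out the qubit at a given position.
\<close>

type_synonym qstate = "bits \<Rightarrow> bits \<Rightarrow> complex"

datatype qop =
    XG nat | HG nat | TG nat | CX nat nat | CCX nat nat nat
  | Init nat | Discard nat

type_synonym qcirc = "qop list"

definition ins_at :: "nat \<Rightarrow> bool \<Rightarrow> bits \<Rightarrow> bits" where
  "ins_at i a u = take i u @ a # drop i u"

definition del_at :: "nat \<Rightarrow> bits \<Rightarrow> bits" where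
  "del_at i u = take i u @ drop (Suc i) u"

text \<open>Conjugation by the one-qubit unitary \<open>U\<close> (row index first) on qubit \<open>i\<close>.\<close>

definition conj1 :: "(bool \<Rightarrow> bool \<Rightarrow> complex) \<Rightarrow> nat \<Rightarrow> qstate \<Rightarrow> qstate" where
  "conj1 U i \<rho> = (\<lambda>u v. \<Sum>a\<in>UNIV. \<Sum>b\<in>UNIV. U (u ! i) a * \<rho> (u[i := a]) (v[i := b]) * cnj (U (v ! i) b))"

definition h_mat :: "bool \<Rightarrow> bool \<Rightarrow> complex" where
  "h_mat a b = (if a \<and> b then - 1 else 1) / complex_of_real (sqrt 2)"

definition t_mat :: "bool \<Rightarrow> bool \<Rightarrow> complex" where
  "t_mat a b = (if a \<noteq> b then 0 else if a then cis (pi / 4) else 1)"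

fun apply_op :: "qop \<Rightarrow> qstate \<Rightarrow> qstate" where
  "apply_op (XG i) \<rho> = (\<lambda>u v. \<rho> (u[i := (\<not> u ! i)]) (v[i := (\<not> v ! i)]))"
| "apply_op (HG i) \<rho> = conj1 h_mat i \<rho>"
| "apply_op (TG i) \<rho> = conj1 t_mat i \<rho>"
| "apply_op (CX i j) \<rho> =
     (\<lambda>u v. \<rho> (u[j := (u ! j \<noteq> u ! i)]) (v[j := (v ! j \<noteq> v ! i)]))"
| "apply_op (CCX i j k) \<rho> =
     (\<lambda>u v. \<rho> (u[k := (u ! k \<noteq> (u ! i \<and> u ! j))]) (v[k := (v ! k \<noteq> (v ! i \<and> v ! j))]))"
| "apply_op (Init i) \<rho> = (\<lambda>u v. if u ! i \<or> v ! i then 0 else \<rho> (del_at i u) (del_at i v))"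
| "apply_op (Discard i) \<rho> = (\<lambda>u v. \<Sum>a\<in>UNIV. \<rho> (ins_at i a u) (ins_at i a v))"

fun op_ok :: "nat \<Rightarrow> qop \<Rightarrow> bool" where
  "op_ok w (XG i) \<longleftrightarrow> i < w"
| "op_ok w (HG i) \<longleftrightarrow> i < w"
| "op_ok w (TG i) \<longleftrightarrow> i < w"
| "op_ok w (CX i j) \<longleftrightarrow> i < w \<and> j < w \<and> i \<noteq> j"
| "op_ok w (CCX i j k) \<longleftrightarrow> i < w \<and> j < w \<and> k < w \<and> i \<noteq> j \<and> i \<noteq> k \<and> j \<noteq> k"
| "op_ok w (Init i) \<longleftrightarrow> i \<le> w"
| "op_ok w (Discard i) \<longleftrightarrow> i < w"

fun op_width :: "nat \<Rightarrow> qop \<Rightarrow> nat" where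
  "op_width w (Init i) = Suc w"
| "op_width w (Discard i) = w - 1"
| "op_width w _ = w"

text \<open>\<open>wf_qcirc a Q b\<close>: \<open>Q\<close> is a circuit from \<open>a\<close> qubits to \<open>b\<close> qubits.\<close>

fun wf_qcirc :: "nat \<Rightarrow> qcirc \<Rightarrow> nat \<Rightarrow> bool" where
  "wf_qcirc a [] b \<longleftrightarrow> a = b"
| "wf_qcirc a (g # Q) b \<longleftrightarrow> op_ok a g \<and> wf_qcirc (op_width a g) Q b"

definition run :: "qcirc \<Rightarrow> qstate \<Rightarrow> qstate" where
  "run Q \<rho> = fold apply_op Q \<rho>"

fun shift_op :: "nat \<Rightarrow> qop \<Rightarrow> qop" where
  "shift_op d (XG i) = XG (d + i)"
| "shift_op d (HG i) = HG (d + i)"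
| "shift_op d (TG i) = TG (d + i)"
| "shift_op d (CX i j) = CX (d + i) (d + j)"
| "shift_op d (CCX i j k) = CCX (d + i) (d + j) (d + k)"
| "shift_op d (Init i) = Init (d + i)"
| "shift_op d (Discard i) = Discard (d + i)"

text \<open>
  \<open>par b Q R\<close> is the tensor product of \<open>Q\<close>, acting on the first block of qubits and leaving \<open>b\<close>
  qubits there, and \<open>R\<close>, acting on the remaining block.
\<close>

definition par :: "nat \<Rightarrow> qcirc \<Rightarrow> qcirc \<Rightarrow> qcirc" where
  "par b Q R = Q @ map (shift_op b) R"

definition basis :: "bits \<Rightarrow> qstate" where
  "basis x = (\<lambda>u v. if u = x \<and> v = x then 1 else 0)"

text \<open>Tensor product; the first argument is the number of qubits of the left factor.\<close>

definition tensor :: "nat \<Rightarrow> qstate \<Rightarrow> qstate \<Rightarrow> qstate" where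
  "tensor k \<rho> \<sigma> = (\<lambda>u v. \<rho> (take k u) (take k v) * \<sigma> (drop k u) (drop k v))"

definition outcome :: "qstate \<Rightarrow> bits \<Rightarrow> real" where
  "outcome \<rho> z = Re (\<rho> z z)"

text \<open>Residual (unnormalised) state after measuring the leading qubits with result \<open>z\<close>.\<close>

definition measured :: "bits \<Rightarrow> qstate \<Rightarrow> qstate" where
  "measured z \<rho> = (\<lambda>u v. \<rho> (z @ u) (z @ v))"

definition out_prob :: "qcirc \<Rightarrow> bits \<Rightarrow> bits \<Rightarrow> real" where
  "out_prob Q x z = outcome (run Q (basis x)) z"

definition density :: "nat \<Rightarrow> qstate \<Rightarrow> bool" where
  "density k \<rho> \<longleftrightarrow>
     (\<forall>\<psi> :: bits \<Rightarrow> complex.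
        let q = (\<Sum>u\<in>bitstrings k. \<Sum>v\<in>bitstrings k. cnj (\<psi> u) * \<rho> u v * \<psi> v)
        in Im q = 0 \<and> Re q \<ge> 0) \<and>
     (\<Sum>u\<in>bitstrings k. \<rho> u u) = 1"

text \<open>
  Non-uniform QPT algorithms: families of circuits with polynomially many gates, classical
  advice being hard-wired.  Input and output lengths are functions of the security parameter.
\<close>

definition qpt :: "(nat \<Rightarrow> nat) \<Rightarrow> (nat \<Rightarrow> qcirc) \<Rightarrow> (nat \<Rightarrow> nat) \<Rightarrow> bool" where
  "qpt a Q b \<longleftrightarrow> (\<forall>\<kappa>. wf_qcirc (a \<kappa>) (Q \<kappa>) (b \<kappa>)) \<and> poly_bounded (\<lambda>\<kappa>. length (Q \<kappa>))"

definition poly_circ :: "(nat \<Rightarrow> nat) \<Rightarrow> (nat \<Rightarrow> bcirc) \<Rightarrow> (nat \<Rightarrow> nat) \<Rightarrow> bool" where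
  "poly_circ a C b \<longleftrightarrow> (\<forall>\<kappa>. wf_circ (a \<kappa>) (b \<kappa>) (C \<kappa>)) \<and> poly_bounded (\<lambda>\<kappa>. bsize (C \<kappa>))"


section \<open>Puncturable trapdoor functions\<close>

text \<open>
  The randomised algorithms are quantum circuit families with classical output, the deterministic
  ones Boolean circuit families.  \<open>t_ek\<close>, \<open>t_td\<close> and \<open>t_ptd\<close> are the lengths of evaluation keys,
  trapdoors and punctured trapdoors.  Boolean circuits take the data first and the
  key second, as \<^const>\<open>hardwire\<close> expects; inverses are in \<open>{0,1}\<^sup>n \<union> {\<bottom>}\<close> and so use \<open>n + 1\<close> bits.
\<close>

record ptdf =
  t_n :: "nat \<Rightarrow> nat"
  t_m :: "nat \<Rightarrow> nat"
  t_ek :: "nat \<Rightarrow> nat"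
  t_td :: "nat \<Rightarrow> nat"
  t_ptd :: "nat \<Rightarrow> nat"
  t_KG :: "nat \<Rightarrow> qcirc"
  t_Eval :: "nat \<Rightarrow> bcirc"
  t_Inv :: "nat \<Rightarrow> bcirc"
  t_Punc :: "nat \<Rightarrow> qcirc"
  t_PuncInv :: "nat \<Rightarrow> bcirc"

definition kg_prob :: "ptdf \<Rightarrow> nat \<Rightarrow> bits \<Rightarrow> bits \<Rightarrow> real" where
  "kg_prob P \<kappa> ek td = out_prob (t_KG P \<kappa>) [] (ek @ td)"

definition punc_prob :: "ptdf \<Rightarrow> nat \<Rightarrow> bits \<Rightarrow> bits \<Rightarrow> bits \<Rightarrow> bits \<Rightarrow> real" where
  "punc_prob P \<kappa> td y1 y2 ptd = out_prob (t_Punc P \<kappa>) (td @ y1 @ y2) ptd"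

definition tdf_eval :: "ptdf \<Rightarrow> nat \<Rightarrow> bits \<Rightarrow> bits \<Rightarrow> bits" where
  "tdf_eval P \<kappa> ek x = beval (t_Eval P \<kappa>) (x @ ek)"

definition inv_circ :: "ptdf \<Rightarrow> nat \<Rightarrow> bits \<Rightarrow> bcirc" where
  "inv_circ P \<kappa> td = hardwire td (t_Inv P \<kappa>)"

definition punc_inv_circ :: "ptdf \<Rightarrow> nat \<Rightarrow> bits \<Rightarrow> bcirc" where
  "punc_inv_circ P \<kappa> ptd = hardwire ptd (t_PuncInv P \<kappa>)"

definition tdf_efficient :: "ptdf \<Rightarrow> bool" where
  "tdf_efficient P \<longleftrightarrow>
     polynomial (t_n P) \<and> polynomial (t_m P) \<and>
     qpt (\<lambda>\<kappa>. 0) (t_KG P) (\<lambda>\<kappa>. t_ek P \<kappa> + t_td P \<kappa>) \<and>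
     poly_circ (\<lambda>\<kappa>. t_n P \<kappa> + t_ek P \<kappa>) (t_Eval P) (t_m P) \<and>
     poly_circ (\<lambda>\<kappa>. t_m P \<kappa> + t_td P \<kappa>) (t_Inv P) (\<lambda>\<kappa>. t_n P \<kappa> + 1) \<and>
     qpt (\<lambda>\<kappa>. t_td P \<kappa> + (t_m P \<kappa> + t_m P \<kappa>)) (t_Punc P) (t_ptd P) \<and>
     poly_circ (\<lambda>\<kappa>. t_m P \<kappa> + t_ptd P \<kappa>) (t_PuncInv P) (\<lambda>\<kappa>. t_n P \<kappa> + 1)"

definition inversion_correct :: "ptdf \<Rightarrow> bool" where
  "inversion_correct P \<longleftrightarrow> (\<exists>\<epsilon>. negligible \<epsilon> \<and> (\<forall>\<kappa>.
     (\<Sum>ek\<in>bitstrings (t_ek P \<kappa>). \<Sum>td\<in>bitstrings (t_td P \<kappa>).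
        kg_prob P \<kappa> ek td *
        of_bool (\<forall>x\<in>bitstrings (t_n P \<kappa>). beval (inv_circ P \<kappa> td) (tdf_eval P \<kappa> ek x) = val x))
     \<ge> 1 - \<epsilon> \<kappa>))"

text \<open>
  The points \<open>y1 y2\<close> are arbitrary and may depend on the keys (\<open>Y1 ek td\<close>, \<open>Y2 ek td\<close>), as they do
  whenever one punctures at images under \<open>Eval(ek,-)\<close>.  With points fixed before the keys, a
  trapdoor function whose images all contain a random tag taken from \<open>ek\<close> could be
  arbitrarily incorrect when punctured at images.
\<close>

definition punctured_correct_at :: "ptdf \<Rightarrow> nat \<Rightarrow> bits \<Rightarrow> bits \<Rightarrow> bits \<Rightarrow> bits \<Rightarrow> bool" where
  "punctured_correct_at P \<kappa> td y1 y2 ptd \<longleftrightarrow>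
     (\<forall>y\<in>bitstrings (t_m P \<kappa>).
        beval (punc_inv_circ P \<kappa> ptd) y =
          (if y \<in> {y1, y2} then bot_out (t_n P \<kappa> + 1) else beval (inv_circ P \<kappa> td) y))"

definition puncturing_correct :: "ptdf \<Rightarrow> bool" where
  "puncturing_correct P \<longleftrightarrow> (\<exists>\<epsilon>. negligible \<epsilon> \<and> (\<forall>\<kappa> Y1 Y2.
     (\<forall>ek td. Y1 ek td \<in> bitstrings (t_m P \<kappa>) \<and> Y2 ek td \<in> bitstrings (t_m P \<kappa>)) \<longrightarrow>
     (\<Sum>ek\<in>bitstrings (t_ek P \<kappa>). \<Sum>td\<in>bitstrings (t_td P \<kappa>). \<Sum>ptd\<in>bitstrings (t_ptd P \<kappa>).
        kg_prob P \<kappa> ek td * punc_prob P \<kappa> td (Y1 ek td) (Y2 ek td) ptd *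
        of_bool (punctured_correct_at P \<kappa> td (Y1 ek td) (Y2 ek td) ptd))
     \<ge> 1 - \<epsilon> \<kappa>))"

definition ow_win :: "ptdf \<Rightarrow> (nat \<Rightarrow> qcirc) \<Rightarrow> nat \<Rightarrow> real" where
  "ow_win P A \<kappa> =
     (\<Sum>ek\<in>bitstrings (t_ek P \<kappa>). \<Sum>td\<in>bitstrings (t_td P \<kappa>). kg_prob P \<kappa> ek td *
       (\<Sum>x1\<in>bitstrings (t_n P \<kappa>). \<Sum>x2\<in>bitstrings (t_n P \<kappa>). (1 / 2 ^ t_n P \<kappa>)\<^sup>2 *
         (let y1 = tdf_eval P \<kappa> ek x1; y2 = tdf_eval P \<kappa> ek x2 in
          \<Sum>ptd\<in>bitstrings (t_ptd P \<kappa>). punc_prob P \<kappa> td y1 y2 ptd *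
            (\<Sum>x1'\<in>bitstrings (t_n P \<kappa>). \<Sum>x2'\<in>bitstrings (t_n P \<kappa>).
               of_bool (x1' = x1 \<or> x2' = x2) *
               out_prob (A \<kappa>) (ek @ ptd @ y1 @ y2) (x1' @ x2')))))"

definition one_way_punctured :: "ptdf \<Rightarrow> bool" where
  "one_way_punctured P \<longleftrightarrow> (\<forall>A.
     qpt (\<lambda>\<kappa>. t_ek P \<kappa> + (t_ptd P \<kappa> + (t_m P \<kappa> + t_m P \<kappa>))) A (\<lambda>\<kappa>. t_n P \<kappa> + t_n P \<kappa>) \<longrightarrow>
     (\<exists>\<epsilon>. negligible \<epsilon> \<and> (\<forall>\<kappa>. ow_win P A \<kappa> \<le> \<epsilon> \<kappa>)))"

definition puncturable_tdf :: "ptdf \<Rightarrow> bool" where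
  "puncturable_tdf P \<longleftrightarrow>
     tdf_efficient P \<and> inversion_correct P \<and> puncturing_correct P \<and> one_way_punctured P"


section \<open>Unclonable puncturable obfuscation\<close>

text \<open>
  \<open>u_size\<close> is the size of the circuits in the class and \<open>u_reg\<close> the number of qubits of an obfuscated
  program.  So as not to reveal the size of its input, \<open>Obf\<close> first pads it to a
  common size that leaves room for puncturing.
\<close>

record upo =
  u_in :: "nat \<Rightarrow> nat"
  u_out :: "nat \<Rightarrow> nat"
  u_size :: "nat \<Rightarrow> nat"
  u_reg :: "nat \<Rightarrow> nat"
  u_Obf :: "nat \<Rightarrow> qcirc"
  u_Eval :: "nat \<Rightarrow> qcirc"

definition u_class :: "upo \<Rightarrow> nat \<Rightarrow> bcirc set" where
  "u_class U \<kappa> = circuits (u_in U \<kappa>) (u_out U \<kappa>) (u_size U \<kappa>)"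

definition u_full :: "upo \<Rightarrow> nat \<Rightarrow> nat" where
  "u_full U \<kappa> = u_size U \<kappa> + puncture_overhead (u_in U \<kappa>) (u_out U \<kappa>)"

definition obfuscated :: "upo \<Rightarrow> nat \<Rightarrow> bcirc \<Rightarrow> qstate" where
  "obfuscated U \<kappa> C = run (u_Obf U \<kappa>) (basis (code (u_in U \<kappa>) (pad (u_full U \<kappa>) C)))"

definition upo_eval :: "upo \<Rightarrow> nat \<Rightarrow> qstate \<Rightarrow> bits \<Rightarrow> qstate" where
  "upo_eval U \<kappa> p x = run (u_Eval U \<kappa>) (tensor (u_reg U \<kappa>) p (basis x))"

definition upo_efficient :: "upo \<Rightarrow> bool" where
  "upo_efficient U \<longleftrightarrow>
     poly_bounded (u_size U) \<and>
     qpt (\<lambda>\<kappa>. code_len (u_in U \<kappa>) (u_out U \<kappa>) (u_full U \<kappa>)) (u_Obf U) (u_reg U) \<and>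
     qpt (\<lambda>\<kappa>. u_reg U \<kappa> + u_in U \<kappa>) (u_Eval U) (\<lambda>\<kappa>. u_out U \<kappa> + u_reg U \<kappa>)"

text \<open>
  ``With overwhelming probability over \<open>p \<leftarrow> Obf\<close>'' refers to an ensemble \<open>(w i, p i)\<^sub>i\<close> of states
  whose average is the output state of \<open>Obf\<close>.
\<close>

definition upo_correct :: "upo \<Rightarrow> bool" where
  "upo_correct U \<longleftrightarrow> (\<exists>\<epsilon> \<delta>. negligible \<epsilon> \<and> negligible \<delta> \<and> (\<forall>\<kappa>. \<forall>C\<in>u_class U \<kappa>.
     \<exists>(N::nat) w p.
       (\<forall>i<N. 0 \<le> w i \<and> density (u_reg U \<kappa>) (p i)) \<and> (\<Sum>i<N. w i) = 1 \<and>
       (\<forall>u\<in>bitstrings (u_reg U \<kappa>). \<forall>v\<in>bitstrings (u_reg U \<kappa>).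
          obfuscated U \<kappa> C u v = (\<Sum>i<N. complex_of_real (w i) * p i u v)) \<and>
       (\<Sum>i<N. w i * of_bool (\<forall>x\<in>bitstrings (u_in U \<kappa>).
            (\<Sum>z\<in>bitstrings (u_reg U \<kappa>). outcome (upo_eval U \<kappa> (p i) x) (beval C x @ z)) \<ge> 1 - \<delta> \<kappa>))
         \<ge> 1 - \<epsilon> \<kappa>))"

text \<open>
  \<open>A1\<close> outputs (the description of) a circuit in the class, which is measured, and its
  internal state on \<open>aux\<close> qubits; failing to output a circuit in the class loses the game.
  \<open>A2\<close> receives that state and the obfuscated program and outputs the registers, \<open>rB\<close> and \<open>rC\<close> qubits,
  for \<open>B\<close> and \<open>C\<close>.  In the final step the qubits are ordered as \<open>xB, R\<^sub>B, R\<^sub>C, xC\<close>, so that \<open>B\<close> acts on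
  the first and \<open>C\<close> on the last two blocks.
\<close>

definition upo_win ::
  "upo \<Rightarrow> (nat \<Rightarrow> qcirc) \<Rightarrow> (nat \<Rightarrow> qcirc) \<Rightarrow> (nat \<Rightarrow> nat) \<Rightarrow> (nat \<Rightarrow> nat) \<Rightarrow> (nat \<Rightarrow> nat) \<Rightarrow>
   (nat \<Rightarrow> qcirc) \<Rightarrow> (nat \<Rightarrow> qcirc) \<Rightarrow> (nat \<Rightarrow> qcirc) \<Rightarrow> (nat \<Rightarrow> qcirc) \<Rightarrow> nat \<Rightarrow> real" where
  "upo_win U DB DC aux rB rC A1 A2 B C \<kappa> =
     (\<Sum>b\<in>(UNIV :: bool set). 1 / 2 *
       (\<Sum>xB\<in>bitstrings (u_in U \<kappa>). \<Sum>xC\<in>bitstrings (u_in U \<kappa>).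
         out_prob (DB \<kappa>) [] xB * out_prob (DC \<kappa>) [] xC *
         (\<Sum>K\<in>u_class U \<kappa>.
           (let st = measured (code (u_in U \<kappa>) K) (run (A1 \<kappa>) (basis []));
                p = obfuscated U \<kappa> (if b then puncture_circ (u_in U \<kappa>) K xB xC else K);
                bip = run (A2 \<kappa>) (tensor (aux \<kappa>) st p);
                fin = run (par 1 (B \<kappa>) (C \<kappa>))
                        (tensor (u_in U \<kappa>) (basis xB) (tensor (rB \<kappa> + rC \<kappa>) bip (basis xC)))
            in outcome fin [b, b]))))"

definition high_min_entropy :: "real \<Rightarrow> (nat \<Rightarrow> nat) \<Rightarrow> (nat \<Rightarrow> qcirc) \<Rightarrow> bool" where
  "high_min_entropy c len D \<longleftrightarrow>
     eventually (\<lambda>\<kappa>. min_entropy (len \<kappa>) (out_prob (D \<kappa>) []) \<ge> real \<kappa> powr c) sequentially"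

text \<open>A QPT-samplable distribution is given by its sampler.\<close>

definition upo_secure :: "real \<Rightarrow> upo \<Rightarrow> bool" where
  "upo_secure c U \<longleftrightarrow> (\<forall>DB DC aux rB rC A1 A2 B C.
     qpt (\<lambda>\<kappa>. 0) DB (u_in U) \<and> high_min_entropy c (u_in U) DB \<and>
     qpt (\<lambda>\<kappa>. 0) DC (u_in U) \<and> high_min_entropy c (u_in U) DC \<and>
     qpt (\<lambda>\<kappa>. 0) A1 (\<lambda>\<kappa>. code_len (u_in U \<kappa>) (u_out U \<kappa>) (u_size U \<kappa>) + aux \<kappa>) \<and>
     qpt (\<lambda>\<kappa>. aux \<kappa> + u_reg U \<kappa>) A2 (\<lambda>\<kappa>. rB \<kappa> + rC \<kappa>) \<and>
     qpt (\<lambda>\<kappa>. u_in U \<kappa> + rB \<kappa>) B (\<lambda>\<kappa>. 1) \<and>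
     qpt (\<lambda>\<kappa>. rC \<kappa> + u_in U \<kappa>) C (\<lambda>\<kappa>. 1) \<longrightarrow>
     (\<exists>\<epsilon>. negligible \<epsilon> \<and> (\<forall>\<kappa>. upo_win U DB DC aux rB rC A1 A2 B C \<kappa> \<le> 1 / 2 + \<epsilon> \<kappa>)))"

definition io_secure :: "upo \<Rightarrow> bool" where
  "io_secure U \<longleftrightarrow> (\<forall>D C0 C1.
     qpt (u_reg U) D (\<lambda>\<kappa>. 1) \<and>
     (\<forall>\<kappa>. wf_circ (u_in U \<kappa>) (u_out U \<kappa>) (C0 \<kappa>) \<and> wf_circ (u_in U \<kappa>) (u_out U \<kappa>) (C1 \<kappa>) \<and>
          bsize (C0 \<kappa>) = bsize (C1 \<kappa>) \<and> bsize (C0 \<kappa>) \<le> u_full U \<kappa> \<and>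
          (\<forall>x\<in>bitstrings (u_in U \<kappa>). beval (C0 \<kappa>) x = beval (C1 \<kappa>) x)) \<longrightarrow>
     negligible (\<lambda>\<kappa>. outcome (run (D \<kappa>) (obfuscated U \<kappa> (C0 \<kappa>))) [True] -
                     outcome (run (D \<kappa>) (obfuscated U \<kappa> (C1 \<kappa>))) [True]))"

definition is_upo :: "real \<Rightarrow> upo \<Rightarrow> bool" where
  "is_upo c U \<longleftrightarrow> upo_efficient U \<and> upo_correct U \<and> upo_secure c U \<and> io_secure U"


section \<open>Copy-protected trapdoor functions and search anti-piracy\<close>

text \<open>
  \<open>s_Setup\<close> gives the joint distribution of \<open>(ek, td)\<close>, \<open>s_KG\<close> the state of the quantum trapdoor
  on \<open>s_key\<close> qubits, and \<open>s_Inv\<close> the joint state of answer and updated trapdoor.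
\<close>

record cp_tdf =
  s_n :: "nat \<Rightarrow> nat"
  s_m :: "nat \<Rightarrow> nat"
  s_ek :: "nat \<Rightarrow> nat"
  s_td :: "nat \<Rightarrow> nat"
  s_key :: "nat \<Rightarrow> nat"
  s_Setup :: "nat \<Rightarrow> bits \<Rightarrow> bits \<Rightarrow> real"
  s_KG :: "nat \<Rightarrow> bits \<Rightarrow> qstate"
  s_Eval :: "nat \<Rightarrow> bits \<Rightarrow> bits \<Rightarrow> bits"
  s_Inv :: "nat \<Rightarrow> qstate \<Rightarrow> bits \<Rightarrow> qstate"

text \<open>The qubits given to \<open>B\<close> and \<open>C\<close> are ordered as \<open>yB, R\<^sub>B, R\<^sub>C, yC\<close>.\<close>

definition search_win ::
  "cp_tdf \<Rightarrow> (nat \<Rightarrow> nat) \<Rightarrow> (nat \<Rightarrow> nat) \<Rightarrow>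
   (nat \<Rightarrow> qcirc) \<Rightarrow> (nat \<Rightarrow> qcirc) \<Rightarrow> (nat \<Rightarrow> qcirc) \<Rightarrow> nat \<Rightarrow> real" where
  "search_win S rB rC A B C \<kappa> =
     (\<Sum>ek\<in>bitstrings (s_ek S \<kappa>). \<Sum>td\<in>bitstrings (s_td S \<kappa>). s_Setup S \<kappa> ek td *
       (\<Sum>xB\<in>bitstrings (s_n S \<kappa>). \<Sum>xC\<in>bitstrings (s_n S \<kappa>). (1 / 2 ^ s_n S \<kappa>)\<^sup>2 *
         (let yB = s_Eval S \<kappa> ek xB;
              yC = s_Eval S \<kappa> ek xC;
              bip = run (A \<kappa>) (tensor (s_ek S \<kappa>) (basis ek) (s_KG S \<kappa> td));
              fin = run (par (s_n S \<kappa>) (B \<kappa>) (C \<kappa>))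
                      (tensor (s_m S \<kappa>) (basis yB) (tensor (rB \<kappa> + rC \<kappa>) bip (basis yC)))
          in outcome fin (xB @ xC))))"

definition search_secure :: "cp_tdf \<Rightarrow> bool" where
  "search_secure S \<longleftrightarrow> (\<forall>rB rC A B C.
     qpt (\<lambda>\<kappa>. s_ek S \<kappa> + s_key S \<kappa>) A (\<lambda>\<kappa>. rB \<kappa> + rC \<kappa>) \<and>
     qpt (\<lambda>\<kappa>. s_m S \<kappa> + rB \<kappa>) B (s_n S) \<and>
     qpt (\<lambda>\<kappa>. rC \<kappa> + s_m S \<kappa>) C (s_n S) \<longrightarrow>
     (\<exists>\<epsilon>. negligible \<epsilon> \<and> (\<forall>\<kappa>. search_win S rB rC A B C \<kappa> \<le> \<epsilon> \<kappa>)))"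

definition TDFCP :: "ptdf \<Rightarrow> upo \<Rightarrow> cp_tdf" where
  "TDFCP P U = \<lparr>
     s_n = t_n P,
     s_m = t_m P,
     s_ek = t_ek P,
     s_td = t_td P,
     s_key = u_reg U,
     s_Setup = kg_prob P,
     s_KG = (\<lambda>\<kappa> td. obfuscated U \<kappa> (inv_circ P \<kappa> td)),
     s_Eval = tdf_eval P,
     s_Inv = upo_eval U \<rparr>"

text \<open>
  The circuit class of \<open>U\<close> has the input and output lengths of \<open>Inv(td,-)\<close> and, after
  padding, contains both \<open>Inv(td,-)\<close> and \<open>PuncInv(ptd,-)\<close>.
\<close>

definition upo_fits :: "ptdf \<Rightarrow> upo \<Rightarrow> bool" where
  "upo_fits P U \<longleftrightarrow> (\<forall>\<kappa>.
     u_in U \<kappa> = t_m P \<kappa> \<and> u_out U \<kappa> = t_n P \<kappa> + 1 \<and>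
     bsize (t_Inv P \<kappa>) + t_td P \<kappa> \<le> u_size U \<kappa> \<and>
     bsize (t_PuncInv P \<kappa>) + t_ptd P \<kappa> \<le> u_size U \<kappa>)"

end

theory Submission
  imports Defs
begin

text \<open>
  Fix keys \<open>(ek, td)\<close> and let the players of the unclonability game run those of the search game,
  outputting 0 if and only if the answer is a preimage of the challenge. With an unpunctured
  program they win when both search players succeed, with a punctured one when both fail. Winning
  with probability at most \<open>1/2 + negl\<close> therefore means that the search game is won with
  probability at most \<open>2 negl\<close> plus the probability that some player succeeds although the program
  was punctured. The latter is negligible: by iO security the punctured circuit for \<open>Inv(td,-)\<close> may
  be replaced by \<open>PuncInv\<close> with the punctured trapdoor, and one-wayness at punctured points
  bounds the disjunction.

  The challenge distribution of the unclonability game may not depend on the circuit, while here it is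
  \<open>Eval(ek,-)\<close> on a uniform input. Since adversaries are non-uniform, keys that maximize the
  difference between the two success probabilities can be hard-wired. For correct keys
  \<open>Eval(ek,-)\<close> is injective, so the min-entropy is \<open>n\<close>; and one-wayness makes \<open>n\<close> a nonconstant
  polynomial, so that \<open>c = 1/2\<close> works.
\<close>

text \<open>The search game averages over keys, while unclonability and iO security give a
  negligible bound only after a whole family of circuits has been fixed. Both therefore need a worst
  choice at each security parameter, which for iO includes the two challenges and the punctured
  trapdoor. One-wayness is different: its adversary receives \<open>ek\<close> and the punctured
  trapdoor as input, so it must write the description of \<open>PuncInv\<close> with that trapdoor
  by itself, and the simulation is exact. The registers of the two players may be entangled, so
  their outcomes cannot be treated as independent. Of quantum circuits only locality, linearity,
  positivity, preservation of trace and the behaviour of classical gates on basis states and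
  diagonals enter: whatever the new players add to the search players is classical and acts on basis
  states or measured answers. The exponent 1/2 comes from n \<ge> l \<kappa> + a with an unknown
  slope l > 0, which eventually dominates any power of \<kappa> with exponent below 1.\<close>

lemma bitstrings_iff [simp]: "x \<in> bitstrings k \<longleftrightarrow> length x = k"
  by (simp add: bitstrings_def)

lemma finite_bitstrings [simp]: "finite (bitstrings k)"
  using finite_lists_length_eq[of "UNIV :: bool set" k] by (simp add: bitstrings_def)

lemma card_bitstrings: "card (bitstrings k) = 2 ^ k"
  using card_lists_length_eq[of "UNIV :: bool set" k] by (simp add: bitstrings_def)

lemma bitstrings_1: "bitstrings (Suc 0) = {[False], [True]}"
  by (auto simp: bitstrings_def length_Suc_conv)

lemma sum_bitstrings_append:
  "(\<Sum>z\<in>bitstrings (a + b). f z) = (\<Sum>x\<in>bitstrings a. \<Sum>y\<in>bitstrings b. f (x @ y))"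
proof -
  have "(\<Sum>z\<in>bitstrings (a + b). f z) = (\<Sum>p\<in>bitstrings a \<times> bitstrings b. f (fst p @ snd p))"
    by (rule sum.reindex_bij_witness[of _ "\<lambda>p. fst p @ snd p" "\<lambda>z. (take a z, drop a z)"]) auto
  then show ?thesis
    by (simp add: sum.cartesian_product case_prod_beta)
qed

lemma sum_swap_past_pair:
  "(\<Sum>a\<in>A. \<Sum>c\<in>C. \<Sum>d\<in>D. f a c d) = (\<Sum>c\<in>C. \<Sum>d\<in>D. \<Sum>a\<in>A. f a c d)"
  by (subst sum.swap) (intro sum.cong refl sum.swap)

lemma sum_swap_pairs:
  "(\<Sum>a\<in>A. \<Sum>b\<in>B. \<Sum>c\<in>C. \<Sum>d\<in>D. f a b c d) = (\<Sum>c\<in>C. \<Sum>d\<in>D. \<Sum>a\<in>A. \<Sum>b\<in>B. f a b c d)"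
  by (rule trans[OF sum.cong[OF refl sum_swap_past_pair] sum_swap_past_pair])

section \<open>Asymptotics\<close>

lemma negligible_add:
  assumes "negligible f" "negligible g"
  shows "negligible (\<lambda>\<kappa>. f \<kappa> + g \<kappa>)"
  unfolding negligible_def
proof
  fix k
  \<comment> \<open>Exponent k + 1 leaves a spare factor \<kappa>, which from \<kappa> \<ge> 2 on
    absorbs the factor 2 of the sum.\<close>
  have f: "eventually (\<lambda>\<kappa>. \<bar>f \<kappa>\<bar> < 1 / real \<kappa> ^ Suc k) sequentially"
    and g: "eventually (\<lambda>\<kappa>. \<bar>g \<kappa>\<bar> < 1 / real \<kappa> ^ Suc k) sequentially"
    using assms unfolding negligible_def by blast+
  show "eventually (\<lambda>\<kappa>. \<bar>f \<kappa> + g \<kappa>\<bar> < 1 / real \<kappa> ^ k) sequentially"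
    using f g eventually_ge_at_top[of 2]
  proof eventually_elim
    case (elim \<kappa>)
    have "\<bar>f \<kappa> + g \<kappa>\<bar> < 2 / real \<kappa> ^ Suc k"
      using elim by linarith
    also have "\<dots> \<le> real \<kappa> / real \<kappa> ^ Suc k"
      using elim by (intro divide_right_mono) auto
    also have "\<dots> = 1 / real \<kappa> ^ k"
      using elim by simp
    finally show ?case .
  qed
qed

text \<open>The shape c (\<kappa> + 1)^d is easier to add and multiply than \<kappa>^k + k; together
  with \<open>poly_boundedD\<close> it carries the closure properties.\<close>

lemma poly_boundedI:
  assumes "\<And>\<kappa>. f \<kappa> \<le> c * Suc \<kappa> ^ d"
  shows "poly_bounded f"
  unfolding poly_bounded_def
proof (intro exI allI)
  fix \<kappa>
  \<comment> \<open>As an additive term, c 2^d covers \<kappa> < 2; for \<kappa> \<ge> 2 the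
    exponent c + 2 d suffices, as c \<le> \<kappa>^c and \<kappa> + 1 \<le> \<kappa>^2.\<close>
  let ?k = "c * 2 ^ d + c + 2 * d"
  show "f \<kappa> \<le> \<kappa> ^ ?k + ?k"
  proof (cases "\<kappa> < 2")
    case True
    have "f \<kappa> \<le> c * Suc \<kappa> ^ d"
      by (rule assms)
    also have "\<dots> \<le> c * 2 ^ d"
      using True by (intro mult_left_mono power_mono) auto
    finally show ?thesis by simp
  next
    case False
    have "Suc \<kappa> \<le> \<kappa> ^ 2"
      using False mult_le_mono1[of 2 \<kappa> \<kappa>] unfolding power2_eq_square by linarith
    then have "Suc \<kappa> ^ d \<le> (\<kappa> ^ 2) ^ d"
      by (rule power_mono) simp
    moreover have "c \<le> \<kappa> ^ c"
      using less_exp[of c] power_mono[of 2 \<kappa> c] False by simp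
    ultimately have "c * Suc \<kappa> ^ d \<le> \<kappa> ^ c * (\<kappa> ^ 2) ^ d"
      by (rule mult_le_mono[rotated])
    also have "\<dots> = \<kappa> ^ (c + 2 * d)"
      by (simp add: power_add power_mult)
    also have "\<dots> \<le> \<kappa> ^ ?k"
      using False by (intro power_increasing) auto
    finally show ?thesis
      using assms[of \<kappa>] by simp
  qed
qed

lemma poly_boundedD:
  assumes "poly_bounded f"
  shows "\<exists>c d. \<forall>\<kappa>. f \<kappa> \<le> c * Suc \<kappa> ^ d"
proof -
  obtain k where k: "\<And>\<kappa>. f \<kappa> \<le> \<kappa> ^ k + k"
    using assms by (auto simp: poly_bounded_def)
  have "f \<kappa> \<le> (1 + k) * Suc \<kappa> ^ k" for \<kappa>
  proof -
    have "\<kappa> ^ k \<le> Suc \<kappa> ^ k"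
      by (intro power_mono) auto
    moreover have "k \<le> k * Suc \<kappa> ^ k"
      by simp
    ultimately show ?thesis
      using k[of \<kappa>] unfolding add_mult_distrib by linarith
  qed
  then show ?thesis by blast
qed

lemma poly_bounded_mono:
  assumes "poly_bounded g" "\<And>\<kappa>. f \<kappa> \<le> g \<kappa>"
  shows "poly_bounded f"
  using assms unfolding poly_bounded_def by (meson order_trans)

lemma poly_bounded_const: "poly_bounded (\<lambda>\<kappa>. a)"
  by (rule poly_boundedI[of _ a 0]) simp

lemma poly_bounded_add:
  assumes "poly_bounded f" "poly_bounded g"
  shows "poly_bounded (\<lambda>\<kappa>. f \<kappa> + g \<kappa>)"
proof -
  obtain c d where f: "\<And>\<kappa>. f \<kappa> \<le> c * Suc \<kappa> ^ d"
    using poly_boundedD[OF assms(1)] by blast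
  obtain c' d' where g: "\<And>\<kappa>. g \<kappa> \<le> c' * Suc \<kappa> ^ d'"
    using poly_boundedD[OF assms(2)] by blast
  show ?thesis
  proof (rule poly_boundedI)
    fix \<kappa>
    have "c * Suc \<kappa> ^ d \<le> c * Suc \<kappa> ^ (d + d')" "c' * Suc \<kappa> ^ d' \<le> c' * Suc \<kappa> ^ (d + d')"
      by (intro mult_left_mono power_increasing; simp)+
    then show "f \<kappa> + g \<kappa> \<le> (c + c') * Suc \<kappa> ^ (d + d')"
      using f[of \<kappa>] g[of \<kappa>] unfolding add_mult_distrib by linarith
  qed
qed

lemma poly_bounded_mult:
  assumes "poly_bounded f" "poly_bounded g"
  shows "poly_bounded (\<lambda>\<kappa>. f \<kappa> * g \<kappa>)"
proof -
  obtain c d where f: "\<And>\<kappa>. f \<kappa> \<le> c * Suc \<kappa> ^ d"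
    using poly_boundedD[OF assms(1)] by blast
  obtain c' d' where g: "\<And>\<kappa>. g \<kappa> \<le> c' * Suc \<kappa> ^ d'"
    using poly_boundedD[OF assms(2)] by blast
  show ?thesis
  proof (rule poly_boundedI)
    fix \<kappa>
    have "f \<kappa> * g \<kappa> \<le> (c * Suc \<kappa> ^ d) * (c' * Suc \<kappa> ^ d')"
      by (intro mult_le_mono f g)
    then show "f \<kappa> * g \<kappa> \<le> (c * c') * Suc \<kappa> ^ (d + d')"
      by (simp add: power_add mult.assoc mult.left_commute)
  qed
qed

lemma polynomial_poly_bounded:
  assumes "polynomial f"
  shows "poly_bounded f"
proof -
  obtain p :: "real poly" where p: "\<And>\<kappa>. real (f \<kappa>) = poly p (real \<kappa>)"
    using assms by (auto simp: polynomial_def)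
  define c where "c = nat \<lceil>\<Sum>i\<le>degree p. \<bar>coeff p i\<bar>\<rceil>"
  show ?thesis
  proof (rule poly_boundedI)
    fix \<kappa>
    have "real (f \<kappa>) = (\<Sum>i\<le>degree p. coeff p i * real \<kappa> ^ i)"
      by (simp add: p poly_altdef)
    also have "\<dots> \<le> (\<Sum>i\<le>degree p. \<bar>coeff p i\<bar> * real (Suc \<kappa>) ^ degree p)"
    proof (rule sum_mono)
      fix i assume "i \<in> {..degree p}"
      then have "real \<kappa> ^ i \<le> real (Suc \<kappa>) ^ degree p"
        by (intro order_trans[OF power_mono[of "real \<kappa>" "real (Suc \<kappa>)"] power_increasing]) auto
      then show "coeff p i * real \<kappa> ^ i \<le> \<bar>coeff p i\<bar> * real (Suc \<kappa>) ^ degree p"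
        by (intro mult_mono) auto
    qed
    also have "\<dots> = (\<Sum>i\<le>degree p. \<bar>coeff p i\<bar>) * real (Suc \<kappa>) ^ degree p"
      by (simp add: sum_distrib_right)
    also have "\<dots> \<le> real c * real (Suc \<kappa>) ^ degree p"
      unfolding c_def by (intro mult_right_mono real_nat_ceiling_ge) auto
    finally have "real (f \<kappa>) \<le> real (c * Suc \<kappa> ^ degree p)"
      by simp
    then show "f \<kappa> \<le> c * Suc \<kappa> ^ degree p"
      by (simp only: of_nat_le_iff)
  qed
qed

lemmas poly_bounded_intros =
  poly_bounded_const poly_bounded_add poly_bounded_mult

text \<open>A natural-valued polynomial either is constant or grows at least linearly.\<close>

lemma polynomial_ge_sqrt:
  assumes "polynomial f" "negligible \<epsilon>" "\<And>\<kappa>. 1 / 2 ^ f \<kappa> \<le> \<epsilon> \<kappa>"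
  shows "eventually (\<lambda>\<kappa>. real (f \<kappa>) \<ge> real \<kappa> powr (1 / 2)) sequentially"
proof -
  obtain p :: "real poly" where p: "\<And>\<kappa>. real (f \<kappa>) = poly p (real \<kappa>)"
    using assms by (auto simp: polynomial_def)
  obtain a q where pq: "p = pCons a q"
    by (cases p)
  \<comment> \<open>As p = a + x q, a vanishing q makes f constant, and 1 / 2^f would be a positive
    constant below a negligible function.\<close>
  have "q \<noteq> 0"
  proof
    assume "q = 0"
    then have const: "f \<kappa> = f 0" for \<kappa>
      using p[of \<kappa>] p[of 0] pq by simp
    have "eventually (\<lambda>\<kappa>. \<bar>\<epsilon> \<kappa>\<bar> < 1 / real \<kappa> ^ 1) sequentially"
      using assms(2) unfolding negligible_def by blast
    then have "eventually (\<lambda>\<kappa>. False) sequentially"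
      using eventually_ge_at_top[of "2 ^ f 0"]
    proof eventually_elim
      case (elim \<kappa>)
      have "real \<kappa> \<ge> 2 ^ f 0"
        using elim(2) by (metis of_nat_le_iff of_nat_numeral of_nat_power)
      then have "1 / real \<kappa> \<le> 1 / 2 ^ f 0"
        by (rule frac_le[rotated 3]) auto
      then show False
        using elim(1) assms(3)[of \<kappa>] const[of \<kappa>] by simp
    qed
    then show False by simp
  qed
  have lin: "\<exists>l>0. eventually (\<lambda>\<kappa>. l * real \<kappa> + a \<le> real (f \<kappa>)) sequentially"
  proof (cases "lead_coeff q > 0")
    case True
    then obtain N where N: "\<And>x. x \<ge> N \<Longrightarrow> lead_coeff q \<le> poly q x"
      using poly_pinfty_gt_lc by blast
    have "eventually (\<lambda>\<kappa>. lead_coeff q * real \<kappa> + a \<le> real (f \<kappa>)) sequentially"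
      using eventually_ge_at_top[of "nat \<lceil>N\<rceil>"]
    proof eventually_elim
      case (elim \<kappa>)
      then have "lead_coeff q \<le> poly q (real \<kappa>)"
        by (intro N) linarith
      then show ?case
        by (auto simp: p pq mult.commute intro!: mult_left_mono)
    qed
    with True show ?thesis by blast
  next
    case False
    then have "lead_coeff (- q) > 0"
      using \<open>q \<noteq> 0\<close> leading_coeff_neq_0[of q] by (simp add: lead_coeff_minus order_less_le)
    then obtain N where l: "lead_coeff (- q) > 0" and N: "\<And>x. x \<ge> N \<Longrightarrow> lead_coeff (- q) \<le> poly (- q) x"
      using poly_pinfty_gt_lc by blast
    \<comment> \<open>A point beyond \<open>N\<close> at which \<kappa> q(\<kappa>) also outweighs
      a, so that f would be negative there; the + 1 makes the inequality strict.\<close>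
    define \<kappa> where "\<kappa> = nat \<lceil>N\<rceil> + nat \<lceil>\<bar>a\<bar> / lead_coeff (- q)\<rceil> + 1"
    have "lead_coeff (- q) \<le> - poly q (real \<kappa>)"
      using N[of "real \<kappa>"] by (simp add: \<kappa>_def) linarith
    then have "real \<kappa> * poly q (real \<kappa>) \<le> - (real \<kappa> * lead_coeff (- q))"
      by (metis mult_left_mono mult_minus_right neg_le_iff_le of_nat_0_le_iff minus_minus)
    moreover have "\<bar>a\<bar> / lead_coeff (- q) < real \<kappa>"
      by (simp add: \<kappa>_def) linarith
    then have "\<bar>a\<bar> < real \<kappa> * lead_coeff (- q)"
      using l by (simp only: pos_divide_less_eq)
    ultimately have "real (f \<kappa>) < 0"
      by (simp add: p pq)
    then show ?thesis by simp
  qed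
  then obtain l where l: "l > 0" and ev: "eventually (\<lambda>\<kappa>. l * real \<kappa> + a \<le> real (f \<kappa>)) sequentially"
    by blast
  show ?thesis
    \<comment> \<open>With s = sqrt \<kappa> the threshold gives l s \<ge> \<bar>a\<bar> + 1, so l
      \<kappa> = (l s) s \<ge> s + \<bar>a\<bar> s \<ge> s - a; the final + 1 ensures s \<ge>
      1.\<close>
    using ev eventually_ge_at_top[of "nat \<lceil>((\<bar>a\<bar> + 1) / l)\<^sup>2\<rceil> + 1"]
  proof eventually_elim
    case (elim \<kappa>)
    define s where "s = sqrt (real \<kappa>)"
    have "((\<bar>a\<bar> + 1) / l)\<^sup>2 \<le> real \<kappa>"
      using elim(2) by linarith
    then have s: "(\<bar>a\<bar> + 1) / l \<le> s" "1 \<le> s"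
      using elim(2) unfolding s_def by (auto intro: real_le_rsqrt)
    have "\<bar>a\<bar> + 1 \<le> l * s"
      using s(1) l by (simp add: pos_divide_le_eq mult.commute)
    then have "(\<bar>a\<bar> + 1) * s \<le> l * s * s"
      using s(2) by (intro mult_right_mono) auto
    moreover have "s * s = real \<kappa>"
      by (simp add: s_def)
    moreover have "\<bar>a\<bar> * 1 \<le> \<bar>a\<bar> * s"
      using s(2) by (intro mult_left_mono) auto
    ultimately have "s \<le> l * real \<kappa> + a"
      by (simp add: algebra_simps)
    then show ?case
      using elim(1) by (simp add: s_def powr_half_sqrt)
  qed
qed

section \<open>Boolean circuits\<close>

definition wires :: "bits \<Rightarrow> bgate list \<Rightarrow> bits" where
  "wires x gs = foldl (\<lambda>ws g. ws @ [gate_val ws g]) x gs"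

lemma wires_Nil [simp]: "wires x [] = x"
  and wires_Cons [simp]: "wires x (g # gs) = wires (x @ [gate_val x g]) gs"
  and wires_append: "wires x (gs @ hs) = wires (wires x gs) hs"
  by (simp_all add: wires_def)

lemma beval_wires: "beval C x = map (\<lambda>i. wires x (fst C) ! i) (snd C)"
  by (simp add: beval_def wires_def)

lemma length_wires [simp]: "length (wires x gs) = length x + length gs"
  by (induction gs arbitrary: x) auto

lemma length_beval [simp]: "length (beval C x) = length (snd C)"
  by (simp add: beval_wires)

lemma wires_nth: "i < length x \<Longrightarrow> wires x gs ! i = x ! i"
  by (induction gs arbitrary: x) (auto simp: nth_append)

lemma take_wires: "take (length x) (wires x gs) = x"
  by (rule nth_equalityI) (auto simp: wires_nth)

lemma wires_consts: "wires x (map ConstG key) = x @ key"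
  by (induction key arbitrary: x) auto

lemma beval_hardwire: "beval (hardwire key C) x = beval C (x @ key)"
  by (simp add: beval_wires hardwire_def wires_append wires_consts)

text \<open>Recursive form of the gate condition of \<open>wf_circ\<close>: it splits over
  concatenated blocks, the second block starting at a later wire.\<close>

primrec gates_ok :: "nat \<Rightarrow> bgate list \<Rightarrow> bool" where
  "gates_ok w [] \<longleftrightarrow> True"
| "gates_ok w (g # gs) \<longleftrightarrow> gate_ok w g \<and> gates_ok (Suc w) gs"

lemma gates_ok_append: "gates_ok w (gs @ hs) \<longleftrightarrow> gates_ok w gs \<and> gates_ok (w + length gs) hs"
  by (induction gs arbitrary: w) auto

lemma gates_ok_conv: "gates_ok w gs \<longleftrightarrow> (\<forall>k < length gs. gate_ok (w + k) (gs ! k))"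
  by (induction gs arbitrary: w) (simp_all add: All_less_Suc2)

lemma gates_ok_consts: "gates_ok w (map ConstG key)"
  by (induction key arbitrary: w) auto

lemma wf_circ_gates_ok:
  "wf_circ lin lout C \<longleftrightarrow> gates_ok lin (fst C) \<and> (\<forall>i\<in>set (snd C). i < lin + bsize C) \<and> length (snd C) = lout"
  by (simp add: wf_circ_def gates_ok_conv bsize_def)

lemma wf_hardwire:
  assumes "wf_circ (lin + length key) lout C"
  shows "wf_circ lin lout (hardwire key C)"
  using assms by (simp add: wf_circ_gates_ok hardwire_def gates_ok_append gates_ok_consts bsize_def add.assoc)

lemma bsize_hardwire [simp]: "bsize (hardwire key C) = length key + bsize C"
  by (simp add: bsize_def hardwire_def)

lemma bsize_pad: "bsize C \<le> s \<Longrightarrow> bsize (pad s C) = s"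
  by (simp add: bsize_def pad_def)

lemma pad_pad: "bsize C \<le> s \<Longrightarrow> s \<le> t \<Longrightarrow> pad t (pad s C) = pad t C"
  by (simp add: bsize_def pad_def replicate_add[symmetric])

lemma wf_pad:
  assumes "wf_circ lin lout C"
  shows "wf_circ lin lout (pad s C)"
proof -
  have "gates_ok w (replicate k (ConstG False))" for w k
    by (induction k arbitrary: w) auto
  then show ?thesis
    using assms by (auto simp: wf_circ_gates_ok pad_def gates_ok_append bsize_def)
qed

lemma beval_pad:
  assumes "wf_circ (length x) lout C"
  shows "beval (pad s C) x = beval C x"
  using assms by (auto simp: beval_wires pad_def wires_append wires_nth wf_circ_def)

section \<open>Puncturing\<close>

text \<open>No gate of the block reads a wire produced inside the block, which is expressed by
  letting \<open>ys\<close> be arbitrary; hence the values can be listed gate by gate. It serves the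
  literals of \<open>eq_gates\<close> and the masks of \<open>puncture_circ\<close>.\<close>

lemma wires_independent:
  assumes "\<And>k ys. k < length gs \<Longrightarrow> length ys = k \<Longrightarrow> gate_val (x @ ys) (gs ! k) = bs k"
  shows "wires x gs = x @ map bs [0..<length gs]"
  using assms
proof (induction gs rule: rev_induct)
  case (snoc g gs)
  have "wires x gs = x @ map bs [0..<length gs]"
  proof (rule snoc.IH)
    fix k and ys :: bits assume "k < length gs" "length ys = k"
    then show "gate_val (x @ ys) (gs ! k) = bs k"
      using snoc.prems[of k ys] by (simp add: nth_append)
  qed
  moreover have "gate_val (x @ map bs [0..<length gs]) g = bs (length gs)"
    using snoc.prems[of "length gs" "map bs [0..<length gs]"] by simp
  ultimately show ?case
    by (simp add: wires_append)
qed simp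

text \<open>By induction on the length of the chain: gate k joins the previous conjunction, on wire
  w + n + k, with literal k on wire w + k. The constant on wire w + n is the empty
  conjunction.\<close>

lemma wires_conj_chain:
  assumes "length ws = w + n + 1" "k \<le> n" "ws ! (w + n)"
  shows "length (wires ws (map (\<lambda>i. AndG (w + n + i) (w + i)) [0..<k])) = w + n + 1 + k
    \<and> wires ws (map (\<lambda>i. AndG (w + n + i) (w + i)) [0..<k]) ! (w + n + k) = (\<forall>i<k. ws ! (w + i))"
  using assms(2)
proof (induction k)
  case 0
  then show ?case using assms by simp
next
  case (Suc k)
  let ?vs = "wires ws (map (\<lambda>i. AndG (w + n + i) (w + i)) [0..<k])"
  have IH: "length ?vs = w + n + 1 + k" "?vs ! (w + n + k) = (\<forall>i<k. ws ! (w + i))"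
    using Suc by auto
  have "?vs ! (w + k) = ws ! (w + k)"
    using Suc.prems assms(1) by (simp add: wires_nth)
  then show ?case
    using IH by (simp add: wires_append nth_append All_less_Suc conj_commute)
qed

lemma wires_eq_gates:
  assumes "length ws = w" "length z \<le> w"
  shows "wires ws (eq_gates w z) ! (w + 2 * length z) = (take (length z) ws = z)"
proof -
  let ?n = "length z"
  define lits where "lits = map (\<lambda>i. if z ! i then AndG i i else NotG i) [0..<?n]"
  have "wires ws lits = ws @ map (\<lambda>i. ws ! i = z ! i) [0..<length lits]"
  proof (rule wires_independent)
    fix k and ys :: bits assume "k < length lits" "length ys = k"
    then show "gate_val (ws @ ys) (lits ! k) = (ws ! k = z ! k)"
      using assms by (auto simp: lits_def nth_append)
  qed
  then have lits: "wires ws (lits @ [ConstG True]) = ws @ map (\<lambda>i. ws ! i = z ! i) [0..<?n] @ [True]"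
    by (simp add: wires_append lits_def)
  have "wires ws (eq_gates w z) =
      wires (ws @ map (\<lambda>i. ws ! i = z ! i) [0..<?n] @ [True]) (map (\<lambda>i. AndG (w + ?n + i) (w + i)) [0..<?n])"
    unfolding lits[symmetric] by (simp add: eq_gates_def wires_append lits_def)
  also have "\<dots> ! (w + ?n + ?n) = (\<forall>i<?n. (ws @ map (\<lambda>i. ws ! i = z ! i) [0..<?n] @ [True]) ! (w + i))"
    using wires_conj_chain[of "ws @ map (\<lambda>i. ws ! i = z ! i) [0..<?n] @ [True]" w ?n ?n] assms
    by (simp add: nth_append)
  also have "\<dots> = (\<forall>i<?n. ws ! i = z ! i)"
    using assms by (auto simp: nth_append)
  also have "\<dots> = (take ?n ws = z)"
    using assms by (auto simp: list_eq_iff_nth_eq)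
  finally show ?thesis
    by (simp add: mult_2 add.assoc)
qed

lemma length_eq_gates [simp]: "length (eq_gates w z) = 2 * length z + 1"
  by (simp add: eq_gates_def)

lemma eq_gates_ok:
  assumes "k < length (eq_gates w z)" "length z \<le> w"
  shows "gate_ok (w + k) (eq_gates w z ! k)"
  using assms by (auto simp: eq_gates_def nth_append nth_Cons split: nat.split)

lemma bsize_puncture:
  assumes "length z1 = lin" "length z2 = lin"
  shows "bsize (puncture_circ lin C z1 z2) = bsize C + puncture_overhead lin (length (snd C))"
  using assms by (simp add: bsize_def puncture_circ_def puncture_overhead_def Let_def)

lemma gates_ok_eq_gates: "length z \<le> w \<Longrightarrow> gates_ok w (eq_gates w z)"
  using eq_gates_ok unfolding gates_ok_conv by blast

lemma gates_ok_mask: "(\<forall>i\<in>set os. i < w) \<Longrightarrow> j < w \<Longrightarrow> gates_ok w (map (\<lambda>i. AndG i j) os)"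
  by (induction os arbitrary: w) (auto simp: less_Suc_eq)

lemma wf_puncture:
  assumes "wf_circ lin lout C" "length z1 = lin" "length z2 = lin"
  shows "wf_circ lin lout (puncture_circ lin C z1 z2)"
proof -
  \<comment> \<open>First wires of the three blocks behind C: the test for \<open>z1\<close>, the
    test for \<open>z2\<close>, and the two gates that combine them, followed by the masks.\<close>
  define w1 where "w1 = lin + bsize C"
  define w2 where "w2 = w1 + 2 * lin + 1"
  define w3 where "w3 = w2 + 2 * lin + 1"
  have *: "gates_ok lin (fst C)" "\<forall>i\<in>set (snd C). i < w1" "length (snd C) = lout"
    using assms(1) by (simp_all add: wf_circ_gates_ok w1_def)
  have p: "puncture_circ lin C z1 z2 =
      (fst C @ eq_gates w1 z1 @ eq_gates w2 z2 @ [OrG (w1 + 2 * lin) (w2 + 2 * lin), NotG w3] @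
        map (\<lambda>i. AndG i (w3 + 1)) (snd C), [w3 + 2 ..< w3 + 2 + length (snd C)])"
    by (simp only: puncture_circ_def Let_def w1_def w2_def w3_def)
  have w: "lin + length (fst C) = w1" "w1 + length (eq_gates w1 z1) = w2" "w2 + length (eq_gates w2 z2) = w3"
    using assms by (simp_all add: w1_def w2_def w3_def bsize_def)
  have ge: "lin \<le> w1" "w1 + 2 * lin < w2" "w2 + 2 * lin < w3"
    by (simp_all add: w1_def w2_def w3_def)
  have mask: "gates_ok (Suc (Suc w3)) (map (\<lambda>i. AndG i (w3 + 1)) (snd C))"
    using *(2) ge by (intro gates_ok_mask) (auto dest!: bspec)
  have "gates_ok lin (fst (puncture_circ lin C z1 z2))"
    unfolding p fst_conv gates_ok_append w
    using * ge assms mask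
    by (simp add: gates_ok_eq_gates)
  moreover have "lin + length (fst (puncture_circ lin C z1 z2)) = w3 + 2 + length (snd C)"
    unfolding p fst_conv length_append add.assoc[symmetric] w by simp
  ultimately show ?thesis
    using *(3) by (auto simp: wf_circ_gates_ok bsize_def p simp del: upt_Suc)
qed

lemma beval_puncture:
  assumes C: "wf_circ lin lout C" and z: "length z1 = lin" "length z2 = lin" and x: "length x = lin"
  shows "beval (puncture_circ lin C z1 z2) x = (if x \<in> {z1, z2} then bot_out lout else beval C x)"
proof -
  define w1 where "w1 = lin + bsize C"
  define w2 where "w2 = w1 + 2 * lin + 1"
  define w3 where "w3 = w2 + 2 * lin + 1"
  define ws1 where "ws1 = wires x (fst C)"
  define ws2 where "ws2 = wires ws1 (eq_gates w1 z1)"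
  define ws3 where "ws3 = wires ws2 (eq_gates w2 z2)"
  define ws4 where "ws4 = wires ws3 [OrG (w1 + 2 * lin) (w2 + 2 * lin), NotG w3]"
  have len: "length ws1 = w1" "length ws2 = w2" "length ws3 = w3" "length ws4 = w3 + 2"
    using x z by (simp_all add: ws1_def ws2_def ws3_def ws4_def w1_def w2_def w3_def bsize_def)
  have tk: "take lin ws1 = x" "take lin ws2 = x"
  proof -
    show "take lin ws1 = x"
      unfolding ws1_def x[symmetric] by (rule take_wires)
    then have "take lin (take w1 ws2) = x"
      unfolding ws2_def len(1)[symmetric] take_wires .
    then show "take lin ws2 = x"
      by (simp add: w1_def)
  qed
  have e1: "ws2 ! (w1 + 2 * lin) = (x = z1)"
    using wires_eq_gates[of ws1 w1 z1] len z tk by (simp add: ws2_def w1_def)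
  have e2: "ws3 ! (w2 + 2 * lin) = (x = z2)"
    using wires_eq_gates[of ws2 w2 z2] len z tk by (simp add: ws3_def w2_def w1_def)
  have e1': "ws3 ! (w1 + 2 * lin) = (x = z1)"
    using e1 len unfolding ws3_def by (simp add: wires_nth w2_def)
  have m: "ws4 ! (w3 + 1) = (x \<notin> {z1, z2})"
    using len e1' e2 by (simp add: ws4_def nth_append)
  have old: "ws4 ! i = ws1 ! i" if "i < w1" for i
    using that len by (simp add: ws4_def ws3_def ws2_def wires_nth w3_def w2_def nth_append)
  have outs: "i < w1" if "i \<in> set (snd C)" for i
    using that C by (auto simp: wf_circ_def w1_def bsize_def)
  \<comment> \<open>The masks read only the original outputs, below \<open>w1\<close>, and the bit
    on wire w3 + 1; both are older than the block.\<close>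
  have last: "wires ws4 (map (\<lambda>i. AndG i (w3 + 1)) (snd C)) =
      ws4 @ map (\<lambda>k. ws4 ! (snd C ! k) \<and> ws4 ! (w3 + 1)) [0..<length (map (\<lambda>i. AndG i (w3 + 1)) (snd C))]"
  proof (rule wires_independent)
    fix k and ys :: bits assume "k < length (map (\<lambda>i. AndG i (w3 + 1)) (snd C))"
    moreover from this have "snd C ! k < w1"
      by (simp add: outs)
    ultimately show "gate_val (ws4 @ ys) (map (\<lambda>i. AndG i (w3 + 1)) (snd C) ! k) =
        (ws4 ! (snd C ! k) \<and> ws4 ! (w3 + 1))"
      using len by (simp add: nth_append w3_def w2_def)
  qed
  have "wires x (fst (puncture_circ lin C z1 z2)) = wires ws4 (map (\<lambda>i. AndG i (w3 + 1)) (snd C))"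
    by (simp add: puncture_circ_def Let_def wires_append ws4_def ws3_def ws2_def ws1_def w1_def w2_def w3_def)
  moreover have "snd (puncture_circ lin C z1 z2) = [w3 + 2 ..< w3 + 2 + length (snd C)]"
    by (simp add: puncture_circ_def Let_def w1_def w2_def w3_def)
  ultimately have "beval (puncture_circ lin C z1 z2) x =
      map (\<lambda>i. (ws4 @ map (\<lambda>k. ws4 ! (snd C ! k) \<and> ws4 ! (w3 + 1)) [0..<length (snd C)]) ! i)
        [w3 + 2 ..< w3 + 2 + length (snd C)]"
    by (simp only: beval_wires last length_map)
  also have "\<dots> = map (\<lambda>k. ws1 ! (snd C ! k) \<and> x \<notin> {z1, z2}) [0..<length (snd C)]"
  proof (rule nth_equalityI; unfold length_map length_upt)
    fix i assume i: "i < w3 + 2 + length (snd C) - (w3 + 2)"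
    then have "snd C ! i < w1"
      by (simp add: outs)
    with i show "map (\<lambda>i. (ws4 @ map (\<lambda>k. ws4 ! (snd C ! k) \<and> ws4 ! (w3 + 1)) [0..<length (snd C)]) ! i)
        [w3 + 2 ..< w3 + 2 + length (snd C)] ! i =
      map (\<lambda>k. ws1 ! (snd C ! k) \<and> x \<notin> {z1, z2}) [0..<length (snd C)] ! i"
      using len(4) m old by (simp add: nth_append del: upt_Suc)
  qed simp
  also have "\<dots> = (if x \<in> {z1, z2} then bot_out lout else beval C x)"
  proof (cases "x \<in> {z1, z2}")
    case True
    then show ?thesis
      using C by (simp add: bot_out_def wf_circ_def map_replicate_const)
  next
    case False
    then have "map (\<lambda>k. ws1 ! (snd C ! k) \<and> x \<notin> {z1, z2}) [0..<length (snd C)] =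
        map (\<lambda>k. ws1 ! (snd C ! k)) [0..<length (snd C)]"
      by simp
    also have "\<dots> = beval C x"
      by (rule nth_equalityI) (simp_all add: beval_wires ws1_def)
    finally show ?thesis
      using False by simp
  qed
  finally show ?thesis .
qed

section \<open>Circuit descriptions\<close>

lemma length_onehot [simp]: "length (onehot w i) = w"
  by (simp add: onehot_def)

lemma length_gate_code [simp]: "length (gate_code w g) = 3 + 2 * w"
  by (cases g) simp_all

lemma length_concat_const:
  "\<forall>x\<in>set xs. length (f x) = c \<Longrightarrow> length (concat (map f xs)) = length xs * c"
  by (induction xs) auto

lemma length_code: "length (code lin C) = code_len lin (length (snd C)) (bsize C)"
proof -
  define w where "w = lin + bsize C"
  have "length (concat (map (gate_code w) (fst C))) = bsize C * (3 + 2 * w)"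
    unfolding bsize_def by (rule length_concat_const) simp
  moreover have "length (concat (map (onehot w) (snd C))) = length (snd C) * w"
    by (rule length_concat_const) simp
  ultimately show ?thesis
    by (simp add: code_def code_len_def w_def Let_def)
qed

fun gate_wires :: "bgate \<Rightarrow> nat set" where
  "gate_wires (ConstG b) = {}"
| "gate_wires (NotG i) = {i}"
| "gate_wires (AndG i j) = {i, j}"
| "gate_wires (OrG i j) = {i, j}"

lemma finite_gates: "finite {g. gate_wires g \<subseteq> {..<w}}"
proof (rule finite_subset)
  let ?G = "ConstG ` UNIV \<union> NotG ` {..<w} \<union> case_prod AndG ` ({..<w} \<times> {..<w}) \<union>
      case_prod OrG ` ({..<w} \<times> {..<w})"
  have "g \<in> ?G" if "gate_wires g \<subseteq> {..<w}" for g
  proof (cases g)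
    case (AndG i j)
    with that show ?thesis by (auto intro: image_eqI[of _ _ "(i, j)"])
  next
    case (OrG i j)
    with that show ?thesis by (auto intro: image_eqI[of _ _ "(i, j)"])
  qed (use that in simp_all)
  then show "{g. gate_wires g \<subseteq> {..<w}} \<subseteq> ?G"
    by blast
qed simp

text \<open>\<open>upo_win\<close> sums over the whole circuit class, and a sum over an infinite set
  would be 0. A single summand is a lower bound because a fixed size leaves finitely many wires,
  gates and output lists.\<close>

lemma finite_circuits: "finite (circuits lin lout s)"
proof (rule finite_subset)
  let ?G = "{gs. set gs \<subseteq> {g. gate_wires g \<subseteq> {..<lin + s}} \<and> length gs = s}"
  let ?O = "{os. set os \<subseteq> {..<lin + s} \<and> length os = lout}"
  show "finite (?G \<times> ?O)"
    using finite_lists_length_eq[OF finite_gates] finite_lists_length_eq[OF finite_lessThan]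
    by (rule finite_cartesian_product)
  have ok: "gate_wires g \<subseteq> {..<w}" if "gate_ok v g" "v \<le> w" for g v w
    using that by (cases g) simp_all
  have "C \<in> ?G \<times> ?O" if C: "C \<in> circuits lin lout s" for C
  proof -
    have len: "length (fst C) = s" "length (snd C) = lout"
      and gates: "\<And>k. k < s \<Longrightarrow> gate_ok (lin + k) (fst C ! k)"
      and outs: "\<And>i. i \<in> set (snd C) \<Longrightarrow> i < lin + s"
      using C by (simp_all add: circuits_def wf_circ_def bsize_def) blast
    have "gate_wires g \<subseteq> {..<lin + s}" if g: "g \<in> set (fst C)" for g
    proof -
      obtain k where "k < s" "g = fst C ! k"
        using g len by (metis in_set_conv_nth)
      then show ?thesis
        using ok[OF gates[of k]] by simp
    qed
    then show ?thesis
      using len outs by (cases C) (simp add: subset_iff)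
  qed
  then show "circuits lin lout s \<subseteq> ?G \<times> ?O"
    by (rule subsetI)
qed

section \<open>Locality and linearity of quantum circuits\<close>

lemma length_ins_at [simp]: "length (ins_at i a u) = Suc (length u)"
  by (simp add: ins_at_def)

lemma length_del_at [simp]: "i < length u \<Longrightarrow> length (del_at i u) = length u - 1"
  by (simp add: del_at_def)

lemma del_at_ins_at [simp]: "i \<le> length u \<Longrightarrow> del_at i (ins_at i a u) = u"
  by (simp add: ins_at_def del_at_def)

lemma nth_ins_at [simp]: "i \<le> length u \<Longrightarrow> ins_at i a u ! i = a"
  by (simp add: ins_at_def nth_append)

lemma ins_at_del_at [simp]: "i < length u \<Longrightarrow> ins_at i (u ! i) (del_at i u) = u"
  by (simp add: ins_at_def del_at_def id_take_nth_drop[symmetric])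

lemma ins_at_append1: "i \<le> length u \<Longrightarrow> ins_at i a (u @ v) = ins_at i a u @ v"
  by (simp add: ins_at_def)

lemma del_at_append1: "i < length u \<Longrightarrow> del_at i (u @ v) = del_at i u @ v"
  by (simp add: del_at_def)

lemma ins_at_append2: "ins_at (length u + i) a (u @ v) = u @ ins_at i a v"
  by (simp add: ins_at_def)

lemma del_at_append2: "del_at (length u + i) (u @ v) = u @ del_at i v"
  by (simp add: del_at_def)

text \<open>Entries at index pairs of the wrong length are junk, so states are compared on one length only.\<close>

definition eqst :: "nat \<Rightarrow> qstate \<Rightarrow> qstate \<Rightarrow> bool" where
  "eqst k \<rho> \<sigma> \<longleftrightarrow> (\<forall>u v. length u = k \<longrightarrow> length v = k \<longrightarrow> \<rho> u v = \<sigma> u v)"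

lemma eqstI: "(\<And>u v. length u = k \<Longrightarrow> length v = k \<Longrightarrow> \<rho> u v = \<sigma> u v) \<Longrightarrow> eqst k \<rho> \<sigma>"
  by (simp add: eqst_def)

lemma eqstD: "eqst k \<rho> \<sigma> \<Longrightarrow> length u = k \<Longrightarrow> length v = k \<Longrightarrow> \<rho> u v = \<sigma> u v"
  by (simp add: eqst_def)

lemma eqst_refl [simp]: "eqst k \<rho> \<rho>"
  by (simp add: eqst_def)

lemma eqst_trans [trans]: "eqst k \<rho> \<sigma> \<Longrightarrow> eqst k \<sigma> \<tau> \<Longrightarrow> eqst k \<rho> \<tau>"
  by (simp add: eqst_def)

lemma eqst_outcome: "eqst k \<rho> \<sigma> \<Longrightarrow> length z = k \<Longrightarrow> outcome \<rho> z = outcome \<sigma> z"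
  by (simp add: eqst_def outcome_def)

lemma apply_op_cong:
  assumes "op_ok w g" "eqst w \<rho> \<sigma>"
  shows "eqst (op_width w g) (apply_op g \<rho>) (apply_op g \<sigma>)"
  using assms by (cases g) (auto simp: eqst_def conj1_def intro!: sum.cong arg_cong2[where f = "(*)"])

lemma run_Nil [simp]: "run [] \<rho> = \<rho>"
  and run_Cons [simp]: "run (g # Q) \<rho> = run Q (apply_op g \<rho>)"
  and run_append: "run (Q @ R) \<rho> = run R (run Q \<rho>)"
  by (simp_all add: run_def)

lemma run_cong: "wf_qcirc a Q b \<Longrightarrow> eqst a \<rho> \<sigma> \<Longrightarrow> eqst b (run Q \<rho>) (run Q \<sigma>)"
  by (induction Q arbitrary: a \<rho> \<sigma>) (auto intro: apply_op_cong)

lemma wf_qcirc_append: "wf_qcirc a Q b \<Longrightarrow> wf_qcirc b R c \<Longrightarrow> wf_qcirc a (Q @ R) c"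
  by (induction Q arbitrary: a) auto

lemma wf_qcirc_width: "wf_qcirc a Q b \<Longrightarrow> b \<le> a + length Q"
proof (induction Q arbitrary: a)
  case (Cons g Q)
  have "op_width a g \<le> Suc a"
    by (cases g) auto
  then show ?case
    using Cons.IH[of "op_width a g"] Cons.prems by simp
qed simp

lemma op_local: "op_ok w g \<Longrightarrow> op_ok (w + c) g \<and> op_width (w + c) g = op_width w g + c"
  by (cases g) auto

lemma wf_qcirc_local: "wf_qcirc a Q b \<Longrightarrow> wf_qcirc (a + c) Q (b + c)"
  by (induction Q arbitrary: a) (auto simp: op_local)

lemma op_shift: "op_ok w g \<Longrightarrow> op_ok (d + w) (shift_op d g) \<and> op_width (d + w) (shift_op d g) = d + op_width w g"
  by (cases g) auto

lemma wf_qcirc_shift: "wf_qcirc a Q b \<Longrightarrow> wf_qcirc (d + a) (map (shift_op d) Q) (d + b)"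
  by (induction Q arbitrary: a) (auto simp: op_shift)

lemma wf_qcirc_par: "wf_qcirc a Q b \<Longrightarrow> wf_qcirc c R d \<Longrightarrow> wf_qcirc (a + c) (par b Q R) (b + d)"
  unfolding par_def by (rule wf_qcirc_append[OF wf_qcirc_local wf_qcirc_shift])

lemma apply_op_left:
  assumes "op_ok w g" "length u = op_width w g" "length v = op_width w g"
  shows "apply_op g \<rho> (u @ u') (v @ v') = apply_op g (\<lambda>s t. \<rho> (s @ u') (t @ v')) u v"
  using assms
  by (cases g) (auto simp: conj1_def nth_append list_update_append ins_at_append1 del_at_append1)

text \<open>An operation on the leading block leaves the remaining indices alone, so each slice of
  the matrix with fixed trailing indices evolves by itself. This covers entangled registers, for
  which the rules on product states say nothing.\<close>

lemma run_left:
  assumes "wf_qcirc a Q b" "length u = b" "length v = b"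
  shows "run Q \<rho> (u @ u') (v @ v') = run Q (\<lambda>s t. \<rho> (s @ u') (t @ v')) u v"
  using assms(1)
proof (induction Q arbitrary: a \<rho>)
  case (Cons g Q)
  have "run (g # Q) \<rho> (u @ u') (v @ v') = run Q (\<lambda>s t. apply_op g \<rho> (s @ u') (t @ v')) u v"
    using Cons.prems by (simp add: Cons.IH[of "op_width a g"])
  also have "\<dots> = run Q (apply_op g (\<lambda>s t. \<rho> (s @ u') (t @ v'))) u v"
    using Cons.prems assms
    by (intro eqstD[OF run_cong[of "op_width a g"]] eqstI apply_op_left[of a]) auto
  finally show ?case by simp
qed simp

lemma apply_op_right:
  assumes "op_ok w g" "length u' = op_width w g" "length v' = op_width w g" "length u = d" "length v = d"
  shows "apply_op (shift_op d g) \<rho> (u @ u') (v @ v') = apply_op g (\<lambda>s t. \<rho> (u @ s) (v @ t)) u' v'"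
proof -
  have [simp]: "ins_at (d + i) a (u @ s) = u @ ins_at i a s" "ins_at (d + i) a (v @ s) = v @ ins_at i a s"
    "del_at (d + i) (u @ s) = u @ del_at i s" "del_at (d + i) (v @ s) = v @ del_at i s" for i a s
    using assms(4,5) by (metis ins_at_append2 del_at_append2)+
  show ?thesis
    using assms by (cases g) (simp_all add: conj1_def nth_append list_update_append)
qed

lemma run_right:
  assumes "wf_qcirc a Q b" "length u' = b" "length v' = b" "length u = d" "length v = d"
  shows "run (map (shift_op d) Q) \<rho> (u @ u') (v @ v') = run Q (\<lambda>s t. \<rho> (u @ s) (v @ t)) u' v'"
  using assms(1)
proof (induction Q arbitrary: a \<rho>)
  case (Cons g Q)
  have "run (map (shift_op d) (g # Q)) \<rho> (u @ u') (v @ v') =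
      run Q (\<lambda>s t. apply_op (shift_op d g) \<rho> (u @ s) (v @ t)) u' v'"
    using Cons.prems by (simp add: Cons.IH[of "op_width a g"])
  also have "\<dots> = run Q (apply_op g (\<lambda>s t. \<rho> (u @ s) (v @ t))) u' v'"
    using Cons.prems assms
    by (intro eqstD[OF run_cong[of "op_width a g"]] eqstI apply_op_right[of a]) auto
  finally show ?case by simp
qed simp

lemma apply_op_sum: "apply_op g (\<lambda>u v. \<Sum>i\<in>I. f i u v) = (\<lambda>u v. \<Sum>i\<in>I. apply_op g (f i) u v)"
  by (cases g) (simp_all add: conj1_def fun_eq_iff sum.distrib sum_distrib_left sum_distrib_right UNIV_bool)

lemma run_sum: "run Q (\<lambda>u v. \<Sum>i\<in>I. f i u v) = (\<lambda>u v. \<Sum>i\<in>I. run Q (f i) u v)"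
  by (induction Q arbitrary: f) (simp_all add: apply_op_sum)

lemma apply_op_scale: "apply_op g (\<lambda>u v. c * \<rho> u v) = (\<lambda>u v. c * apply_op g \<rho> u v)"
  by (cases g) (simp_all add: conj1_def fun_eq_iff UNIV_bool algebra_simps)

lemma run_scale: "run Q (\<lambda>u v. c * \<rho> u v) = (\<lambda>u v. c * run Q \<rho> u v)"
  by (induction Q arbitrary: \<rho>) (simp_all add: apply_op_scale)

lemma tensor_assoc: "tensor a \<rho> (tensor b \<sigma> \<tau>) = tensor (a + b) (tensor a \<rho> \<sigma>) \<tau>"
  by (simp add: tensor_def fun_eq_iff take_drop mult.assoc min_def add.commute)

lemma tensor_append: "length u = k \<Longrightarrow> length v = k \<Longrightarrow> tensor k \<rho> \<sigma> (u @ u') (v @ v') = \<rho> u v * \<sigma> u' v'"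
  by (simp add: tensor_def)

lemma eqst_appendI:
  assumes "\<And>u u' v v'. length u = a \<Longrightarrow> length v = a \<Longrightarrow> length u' = b \<Longrightarrow> length v' = b \<Longrightarrow>
    \<rho> (u @ u') (v @ v') = \<sigma> (u @ u') (v @ v')"
  shows "eqst (a + b) \<rho> \<sigma>"
proof (rule eqstI)
  fix u v :: bits assume "length u = a + b" "length v = a + b"
  then show "\<rho> u v = \<sigma> u v"
    using assms[of "take a u" "take a v" "drop a u" "drop a v"] by simp
qed

lemma tensor_cong: "eqst a \<rho> \<rho>' \<Longrightarrow> eqst b \<sigma> \<sigma>' \<Longrightarrow> eqst (a + b) (tensor a \<rho> \<sigma>) (tensor a \<rho>' \<sigma>')"
  by (rule eqst_appendI) (simp add: tensor_append eqstD)

text \<open>A slice of a product state is a scalar multiple of the left factor, so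
  \<open>run_left\<close> and linearity apply.\<close>

lemma run_tensor_left:
  assumes "wf_qcirc a Q b"
  shows "eqst (b + c) (run Q (tensor a \<rho> \<sigma>)) (tensor b (run Q \<rho>) \<sigma>)"
proof (rule eqst_appendI)
  fix u u' v v' :: bits assume len: "length u = b" "length v = b" "length u' = c" "length v' = c"
  have "run Q (tensor a \<rho> \<sigma>) (u @ u') (v @ v') = run Q (\<lambda>s t. tensor a \<rho> \<sigma> (s @ u') (t @ v')) u v"
    by (rule run_left[OF assms len(1,2)])
  also have "\<dots> = run Q (\<lambda>s t. \<sigma> u' v' * \<rho> s t) u v"
    by (rule eqstD[OF run_cong[OF assms]]) (auto intro!: eqstI simp: tensor_append len)
  finally show "run Q (tensor a \<rho> \<sigma>) (u @ u') (v @ v') = tensor b (run Q \<rho>) \<sigma> (u @ u') (v @ v')"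
    by (simp add: run_scale tensor_append len)
qed

lemma run_tensor_right:
  assumes "wf_qcirc a Q b"
  shows "eqst (d + b) (run (map (shift_op d) Q) (tensor d \<rho> \<sigma>)) (tensor d \<rho> (run Q \<sigma>))"
proof (rule eqst_appendI)
  fix u u' v v' :: bits assume len: "length u = d" "length v = d" "length u' = b" "length v' = b"
  have "run (map (shift_op d) Q) (tensor d \<rho> \<sigma>) (u @ u') (v @ v') =
      run Q (\<lambda>s t. tensor d \<rho> \<sigma> (u @ s) (v @ t)) u' v'"
    by (rule run_right[OF assms len(3,4,1,2)])
  also have "(\<lambda>s t. tensor d \<rho> \<sigma> (u @ s) (v @ t)) = (\<lambda>s t. \<rho> u v * \<sigma> s t)"
    by (simp add: tensor_append len)
  finally show "run (map (shift_op d) Q) (tensor d \<rho> \<sigma>) (u @ u') (v @ v') =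
      tensor d \<rho> (run Q \<sigma>) (u @ u') (v @ v')"
    by (simp add: run_scale tensor_append len)
qed

lemma basis_tensor:
  assumes "length x = a"
  shows "eqst (a + b) (basis (x @ y)) (tensor a (basis x) (basis y))"
  by (rule eqst_appendI) (auto simp: tensor_append basis_def assms)

section \<open>Positivity and trace\<close>

text \<open>Positivity in Gram form, with a list of unnormalised vectors. Each operation acts on the
  vectors through its Kraus operators, so the form is preserved by construction and at all index
  lengths, without spectral arguments.\<close>

definition rank1_sum :: "(bits \<Rightarrow> complex) list \<Rightarrow> qstate" where
  "rank1_sum L = (\<lambda>u v. \<Sum>\<phi>\<leftarrow>L. \<phi> u * cnj (\<phi> v))"

definition positive :: "qstate \<Rightarrow> bool" where
  "positive \<rho> \<longleftrightarrow> (\<exists>L. \<rho> = rank1_sum L)"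

lemma rank1_sum_map: "rank1_sum (map f L) u v = (\<Sum>\<phi>\<leftarrow>L. f \<phi> u * cnj (f \<phi> v))"
  by (simp add: rank1_sum_def o_def)

lemma positive_basis: "positive (basis x)"
  unfolding positive_def
  by (rule exI[of _ "[\<lambda>u. if u = x then 1 else 0]"]) (auto simp: rank1_sum_def basis_def fun_eq_iff)

lemma positive_conj1:
  assumes "positive \<rho>"
  shows "positive (conj1 U i \<rho>)"
proof -
  obtain L where L: "\<rho> = rank1_sum L"
    using assms by (auto simp: positive_def)
  have "(\<Sum>a\<in>UNIV. \<Sum>b\<in>UNIV. U (u ! i) a * (\<Sum>\<phi>\<leftarrow>L. \<phi> (u[i := a]) * cnj (\<phi> (v[i := b]))) * cnj (U (v ! i) b)) =
      (\<Sum>\<phi>\<leftarrow>L. (\<Sum>a\<in>UNIV. U (u ! i) a * \<phi> (u[i := a])) * cnj (\<Sum>b\<in>UNIV. U (v ! i) b * \<phi> (v[i := b])))" for u v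
    by (induction L) (simp_all add: UNIV_bool algebra_simps)
  then have "conj1 U i \<rho> = rank1_sum (map (\<lambda>\<phi> u. \<Sum>a\<in>UNIV. U (u ! i) a * \<phi> (u[i := a])) L)"
    unfolding L conj1_def rank1_sum_map fun_eq_iff by (simp only: rank1_sum_def) simp
  then show ?thesis
    unfolding positive_def by blast
qed

lemma positive_apply_op:
  assumes "positive \<rho>"
  shows "positive (apply_op g \<rho>)"
proof -
  obtain L where L: "\<rho> = rank1_sum L"
    using assms by (auto simp: positive_def)
  have reindex: "positive (\<lambda>u v. \<rho> (f u) (f v))" for f
    unfolding positive_def
    by (rule exI[of _ "map (\<lambda>\<phi> u. \<phi> (f u)) L"]) (simp add: fun_eq_iff L rank1_sum_def o_def)
  show ?thesis
  proof (cases g)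
    case (Init i)
    have "(if a \<or> b then 0 else (\<Sum>\<phi>\<leftarrow>L. \<phi> s * cnj (\<phi> t))) =
        (\<Sum>\<phi>\<leftarrow>L. (if a then 0 else \<phi> s) * cnj (if b then 0 else \<phi> t))" for a b s t
      by (induction L) auto
    then show ?thesis
      unfolding positive_def Init
      by (intro exI[of _ "map (\<lambda>\<phi> u. if u ! i then 0 else \<phi> (del_at i u)) L"])
        (simp only: fun_eq_iff L rank1_sum_def apply_op.simps map_map o_def simp_thms)
  next
    \<comment> \<open>Tracing out has two Kraus operators, one for each value of the removed bit, so
      the list of vectors doubles.\<close>
    case (Discard i)
    show ?thesis
      unfolding positive_def Discard
      by (intro exI[of _ "map (\<lambda>\<phi> u. \<phi> (ins_at i False u)) L @ map (\<lambda>\<phi> u. \<phi> (ins_at i True u)) L"])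
        (simp add: fun_eq_iff L rank1_sum_def UNIV_bool o_def)
  qed (use assms reindex positive_conj1 in simp_all)
qed

lemma positive_run: "positive \<rho> \<Longrightarrow> positive (run Q \<rho>)"
  by (induction Q arbitrary: \<rho>) (simp_all add: positive_apply_op)

lemma positive_tensor:
  assumes "positive \<rho>" "positive \<sigma>"
  shows "positive (tensor k \<rho> \<sigma>)"
proof -
  obtain L M where L: "\<rho> = rank1_sum L" and M: "\<sigma> = rank1_sum M"
    using assms by (auto simp: positive_def)
  have *: "(\<Sum>\<psi>\<leftarrow>M. (p * \<psi> s) * (q * cnj (\<psi> t))) = (p * q) * (\<Sum>\<psi>\<leftarrow>M. \<psi> s * cnj (\<psi> t))" for p q s t
    by (induction M) (simp_all add: algebra_simps)
  have "(\<Sum>\<phi>\<leftarrow>L. \<phi> u * cnj (\<phi> v)) * (\<Sum>\<psi>\<leftarrow>M. \<psi> s * cnj (\<psi> t)) =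
      (\<Sum>\<chi>\<leftarrow>concat (map (\<lambda>\<phi>. map (\<lambda>\<psi> w. \<phi> (take k w) * \<psi> (drop k w)) M) L). \<chi> u' * cnj (\<chi> v'))"
    if "u = take k u'" "v = take k v'" "s = drop k u'" "t = drop k v'" for u v s t u' v'
    by (induction L) (simp_all add: o_def * that distrib_right)
  then have "tensor k \<rho> \<sigma> = rank1_sum (concat (map (\<lambda>\<phi>. map (\<lambda>\<psi> w. \<phi> (take k w) * \<psi> (drop k w)) M) L))"
    unfolding tensor_def L M rank1_sum_def fun_eq_iff by simp
  then show ?thesis
    unfolding positive_def by blast
qed

lemma positive_outcome:
  assumes "positive \<rho>"
  shows "outcome \<rho> z \<ge> 0"
proof -
  obtain L where L: "\<rho> = rank1_sum L"
    using assms by (auto simp: positive_def)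
  have "Re (\<Sum>\<phi>\<leftarrow>L. \<phi> z * cnj (\<phi> z)) \<ge> 0"
    by (induction L) (simp_all add: complex_mult_cnj)
  then show ?thesis
    by (simp add: outcome_def L rank1_sum_def)
qed

definition qtrace :: "nat \<Rightarrow> qstate \<Rightarrow> complex" where
  "qtrace k \<rho> = (\<Sum>u\<in>bitstrings k. \<rho> u u)"

lemma sum_outcome: "(\<Sum>z\<in>bitstrings k. outcome \<rho> z) = Re (qtrace k \<rho>)"
  by (simp add: outcome_def qtrace_def)

lemma qtrace_basis: "length x = k \<Longrightarrow> qtrace k (basis x) = 1"
  by (simp add: qtrace_def basis_def)

lemma qtrace_tensor: "qtrace (a + b) (tensor a \<rho> \<sigma>) = qtrace a \<rho> * qtrace b \<sigma>"
  by (simp add: qtrace_def sum_bitstrings_append tensor_append sum_product)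

lemma sum_bitstrings_ins_at:
  assumes "i \<le> k"
  shows "(\<Sum>u\<in>bitstrings (Suc k). f u) = (\<Sum>u\<in>bitstrings k. \<Sum>a\<in>UNIV. f (ins_at i a u))"
proof -
  have "(\<Sum>u\<in>bitstrings (Suc k). f u) = (\<Sum>p\<in>bitstrings k \<times> UNIV. f (ins_at i (snd p) (fst p)))"
    by (rule sum.reindex_bij_witness[of _ "\<lambda>p. ins_at i (snd p) (fst p)" "\<lambda>u. (del_at i u, u ! i)"])
      (use assms in auto)
  then show ?thesis
    by (simp add: sum.cartesian_product case_prod_beta)
qed

section \<open>Classical circuits\<close>

text \<open>
  X, CNOT, Toffoli, insertion and tracing out map basis states to basis states, and on the
  diagonal of an arbitrary state they act as the pushforward under that map.  Hence measuring the
  output of a quantum circuit followed by such gates is postprocessing of its measured output.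
\<close>

fun cl_op :: "qop \<Rightarrow> bits \<Rightarrow> bits" where
  "cl_op (XG i) u = u[i := (\<not> u ! i)]"
| "cl_op (CX i j) u = u[j := (u ! j \<noteq> u ! i)]"
| "cl_op (CCX i j k) u = u[k := (u ! k \<noteq> (u ! i \<and> u ! j))]"
| "cl_op (Init i) u = ins_at i False u"
| "cl_op (Discard i) u = del_at i u"
| "cl_op _ u = u"

fun classical_op :: "qop \<Rightarrow> bool" where
  "classical_op (HG i) = False"
| "classical_op (TG i) = False"
| "classical_op _ = True"

text \<open>The gates that permute basis states. Each is an involution, so reading indices through
  \<open>cl_op\<close>, as \<open>apply_op\<close> does, agrees with moving basis states by
  it.\<close>

fun perm_op :: "qop \<Rightarrow> bool" where
  "perm_op (XG i) = True"
| "perm_op (CX i j) = True"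
| "perm_op (CCX i j k) = True"
| "perm_op _ = False"

definition classical :: "qcirc \<Rightarrow> bool" where
  "classical Q \<longleftrightarrow> (\<forall>g\<in>set Q. classical_op g)"

definition cl_run :: "qcirc \<Rightarrow> bits \<Rightarrow> bits" where
  "cl_run Q x = fold cl_op Q x"

lemma cl_run_Nil [simp]: "cl_run [] x = x"
  and cl_run_Cons [simp]: "cl_run (g # Q) x = cl_run Q (cl_op g x)"
  and cl_run_append: "cl_run (Q @ R) x = cl_run R (cl_run Q x)"
  by (simp_all add: cl_run_def)

lemma classical_Nil [simp]: "classical []"
  and classical_Cons [simp]: "classical (g # Q) \<longleftrightarrow> classical_op g \<and> classical Q"
  and classical_append [simp]: "classical (Q @ R) \<longleftrightarrow> classical Q \<and> classical R"
  by (auto simp: classical_def)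

lemma classical_shift [simp]: "classical (map (shift_op d) Q) \<longleftrightarrow> classical Q"
proof -
  have "classical_op (shift_op d g) = classical_op g" for g
    by (cases g) auto
  then show ?thesis by (simp add: classical_def)
qed

lemma length_cl_op: "op_ok w g \<Longrightarrow> length x = w \<Longrightarrow> length (cl_op g x) = op_width w g"
  by (cases g) auto

lemma cl_op_left: "op_ok w g \<Longrightarrow> length x = w \<Longrightarrow> cl_op g (x @ y) = cl_op g x @ y"
  by (cases g) (auto simp: nth_append list_update_append ins_at_append1 del_at_append1)

lemma cl_run_left: "wf_qcirc a Q b \<Longrightarrow> length x = a \<Longrightarrow> cl_run Q (x @ y) = cl_run Q x @ y"
  by (induction Q arbitrary: a x) (auto simp: cl_op_left length_cl_op)

lemma cl_op_right: "cl_op (shift_op (length x) g) (x @ y) = x @ cl_op g y"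
  by (cases g) (auto simp: nth_append list_update_append ins_at_append2 del_at_append2)

lemma cl_run_right: "length x = d \<Longrightarrow> cl_run (map (shift_op d) Q) (x @ y) = x @ cl_run Q y"
  by (induction Q arbitrary: y) (auto simp: cl_op_right)

text \<open>Common core of X, CNOT and Toffoli: if recomputing the bit after the update restores the
  old bit, the update is its own inverse.\<close>

lemma list_update_invol:
  assumes "length u = length x" "i < length x" "f (x[i := f x]) = x ! i" "f (u[i := f u]) = u ! i"
  shows "u[i := f u] = x \<longleftrightarrow> u = x[i := f x]"
  using assms by (metis list_update_id list_update_overwrite)

lemma cl_op_invol:
  assumes "op_ok w g" "perm_op g" "length x = w" "length u = w"
  shows "cl_op g u = x \<longleftrightarrow> u = cl_op g x"
proof (cases g)
  case (XG i)
  with assms show ?thesis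
    unfolding XG cl_op.simps by (intro list_update_invol) simp_all
next
  case (CX i j)
  then have ij: "i < w" "j < w" "i \<noteq> j"
    using assms(1) by simp_all
  show ?thesis
    unfolding CX cl_op.simps
    by (rule list_update_invol) (use ij assms(3,4) in \<open>simp_all, (argo)+\<close>)
next
  case (CCX i j k)
  then have ij: "i < w" "j < w" "k < w" "i \<noteq> j" "i \<noteq> k" "j \<noteq> k"
    using assms(1) by simp_all
  show ?thesis
    unfolding CCX cl_op.simps
    by (rule list_update_invol) (use ij assms(3,4) in \<open>simp_all, (argo)+\<close>)
qed (use assms in simp_all)

lemma apply_op_cl_op:
  assumes "perm_op g"
  shows "apply_op g \<rho> = (\<lambda>u v. \<rho> (cl_op g u) (cl_op g v))"
  using assms by (cases g) (simp_all add: fun_eq_iff)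

lemma del_at_eq_iff: "i < length u \<Longrightarrow> length u = Suc (length x) \<Longrightarrow> \<not> u ! i \<Longrightarrow> del_at i u = x \<longleftrightarrow> u = ins_at i False x"
  using ins_at_del_at[of i u] del_at_ins_at[of i x False] by auto

lemma ins_at_eq_iff:
  assumes "i \<le> length s" "length x = Suc (length s)"
  shows "ins_at i a s = x \<longleftrightarrow> a = x ! i \<and> s = del_at i x"
proof
  assume x: "ins_at i a s = x"
  show "a = x ! i \<and> s = del_at i x"
    unfolding x[symmetric] using assms(1) by simp
next
  assume *: "a = x ! i \<and> s = del_at i x"
  have "ins_at i (x ! i) (del_at i x) = x"
    using assms by (intro ins_at_del_at) simp
  with * show "ins_at i a s = x"
    by (simp only:)
qed

lemma apply_op_basis:
  assumes "op_ok w g" "classical_op g" "length x = w"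
  shows "eqst (op_width w g) (apply_op g (basis x)) (basis (cl_op g x))"
proof (rule eqstI)
  fix u v :: bits assume len: "length u = op_width w g" "length v = op_width w g"
  consider (inv) "perm_op g" | (init) i where "g = Init i" | (disc) i where "g = Discard i"
    using assms(2) by (cases g) auto
  then show "apply_op g (basis x) u v = basis (cl_op g x) u v"
  proof cases
    case inv
    then have "op_width w g = w"
      by (cases g) auto
    then show ?thesis
      using inv assms len cl_op_invol[OF assms(1) inv assms(3)] by (simp add: apply_op_cl_op basis_def)
  next
    case init
    then have i: "i \<le> w"
      using assms by simp
    have "s = ins_at i False x \<longleftrightarrow> \<not> s ! i \<and> del_at i s = x" if "length s = Suc w" for s
      using that i assms(3) del_at_eq_iff[of i s x] by auto
    then show ?thesis
      using len by (auto simp: init basis_def)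
  next
    case disc
    then have i: "i < w"
      using assms by simp
    have *: "ins_at i a s = x \<longleftrightarrow> a = x ! i \<and> s = del_at i x" if "length s = w - 1" for a s
      using that i assms(3) by (intro ins_at_eq_iff) auto
    show ?thesis
      using *[of u] *[of v] len by (simp add: disc basis_def UNIV_bool)
  qed
qed

lemma run_basis:
  assumes "wf_qcirc a Q b" "classical Q" "length x = a"
  shows "eqst b (run Q (basis x)) (basis (cl_run Q x))"
  using assms
proof (induction Q arbitrary: a x)
  case (Cons g Q)
  have "eqst b (run Q (apply_op g (basis x))) (run Q (basis (cl_op g x)))"
    using Cons.prems by (intro run_cong[of "op_width a g"] apply_op_basis) auto
  also have "eqst b (run Q (basis (cl_op g x))) (basis (cl_run Q (cl_op g x)))"
    using Cons.prems by (intro Cons.IH[of "op_width a g"]) (auto simp: length_cl_op)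
  finally show ?case by simp
qed simp

text \<open>A permutation gate moves row and column index together, \<open>Init\<close> gives weight
  0 to a set new bit, and \<open>Discard\<close> adds exactly the two preimages; off-diagonal
  entries never reach the diagonal.\<close>

lemma apply_op_diag:
  assumes "op_ok w g" "classical_op g" "length z = op_width w g"
  shows "apply_op g \<rho> z z = (\<Sum>x\<in>bitstrings w. if cl_op g x = z then \<rho> x x else 0)"
proof -
  consider (inv) "perm_op g" | (init) i where "g = Init i" | (disc) i where "g = Discard i"
    using assms(2) by (cases g) auto
  then show ?thesis
  proof cases
    case inv
    then have w: "op_width w g = w"
      by (cases g) auto
    then have "(\<Sum>x\<in>bitstrings w. if cl_op g x = z then \<rho> x x else 0) =
        (\<Sum>x\<in>bitstrings w. if x = cl_op g z then \<rho> x x else 0)"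
      using assms by (intro sum.cong refl) (simp add: cl_op_invol[OF assms(1) inv])
    also have "\<dots> = apply_op g \<rho> z z"
      using assms w length_cl_op[of w g z] by (simp add: apply_op_cl_op[OF inv])
    finally show ?thesis ..
  next
    case init
    then have i: "i \<le> w" "length z = Suc w"
      using assms by simp_all
    have "(\<Sum>x\<in>bitstrings w. if cl_op g x = z then \<rho> x x else 0) =
        (\<Sum>x\<in>bitstrings w. if x = del_at i z then (if z ! i then 0 else \<rho> x x) else 0)"
      using i by (intro sum.cong refl) (simp add: init ins_at_eq_iff)
    then show ?thesis
      using i by (simp add: init)
  next
    case disc
    then have i: "i < w" "length z = w - 1"
      using assms by simp_all
    then obtain w' where w': "w = Suc w'" "i \<le> w'"
      by (cases w) auto
    have "(\<Sum>x\<in>bitstrings w. if cl_op g x = z then \<rho> x x else 0) =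
        (\<Sum>x\<in>bitstrings w'. if x = z then \<Sum>a\<in>UNIV. \<rho> (ins_at i a x) (ins_at i a x) else 0)"
      unfolding w'(1) sum_bitstrings_ins_at[OF w'(2)]
      using w' by (intro sum.cong[OF refl, of "bitstrings w'"]) (simp add: disc)
    then show ?thesis
      using i w' by (simp add: disc)
  qed
qed

lemma run_diag:
  assumes "wf_qcirc a Q b" "classical Q" "length z = b"
  shows "run Q \<rho> z z = (\<Sum>x\<in>bitstrings a. if cl_run Q x = z then \<rho> x x else 0)"
  using assms
proof (induction Q arbitrary: a \<rho>)
  case (Cons g Q)
  let ?w = "op_width a g"
  have "run (g # Q) \<rho> z z = (\<Sum>y\<in>bitstrings ?w. if cl_run Q y = z then apply_op g \<rho> y y else 0)"
    using Cons.prems by (simp add: Cons.IH[of ?w])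
  also have "\<dots> = (\<Sum>y\<in>bitstrings ?w. \<Sum>x\<in>bitstrings a.
      if cl_op g x = y then (if cl_run Q y = z then \<rho> x x else 0) else 0)"
  proof (rule sum.cong[OF refl])
    fix y assume "y \<in> bitstrings ?w"
    then show "(if cl_run Q y = z then apply_op g \<rho> y y else 0) =
        (\<Sum>x\<in>bitstrings a. if cl_op g x = y then (if cl_run Q y = z then \<rho> x x else 0) else 0)"
      using Cons.prems by (cases "cl_run Q y = z") (simp_all add: apply_op_diag[of a] cong: if_cong)
  qed
  also have "\<dots> = (\<Sum>x\<in>bitstrings a. \<Sum>y\<in>bitstrings ?w.
      if cl_op g x = y then (if cl_run Q y = z then \<rho> x x else 0) else 0)"
    by (rule sum.swap)
  also have "\<dots> = (\<Sum>x\<in>bitstrings a. if cl_run (g # Q) x = z then \<rho> x x else 0)"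
    using Cons.prems by (intro sum.cong refl) (simp add: length_cl_op)
  finally show ?case .
qed simp

lemma qtrace_classical_op:
  assumes "op_ok w g" "classical_op g"
  shows "qtrace (op_width w g) (apply_op g \<rho>) = qtrace w \<rho>"
proof -
  have "qtrace (op_width w g) (apply_op g \<rho>) =
      (\<Sum>y\<in>bitstrings (op_width w g). \<Sum>x\<in>bitstrings w. if cl_op g x = y then \<rho> x x else 0)"
    using assms by (simp add: qtrace_def apply_op_diag)
  also have "\<dots> = (\<Sum>x\<in>bitstrings w. \<Sum>y\<in>bitstrings (op_width w g). if cl_op g x = y then \<rho> x x else 0)"
    by (rule sum.swap)
  also have "\<dots> = qtrace w \<rho>"
    unfolding qtrace_def using assms by (intro sum.cong refl) (simp add: length_cl_op)
  finally show ?thesis .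
qed

lemma list_update_ins_at [simp]: "i \<le> length u \<Longrightarrow> (ins_at i a u)[i := b] = ins_at i b u"
  by (simp add: ins_at_def list_update_append)

text \<open>The hypothesis on \<open>U\<close> is orthonormality of its columns. Grouping the
  indices that differ only in bit \<open>i\<close> reduces the trace to sums over that bit, where
  the columns contract.\<close>

lemma qtrace_conj1:
  assumes "i < w" "\<And>a b. (\<Sum>c\<in>UNIV. U c a * cnj (U c b)) = (if a = b then 1 else 0)"
  shows "qtrace w (conj1 U i \<rho>) = qtrace w \<rho>"
proof -
  obtain w' where w': "w = Suc w'" "i \<le> w'"
    using assms(1) by (cases w) auto
  have "(\<Sum>c\<in>UNIV. conj1 U i \<rho> (ins_at i c u) (ins_at i c u)) = (\<Sum>c\<in>UNIV. \<rho> (ins_at i c u) (ins_at i c u))"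
    if "u \<in> bitstrings w'" for u
  proof -
    have "(\<Sum>c\<in>UNIV. conj1 U i \<rho> (ins_at i c u) (ins_at i c u)) =
        (\<Sum>c\<in>UNIV. \<Sum>a\<in>UNIV. \<Sum>b\<in>UNIV. U c a * \<rho> (ins_at i a u) (ins_at i b u) * cnj (U c b))"
      using that w'(2) by (simp add: conj1_def)
    also have "\<dots> = (\<Sum>a\<in>UNIV. \<Sum>b\<in>UNIV. \<rho> (ins_at i a u) (ins_at i b u) * (\<Sum>c\<in>UNIV. U c a * cnj (U c b)))"
      by (simp add: UNIV_bool distrib_left mult_ac add_ac)
    also have "\<dots> = (\<Sum>c\<in>UNIV. \<rho> (ins_at i c u) (ins_at i c u))"
      unfolding assms(2) by (simp add: UNIV_bool)
    finally show ?thesis .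
  qed
  then show ?thesis
    unfolding qtrace_def w'(1) sum_bitstrings_ins_at[OF w'(2)] by (rule sum.cong[OF refl])
qed

lemma qtrace_apply_op:
  assumes "op_ok w g"
  shows "qtrace (op_width w g) (apply_op g \<rho>) = qtrace w \<rho>"
proof (cases "classical_op g")
  case True
  with assms show ?thesis by (rule qtrace_classical_op)
next
  case False
  have h: "(\<Sum>c\<in>UNIV. h_mat c a * cnj (h_mat c b)) = (if a = b then 1 else 0)" for a b
    by (simp add: UNIV_bool h_mat_def complex_eq_iff field_simps)
  have t: "(\<Sum>c\<in>UNIV. t_mat c a * cnj (t_mat c b)) = (if a = b then 1 else 0)" for a b
    by (auto simp: UNIV_bool t_mat_def cis_cnj cis_mult)
  from False assms show ?thesis
    by (cases g) (simp_all add: qtrace_conj1 h t)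
qed

lemma qtrace_run: "wf_qcirc a Q b \<Longrightarrow> qtrace b (run Q \<rho>) = qtrace a \<rho>"
  by (induction Q arbitrary: a \<rho>) (auto simp: qtrace_apply_op)

lemma out_prob_nonneg: "out_prob Q x z \<ge> 0"
  by (simp add: out_prob_def positive_outcome positive_run positive_basis)

lemma sum_out_prob:
  assumes "wf_qcirc a Q b" "length x = a"
  shows "(\<Sum>z\<in>bitstrings b. out_prob Q x z) = 1"
  by (simp add: out_prob_def sum_outcome qtrace_run[OF assms(1)] qtrace_basis assms(2))

section \<open>Compiling Boolean circuits\<close>

text \<open>\<open>CCX\<close> requires three distinct qubits, so a conjunction or disjunction of a
  wire with itself becomes a plain copy. Otherwise a disjunction is computed as a + b + a b modulo
  2.\<close>

fun gate_ops :: "nat \<Rightarrow> bgate \<Rightarrow> qcirc" where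
  "gate_ops w (ConstG b) = Init w # (if b then [XG w] else [])"
| "gate_ops w (NotG i) = [Init w, CX i w, XG w]"
| "gate_ops w (AndG i j) = Init w # (if i = j then [CX i w] else [CCX i j w])"
| "gate_ops w (OrG i j) = Init w # (if i = j then [CX i w] else [CX i w, CX j w, CCX i j w])"

primrec gates_ops :: "nat \<Rightarrow> bgate list \<Rightarrow> qcirc" where
  "gates_ops w [] = []"
| "gates_ops w (g # gs) = gate_ops w g @ gates_ops (Suc w) gs"

primrec copy_ops :: "nat \<Rightarrow> nat list \<Rightarrow> qcirc" where
  "copy_ops w [] = []"
| "copy_ops w (i # is) = Init w # CX i w # copy_ops (Suc w) is"

text \<open>The outputs are copied behind all wires before everything in front is discarded, so
  output lists may repeat or permute wires. Discarding dephases the input; this does no harm, as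
  compiled circuits are applied to basis states or followed through diagonal entries.\<close>

definition compile :: "nat \<Rightarrow> bcirc \<Rightarrow> qcirc" where
  "compile lin C = gates_ops lin (fst C) @ copy_ops (lin + bsize C) (snd C) @
     replicate (lin + bsize C) (Discard 0)"

lemma ins_at_end [simp]: "ins_at (length x) a x = x @ [a]"
  by (simp add: ins_at_def)

lemma cl_run_gate_ops: "gate_ok (length x) g \<Longrightarrow> cl_run (gate_ops (length x) g) x = x @ [gate_val x g]"
  by (cases g) (auto simp: nth_append list_update_append)

lemma wf_gate_ops: "gate_ok w g \<Longrightarrow> wf_qcirc w (gate_ops w g) (Suc w)"
  by (cases g) auto

lemma classical_gate_ops: "classical (gate_ops w g)"
  by (cases g) auto

lemma length_gate_ops: "length (gate_ops w g) \<le> 4"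
  by (cases g) auto

lemma cl_run_gates_ops: "gates_ok (length x) gs \<Longrightarrow> cl_run (gates_ops (length x) gs) x = wires x gs"
proof (induction gs arbitrary: x)
  case (Cons g gs)
  then show ?case
    using Cons.IH[of "x @ [gate_val x g]"] by (simp add: cl_run_append cl_run_gate_ops)
qed simp

lemma wf_gates_ops: "gates_ok w gs \<Longrightarrow> wf_qcirc w (gates_ops w gs) (w + length gs)"
proof (induction gs arbitrary: w)
  case (Cons g gs)
  then have "wf_qcirc w (gate_ops w g) (Suc w)" "wf_qcirc (Suc w) (gates_ops (Suc w) gs) (Suc w + length gs)"
    by (simp_all only: wf_gate_ops gates_ok.simps)
  then show ?case
    using wf_qcirc_append by simp
qed simp

lemma classical_gates_ops: "classical (gates_ops w gs)"
  by (induction gs arbitrary: w) (simp_all add: classical_gate_ops)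

lemma length_gates_ops: "length (gates_ops w gs) \<le> 4 * length gs"
proof (induction gs arbitrary: w)
  case (Cons g gs)
  from Cons.IH[of "Suc w"] length_gate_ops[of w g] show ?case
    by (simp add: add_mono)
qed simp

lemma cl_run_copy_ops:
  "\<forall>i\<in>set is. i < length x \<Longrightarrow> cl_run (copy_ops (length x) is) x = x @ map (\<lambda>i. x ! i) is"
proof (induction "is" arbitrary: x)
  case (Cons i "is")
  have "cl_run (copy_ops (Suc (length x)) is) (x @ [x ! i]) = (x @ [x ! i]) @ map (\<lambda>j. (x @ [x ! i]) ! j) is"
    using Cons.IH[of "x @ [x ! i]"] Cons.prems by (simp add: less_SucI)
  also have "map (\<lambda>j. (x @ [x ! i]) ! j) is = map (\<lambda>j. x ! j) is"
    using Cons.prems by (simp add: nth_append)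
  finally show ?case
    using Cons.prems by (simp add: nth_append list_update_append)
qed simp

lemma wf_copy_ops: "\<forall>i\<in>set is. i < w \<Longrightarrow> wf_qcirc w (copy_ops w is) (w + length is)"
proof (induction "is" arbitrary: w)
  case (Cons i "is")
  then show ?case
    using Cons.IH[of "Suc w"] by (simp add: less_SucI)
qed simp

lemma classical_copy_ops: "classical (copy_ops w is)"
  by (induction "is" arbitrary: w) simp_all

lemma length_copy_ops: "length (copy_ops w is) = 2 * length is"
  by (induction "is" arbitrary: w) simp_all

lemma cl_run_discards: "cl_run (replicate k (Discard 0)) x = drop k x"
proof (induction k arbitrary: x)
  case (Suc k)
  then show ?case
    by (simp add: del_at_def drop_Suc)
qed simp

lemma wf_discards: "wf_qcirc (k + w) (replicate k (Discard 0)) w"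
  by (induction k) simp_all

lemma compile_correct:
  assumes "wf_circ lin lout C" "length x = lin"
  shows "cl_run (compile lin C) x = beval C x"
proof -
  let ?ws = "wires x (fst C)"
  have *: "gates_ok (length x) (fst C)" "length ?ws = lin + bsize C" "\<forall>i\<in>set (snd C). i < length ?ws"
    using assms by (simp_all add: wf_circ_gates_ok bsize_def)
  have "cl_run (compile lin C) x = drop (lin + bsize C) (cl_run (copy_ops (length ?ws) (snd C)) ?ws)"
    using *(2) cl_run_gates_ops[OF *(1)] assms(2) by (simp add: compile_def cl_run_append cl_run_discards)
  also have "\<dots> = beval C x"
    unfolding cl_run_copy_ops[OF *(3)] beval_wires *(2)[symmetric] by (simp del: length_wires)
  finally show ?thesis .
qed

lemma wf_compile:
  assumes "wf_circ lin lout C"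
  shows "wf_qcirc lin (compile lin C) lout"
proof -
  have *: "gates_ok lin (fst C)" "\<forall>i\<in>set (snd C). i < lin + bsize C" "length (snd C) = lout"
    using assms by (simp_all add: wf_circ_gates_ok)
  then show ?thesis
    using wf_gates_ops[OF *(1)] wf_copy_ops[OF *(2)] wf_discards[of "lin + bsize C" lout]
    unfolding compile_def by (auto intro: wf_qcirc_append simp: bsize_def)
qed

lemma classical_compile: "classical (compile lin C)"
  by (simp add: compile_def classical_gates_ops classical_copy_ops) (simp add: classical_def)

lemma length_compile: "length (compile lin C) \<le> 5 * bsize C + 2 * length (snd C) + lin"
  using length_gates_ops[of lin "fst C"] by (simp add: compile_def length_copy_ops bsize_def)

lemma run_compile_basis:
  assumes "wf_circ lin lout C" "length x = lin"
  shows "eqst lout (run (compile lin C) (basis x)) (basis (beval C x))"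
  using run_basis[OF wf_compile[OF assms(1)] classical_compile assms(2)] compile_correct[OF assms] by simp

section \<open>Elementary circuits: constants, copying, comparison\<close>

definition wiring :: "nat list \<Rightarrow> bcirc" where
  "wiring is = ([], is)"

lemma wf_wiring: "\<forall>i\<in>set is. i < lin \<Longrightarrow> wf_circ lin (length is) (wiring is)"
  by (simp add: wf_circ_def wiring_def)

lemma beval_wiring: "beval (wiring is) x = map (\<lambda>i. x ! i) is"
  by (simp add: beval_wires wiring_def)

definition const_circ :: "bits \<Rightarrow> bcirc" where
  "const_circ z = hardwire z (wiring [0..<length z])"

lemma wf_const: "wf_circ 0 (length z) (const_circ z)"
  unfolding const_circ_def by (rule wf_hardwire) (simp add: wf_circ_def wiring_def)

lemma beval_const: "beval (const_circ z) [] = z"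
  by (simp add: const_circ_def beval_hardwire beval_wiring map_nth)

lemma bsize_const: "bsize (const_circ z) = length z" "length (snd (const_circ z)) = length z"
  by (simp_all add: const_circ_def wiring_def bsize_def hardwire_def)

definition dup_circ :: "nat \<Rightarrow> bcirc" where
  "dup_circ m = wiring ([0..<m] @ [0..<m])"

lemma wf_dup: "wf_circ m (m + m) (dup_circ m)"
  unfolding dup_circ_def using wf_wiring[of "[0..<m] @ [0..<m]" m] by simp

lemma bsize_dup: "bsize (dup_circ m) = 0" "length (snd (dup_circ m)) = 2 * m"
  by (simp_all add: dup_circ_def wiring_def bsize_def)

lemma beval_dup: "length y = m \<Longrightarrow> beval (dup_circ m) y = y @ y"
  by (auto simp: dup_circ_def beval_wiring map_nth)

text \<open>Five gates per position: \<open>a \<and> b\<close>, \<open>a \<or> b\<close>, \<open>\<not> (a \<or> b)\<close>, their disjunction, and the running conjunction.\<close>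

definition neq_step :: "nat \<Rightarrow> nat \<Rightarrow> bgate list" where
  "neq_step m i = (let w = 2 * m + 1 + 5 * i in
     [AndG i (m + i), OrG i (m + i), NotG (w + 1), OrG w (w + 2), AndG (w - 1) (w + 3)])"

definition neq_circ :: "nat \<Rightarrow> bcirc" where
  "neq_circ m = (ConstG True # concat (map (neq_step m) [0..<m]) @ [NotG (7 * m)], [7 * m + 1])"

lemma length_neq_steps: "length (concat (map (neq_step m) [0..<k])) = 5 * k"
  by (induction k) (simp_all add: neq_step_def Let_def)

text \<open>Step k reads the previous conjunction on wire w - 1 = 2 m + 5 k, the seed
  \<open>True\<close> being on wire 2 m, and leaves the new one five wires later; the last
  conjunction is therefore on wire 7 m.\<close>

lemma wires_neq_steps:
  assumes "length z = 2 * m" "k \<le> m"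
  shows "wires (z @ [True]) (concat (map (neq_step m) [0..<k])) ! (2 * m + 5 * k) = (\<forall>i<k. z ! i = z ! (m + i))"
  using assms(2)
proof (induction k)
  case 0
  then show ?case using assms(1) by (simp add: nth_append)
next
  case (Suc k)
  define vs where "vs = wires (z @ [True]) (concat (map (neq_step m) [0..<k]))"
  have vs: "length vs = 2 * m + 1 + 5 * k"
    by (simp add: vs_def length_neq_steps assms(1))
  have z: "vs ! k = z ! k" "vs ! (m + k) = z ! (m + k)"
    using Suc.prems assms(1) by (simp_all add: vs_def wires_nth nth_append)
  have IH: "vs ! (2 * m + 5 * k) = (\<forall>i<k. z ! i = z ! (m + i))"
    using Suc by (simp add: vs_def)
  have "wires (z @ [True]) (concat (map (neq_step m) [0..<Suc k])) = wires vs (neq_step m k)"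
    by (simp add: wires_append vs_def)
  moreover have "wires vs (neq_step m k) ! (2 * m + 5 * Suc k) = ((\<forall>i<k. z ! i = z ! (m + i)) \<and> z ! k = z ! (m + k))"
    using Suc.prems IH z vs by (simp add: neq_step_def Let_def nth_append) argo
  ultimately show ?case
    by (simp add: All_less_Suc conj_commute)
qed

lemma wf_neq: "wf_circ (2 * m) 1 (neq_circ m)"
proof -
  have "gates_ok (2 * m + 1) (concat (map (neq_step m) [0..<k]))" if "k \<le> m" for k
    using that
  proof (induction k)
    case (Suc k)
    then show ?case
      by (simp add: gates_ok_append length_neq_steps) (simp add: neq_step_def Let_def)
  qed simp
  then show ?thesis
    by (simp add: wf_circ_gates_ok neq_circ_def bsize_def gates_ok_append length_neq_steps)
qed

lemma beval_neq:
  assumes "length y = m" "length y' = m"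
  shows "beval (neq_circ m) (y @ y') = [y \<noteq> y']"
proof -
  have "wires ((y @ y') @ [True]) (concat (map (neq_step m) [0..<m])) ! (2 * m + 5 * m) =
      (\<forall>i<m. (y @ y') ! i = (y @ y') ! (m + i))"
    using assms by (intro wires_neq_steps) auto
  also have "\<dots> = (y = y')"
    using assms by (simp add: nth_append list_eq_iff_nth_eq)
  finally show ?thesis
    using assms by (simp add: beval_wires neq_circ_def wires_append nth_append length_neq_steps)
qed

lemma bsize_neq: "bsize (neq_circ m) = 5 * m + 2" "length (snd (neq_circ m)) = 1"
  by (simp_all add: neq_circ_def bsize_def length_neq_steps)

section \<open>From inverters to distinguishers\<close>

text \<open>
  The players of the unclonability game. The challenge is copied first, as the search player
  consumes it; output \<open>True\<close> means that the answer is not a preimage.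
\<close>

definition player_B :: "nat \<Rightarrow> nat \<Rightarrow> bcirc \<Rightarrow> bits \<Rightarrow> qcirc \<Rightarrow> qcirc" where
  "player_B n m Ev ek B =
     compile m (dup_circ m) @ map (shift_op m) B @ map (shift_op m) (compile n (hardwire ek Ev)) @
     compile (2 * m) (neq_circ m)"

definition player_C :: "nat \<Rightarrow> nat \<Rightarrow> nat \<Rightarrow> bcirc \<Rightarrow> bits \<Rightarrow> qcirc \<Rightarrow> qcirc" where
  "player_C n m rC Ev ek C =
     map (shift_op rC) (compile m (dup_circ m)) @ C @ compile n (hardwire ek Ev) @
     compile (2 * m) (neq_circ m)"

lemma hardwire_eval:
  assumes "wf_circ (n + length ek) m Ev"
  shows "wf_qcirc n (compile n (hardwire ek Ev)) m"
    "length x = n \<Longrightarrow> cl_run (compile n (hardwire ek Ev)) x = beval Ev (x @ ek)"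
  using wf_hardwire[OF assms] by (simp_all add: wf_compile compile_correct beval_hardwire)

lemma wf_player_B:
  assumes "wf_circ (n + length ek) m Ev" "wf_qcirc (m + rB) B n"
  shows "wf_qcirc (m + rB) (player_B n m Ev ek B) 1"
proof -
  have "wf_qcirc (m + rB) (compile m (dup_circ m)) (m + (m + rB))"
    using wf_qcirc_local[OF wf_compile[OF wf_dup, of m], of rB] by (simp add: add.assoc)
  moreover have "wf_qcirc (m + (m + rB)) (map (shift_op m) B) (m + n)"
    by (rule wf_qcirc_shift[OF assms(2)])
  moreover have "wf_qcirc (m + n) (map (shift_op m) (compile n (hardwire ek Ev))) (2 * m)"
    using wf_qcirc_shift[OF hardwire_eval(1)[OF assms(1)], of m] by (simp add: mult_2)
  ultimately show ?thesis
    unfolding player_B_def using wf_compile[OF wf_neq] by (blast intro: wf_qcirc_append)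
qed

lemma wf_player_C:
  assumes "wf_circ (n + length ek) m Ev" "wf_qcirc (rC + m) C n"
  shows "wf_qcirc (rC + m) (player_C n m rC Ev ek C) 1"
proof -
  have "wf_qcirc (rC + m) (map (shift_op rC) (compile m (dup_circ m))) (rC + m + m)"
    using wf_qcirc_shift[OF wf_compile[OF wf_dup, of m], of rC] by (simp add: add.assoc)
  moreover have "wf_qcirc (rC + m + m) C (n + m)"
    by (rule wf_qcirc_local[OF assms(2)])
  moreover have "wf_qcirc (n + m) (compile n (hardwire ek Ev)) (2 * m)"
    using wf_qcirc_local[OF hardwire_eval(1)[OF assms(1)], of m] by (simp add: mult_2)
  ultimately show ?thesis
    unfolding player_C_def using wf_compile[OF wf_neq] by (blast intro: wf_qcirc_append)
qed

lemma run_dup: "length y = m \<Longrightarrow> eqst (m + m) (run (compile m (dup_circ m)) (basis y)) (tensor m (basis y) (basis y))"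
  using eqst_trans[OF run_compile_basis[OF wf_dup, of y m] eqst_trans[OF _ basis_tensor[of y m m y]]]
  by (simp add: beval_dup)

text \<open>The challenge is a basis state, so it can be copied exactly, and B acts on the second
  copy with the kept one in front. All that follows B is classical, so \<open>run_diag\<close> turns
  it into postprocessing of B's measured answer.\<close>

lemma player_B_diag:
  assumes Ev: "wf_circ (n + length ek) m Ev" and B: "wf_qcirc (m + rB) B n" and y: "length y = m"
  shows "run (player_B n m Ev ek B) (tensor m (basis y) \<tau>) [b] [b] =
    (\<Sum>x\<in>bitstrings n. if (beval Ev (x @ ek) \<noteq> y) = b then run B (tensor m (basis y) \<tau>) x x else 0)"
proof -
  let ?\<Phi> = "tensor m (basis y) \<tau>"
  define K where "K = map (shift_op m) (compile n (hardwire ek Ev)) @ compile (2 * m) (neq_circ m)"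
  have K: "wf_qcirc (m + n) K 1"
    unfolding K_def using wf_qcirc_shift[OF hardwire_eval(1)[OF Ev], of m] wf_compile[OF wf_neq]
    by (auto intro!: wf_qcirc_append simp: mult_2)
  have classK: "classical K"
    by (simp add: K_def classical_compile)
  have runK: "cl_run K (u @ x) = [u \<noteq> beval Ev (x @ ek)]" if "length u = m" "length x = n" for u x
    using that Ev
    by (simp add: K_def cl_run_append cl_run_right hardwire_eval(2)[OF Ev] compile_correct[OF wf_neq]
        beval_neq wf_circ_def)
  have "eqst (m + m + rB) (run (compile m (dup_circ m)) ?\<Phi>) (tensor (m + m) (run (compile m (dup_circ m)) (basis y)) \<tau>)"
    by (rule run_tensor_left[OF wf_compile[OF wf_dup]])
  also have "eqst (m + m + rB) (tensor (m + m) (run (compile m (dup_circ m)) (basis y)) \<tau>) (tensor m (basis y) ?\<Phi>)"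
    unfolding tensor_assoc by (intro tensor_cong run_dup y eqst_refl)
  finally have "eqst (m + (m + rB)) (run (compile m (dup_circ m)) ?\<Phi>) (tensor m (basis y) ?\<Phi>)"
    by (simp add: add.assoc)
  then have "eqst (m + n) (run (map (shift_op m) B) (run (compile m (dup_circ m)) ?\<Phi>))
      (run (map (shift_op m) B) (tensor m (basis y) ?\<Phi>))"
    by (rule run_cong[OF wf_qcirc_shift[OF B]])
  also have "eqst (m + n) (run (map (shift_op m) B) (tensor m (basis y) ?\<Phi>)) (tensor m (basis y) (run B ?\<Phi>))"
    by (rule run_tensor_right[OF B])
  finally have "run (player_B n m Ev ek B) ?\<Phi> [b] [b] = run K (tensor m (basis y) (run B ?\<Phi>)) [b] [b]"
    using eqstD[OF run_cong[OF K]] by (simp add: player_B_def K_def run_append)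
  also have "\<dots> = (\<Sum>z\<in>bitstrings (m + n). if cl_run K z = [b] then tensor m (basis y) (run B ?\<Phi>) z z else 0)"
    by (rule run_diag[OF K classK]) simp
  also have "\<dots> = (\<Sum>u\<in>bitstrings m. \<Sum>x\<in>bitstrings n.
      if u = y then (if (beval Ev (x @ ek) \<noteq> y) = b then run B ?\<Phi> x x else 0) else 0)"
    unfolding sum_bitstrings_append
    by (intro sum.cong refl) (auto simp: runK tensor_append basis_def)
  also have "\<dots> = (\<Sum>x\<in>bitstrings n. \<Sum>u\<in>bitstrings m.
      if u = y then (if (beval Ev (x @ ek) \<noteq> y) = b then run B ?\<Phi> x x else 0) else 0)"
    by (rule sum.swap)
  also have "\<dots> = (\<Sum>x\<in>bitstrings n. if (beval Ev (x @ ek) \<noteq> y) = b then run B ?\<Phi> x x else 0)"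
    using y by simp
  finally show ?thesis .
qed

text \<open>Mirror image of \<open>player_B_diag\<close>: the kept copy stands behind the registers,
  so C and the evaluation act on the leading block without a shift.\<close>

lemma player_C_diag:
  assumes Ev: "wf_circ (n + length ek) m Ev" and C: "wf_qcirc (rC + m) C n" and y: "length y = m"
  shows "run (player_C n m rC Ev ek C) (tensor rC \<tau> (basis y)) [b] [b] =
    (\<Sum>x\<in>bitstrings n. if (beval Ev (x @ ek) \<noteq> y) = b then run C (tensor rC \<tau> (basis y)) x x else 0)"
proof -
  let ?\<Phi> = "tensor rC \<tau> (basis y)"
  define K where "K = compile n (hardwire ek Ev) @ compile (2 * m) (neq_circ m)"
  have K: "wf_qcirc (n + m) K 1"
    unfolding K_def using wf_qcirc_local[OF hardwire_eval(1)[OF Ev], of m] wf_compile[OF wf_neq]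
    by (auto intro!: wf_qcirc_append simp: mult_2)
  have classK: "classical K"
    by (simp add: K_def classical_compile)
  have runK: "cl_run K (x @ u) = [beval Ev (x @ ek) \<noteq> u]" if "length u = m" "length x = n" for u x
    using that Ev
    by (simp add: K_def cl_run_append cl_run_left[OF hardwire_eval(1)[OF Ev]] hardwire_eval(2)[OF Ev]
        compile_correct[OF wf_neq] beval_neq wf_circ_def)
  let ?D = "map (shift_op rC) (compile m (dup_circ m))"
  have "eqst (rC + (m + m)) (run ?D ?\<Phi>) (tensor rC \<tau> (run (compile m (dup_circ m)) (basis y)))"
    by (rule run_tensor_right[OF wf_compile[OF wf_dup]])
  also have "eqst (rC + (m + m)) (tensor rC \<tau> (run (compile m (dup_circ m)) (basis y))) (tensor (rC + m) ?\<Phi> (basis y))"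
    unfolding tensor_assoc[symmetric] by (intro tensor_cong run_dup y eqst_refl)
  finally have "eqst (rC + m + m) (run ?D ?\<Phi>) (tensor (rC + m) ?\<Phi> (basis y))"
    by (simp add: add.assoc)
  then have "eqst (n + m) (run C (run ?D ?\<Phi>)) (run C (tensor (rC + m) ?\<Phi> (basis y)))"
    by (rule run_cong[OF wf_qcirc_local[OF C]])
  also have "eqst (n + m) (run C (tensor (rC + m) ?\<Phi> (basis y))) (tensor n (run C ?\<Phi>) (basis y))"
    by (rule run_tensor_left[OF C])
  finally have "run (player_C n m rC Ev ek C) ?\<Phi> [b] [b] = run K (tensor n (run C ?\<Phi>) (basis y)) [b] [b]"
    using eqstD[OF run_cong[OF K]] by (simp add: player_C_def K_def run_append)
  also have "\<dots> = (\<Sum>z\<in>bitstrings (n + m). if cl_run K z = [b] then tensor n (run C ?\<Phi>) (basis y) z z else 0)"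
    by (rule run_diag[OF K classK]) simp
  also have "\<dots> = (\<Sum>x\<in>bitstrings n. \<Sum>u\<in>bitstrings m.
      if u = y then (if (beval Ev (x @ ek) \<noteq> y) = b then run C ?\<Phi> x x else 0) else 0)"
    unfolding sum_bitstrings_append
    by (intro sum.cong refl) (auto simp: runK tensor_append basis_def)
  also have "\<dots> = (\<Sum>x\<in>bitstrings n. if (beval Ev (x @ ek) \<noteq> y) = b then run C ?\<Phi> x x else 0)"
    using y by simp
  finally show ?thesis .
qed

definition challenge_state :: "nat \<Rightarrow> bits \<Rightarrow> nat \<Rightarrow> qstate \<Rightarrow> bits \<Rightarrow> qstate" where
  "challenge_state m yB r bip yC = tensor m (basis yB) (tensor r bip (basis yC))"

text \<open>The bipartite state may be entangled, so the results for the single players cannot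
  simply be multiplied. B's is applied to slices with C's indices fixed, which splits the state left
  to C into a sum over B's answers; C's is then applied to each term.\<close>

lemma players_diag:
  assumes Ev: "wf_circ (n + length ek) m Ev" and B: "wf_qcirc (m + rB) B n" and C: "wf_qcirc (rC + m) C n"
    and y: "length yB = m" "length yC = m"
  shows "run (par 1 (player_B n m Ev ek B) (player_C n m rC Ev ek C)) (challenge_state m yB (rB + rC) bip yC) [b, b'] [b, b'] =
    (\<Sum>x1\<in>bitstrings n. \<Sum>x2\<in>bitstrings n.
       if (beval Ev (x1 @ ek) \<noteq> yB) = b \<and> (beval Ev (x2 @ ek) \<noteq> yC) = b'
       then run (par n B C) (challenge_state m yB (rB + rC) bip yC) (x1 @ x2) (x1 @ x2) else 0)"
proof -
  let ?\<Phi> = "challenge_state m yB (rB + rC) bip yC"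
  let ?B = "player_B n m Ev ek B" and ?C = "player_C n m rC Ev ek C"
  let ?okB = "\<lambda>x. (beval Ev (x @ ek) \<noteq> yB) = b" and ?okC = "\<lambda>x. (beval Ev (x @ ek) \<noteq> yC) = b'"
  have wfB: "wf_qcirc (m + rB) ?B 1" and wfC: "wf_qcirc (rC + m) ?C 1"
    by (rule wf_player_B[OF Ev B] wf_player_C[OF Ev C])+
  \<comment> \<open>For fixed indices on C's side the challenge \<open>yC\<close> is a scalar
    factor, and B sees a state of the form that \<open>player_B_diag\<close> handles.\<close>
  have slice: "eqst (m + rB) (\<lambda>s t. ?\<Phi> (s @ u1 @ u2) (t @ v1 @ v2))
      (\<lambda>s t. basis yC u2 v2 * tensor m (basis yB) (\<lambda>s t. bip (s @ u1) (t @ v1)) s t)"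
    if "length u1 = rC" "length v1 = rC" for u1 u2 v1 v2
    by (rule eqstI) (use that in \<open>simp add: challenge_state_def tensor_def\<close>)
  have sliceB: "eqst b0 (run Q (\<lambda>s t. ?\<Phi> (s @ u1 @ u2) (t @ v1 @ v2)))
      (\<lambda>s t. basis yC u2 v2 * run Q (tensor m (basis yB) (\<lambda>s t. bip (s @ u1) (t @ v1))) s t)"
    if "length u1 = rC" "length v1 = rC" "wf_qcirc (m + rB) Q b0" for u1 u2 v1 v2 Q b0
    using run_cong[OF that(3) slice[OF that(1,2)]] by (simp add: run_scale)
  \<comment> \<open>The unnormalised state left to C when B answers x. B does not touch C's
    challenge, so it is still a separate factor, as \<open>player_C_diag\<close> demands.\<close>
  define \<chi> where "\<chi> x = (\<lambda>u v. run B ?\<Phi> (x @ u) (x @ v))" for x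
  have \<chi>: "eqst (rC + m) (\<chi> x) (tensor rC (\<lambda>u v. run B (tensor m (basis yB) (\<lambda>s t. bip (s @ u) (t @ v))) x x) (basis yC))"
    if "length x = n" for x
  proof (rule eqst_appendI)
    fix u1 u2 v1 v2 :: bits assume len: "length u1 = rC" "length v1 = rC" "length u2 = m" "length v2 = m"
    have "\<chi> x (u1 @ u2) (v1 @ v2) = run B (\<lambda>s t. ?\<Phi> (s @ u1 @ u2) (t @ v1 @ v2)) x x"
      unfolding \<chi>_def by (rule run_left[OF B that that])
    then show "\<chi> x (u1 @ u2) (v1 @ v2) = tensor rC (\<lambda>u v. run B (tensor m (basis yB) (\<lambda>s t. bip (s @ u) (t @ v))) x x) (basis yC) (u1 @ u2) (v1 @ v2)"
      using eqstD[OF sliceB[OF len(1,2) B] that that] len by (simp add: tensor_append)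
  qed
  have "run (par 1 ?B ?C) ?\<Phi> ([b] @ [b']) ([b] @ [b']) = run ?C (\<lambda>u v. run ?B ?\<Phi> ([b] @ u) ([b] @ v)) [b'] [b']"
    unfolding par_def run_append by (rule run_right[OF wfC]) auto
  also have "\<dots> = run ?C (\<lambda>u v. \<Sum>x\<in>bitstrings n. (if ?okB x then 1 else 0) * \<chi> x u v) [b'] [b']"
  proof (rule eqstD[OF run_cong[OF wfC]], rule eqst_appendI)
    fix u1 u2 v1 v2 :: bits assume len: "length u1 = rC" "length v1 = rC" "length u2 = m" "length v2 = m"
    let ?\<tau> = "\<lambda>s t. bip (s @ u1) (t @ v1)"
    have "run ?B ?\<Phi> ([b] @ (u1 @ u2)) ([b] @ (v1 @ v2)) = run ?B (\<lambda>s t. ?\<Phi> (s @ u1 @ u2) (t @ v1 @ v2)) [b] [b]"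
      by (rule run_left[OF wfB]) auto
    also have "\<dots> = basis yC u2 v2 * run ?B (tensor m (basis yB) ?\<tau>) [b] [b]"
      by (rule eqstD[OF sliceB[OF len(1,2) wfB]]) auto
    also have "\<dots> = (\<Sum>x\<in>bitstrings n. basis yC u2 v2 * (if ?okB x then run B (tensor m (basis yB) ?\<tau>) x x else 0))"
      by (simp only: player_B_diag[OF Ev B y(1)] sum_distrib_left)
    also have "\<dots> = (\<Sum>x\<in>bitstrings n. (if ?okB x then 1 else 0) * \<chi> x (u1 @ u2) (v1 @ v2))"
      using len by (intro sum.cong refl) (simp add: eqstD[OF \<chi>] tensor_append)
    finally show "run ?B ?\<Phi> ([b] @ (u1 @ u2)) ([b] @ (v1 @ v2)) =
        (\<Sum>x\<in>bitstrings n. (if ?okB x then 1 else 0) * \<chi> x (u1 @ u2) (v1 @ v2))" .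
  qed auto
  also have "\<dots> = (\<Sum>x1\<in>bitstrings n. (if ?okB x1 then 1 else 0) * run ?C (\<chi> x1) [b'] [b'])"
    by (simp only: run_sum run_scale)
  also have "\<dots> = (\<Sum>x1\<in>bitstrings n. \<Sum>x2\<in>bitstrings n.
      if ?okB x1 \<and> ?okC x2 then run (par n B C) ?\<Phi> (x1 @ x2) (x1 @ x2) else 0)"
  proof (rule sum.cong[OF refl])
    fix x1 assume "x1 \<in> bitstrings n"
    then have x1: "length x1 = n" by simp
    let ?\<sigma> = "tensor rC (\<lambda>u v. run B (tensor m (basis yB) (\<lambda>s t. bip (s @ u) (t @ v))) x1 x1) (basis yC)"
    have "run ?C (\<chi> x1) [b'] [b'] = run ?C ?\<sigma> [b'] [b']"
      by (rule eqstD[OF run_cong[OF wfC \<chi>[OF x1]]]) auto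
    also have "\<dots> = (\<Sum>x2\<in>bitstrings n. if ?okC x2 then run C ?\<sigma> x2 x2 else 0)"
      by (rule player_C_diag[OF Ev C y(2)])
    also have "\<dots> = (\<Sum>x2\<in>bitstrings n. if ?okC x2 then run (par n B C) ?\<Phi> (x1 @ x2) (x1 @ x2) else 0)"
    proof (rule sum.cong[OF refl])
      fix x2 assume "x2 \<in> bitstrings n"
      then have x2: "length x2 = n" by simp
      have "run C ?\<sigma> x2 x2 = run C (\<chi> x1) x2 x2"
        by (rule eqstD[OF run_cong[OF C \<chi>[OF x1]] x2 x2, symmetric])
      also have "\<dots> = run (par n B C) ?\<Phi> (x1 @ x2) (x1 @ x2)"
        unfolding \<chi>_def par_def run_append by (rule run_right[OF C x2 x2 x1 x1, symmetric])
      finally show "(if ?okC x2 then run C ?\<sigma> x2 x2 else 0) =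
          (if ?okC x2 then run (par n B C) ?\<Phi> (x1 @ x2) (x1 @ x2) else 0)"
        by simp
    qed
    finally show "(if ?okB x1 then 1 else 0) * run ?C (\<chi> x1) [b'] [b'] =
        (\<Sum>x2\<in>bitstrings n. if ?okB x1 \<and> ?okC x2 then run (par n B C) ?\<Phi> (x1 @ x2) (x1 @ x2) else 0)"
      by (cases "?okB x1") simp_all
  qed
  finally show ?thesis by simp
qed

section \<open>The three reductions\<close>

lemma positive_measured:
  assumes "positive \<rho>"
  shows "positive (measured z \<rho>)"
proof -
  obtain L where "\<rho> = rank1_sum L"
    using assms by (auto simp: positive_def)
  then show ?thesis
    unfolding positive_def
    by (intro exI[of _ "map (\<lambda>\<phi> u. \<phi> (z @ u)) L"]) (simp add: fun_eq_iff measured_def rank1_sum_def o_def)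
qed

section \<open>Hard-wired constants and uniform sampling\<close>

lemma tensor_0: "tensor 0 \<sigma> \<rho> = (\<lambda>u v. \<sigma> [] [] * \<rho> u v)"
  by (simp add: tensor_def fun_eq_iff)

text \<open>Any state is a product with the state of an empty register, since that factor is the
  scalar 1; so the rule for product states applies.\<close>

lemma run_const: "length z = k \<Longrightarrow> eqst (k + r) (run (compile 0 (const_circ z)) \<rho>) (tensor k (basis z) \<rho>)"
proof -
  assume z: "length z = k"
  have "eqst (k + r) (run (compile 0 (const_circ z)) (tensor 0 (basis []) \<rho>))
      (tensor k (run (compile 0 (const_circ z)) (basis [])) \<rho>)"
    using run_tensor_left[OF wf_compile[OF wf_const], of z r "basis []" \<rho>] z by simp
  also have "eqst (k + r) (tensor k (run (compile 0 (const_circ z)) (basis [])) \<rho>) (tensor k (basis z) \<rho>)"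
    using run_compile_basis[OF wf_const, of "[]" z] z by (intro tensor_cong eqst_refl) (simp add: beval_const)
  finally show ?thesis
    by (simp add: tensor_0 basis_def)
qed

lemma run_const_right:
  assumes "length z = k"
  shows "eqst (r + k) (run (map (shift_op r) (compile 0 (const_circ z))) \<rho>) (tensor r \<rho> (basis z))"
proof -
  have "eqst r \<rho> (tensor r \<rho> (basis []))"
    by (simp add: eqst_def tensor_def basis_def)
  then have "eqst (r + 0) \<rho> (tensor r \<rho> (basis []))"
    by simp
  then have "eqst (r + k) (run (map (shift_op r) (compile 0 (const_circ z))) \<rho>)
      (run (map (shift_op r) (compile 0 (const_circ z))) (tensor r \<rho> (basis [])))"
    using run_cong[OF wf_qcirc_shift[OF wf_compile[OF wf_const]]] assms by blast
  also have "eqst (r + k) (run (map (shift_op r) (compile 0 (const_circ z))) (tensor r \<rho> (basis [])))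
      (tensor r \<rho> (run (compile 0 (const_circ z)) (basis [])))"
    using run_tensor_right[OF wf_compile[OF wf_const]] assms by blast
  also have "eqst (r + k) (tensor r \<rho> (run (compile 0 (const_circ z)) (basis []))) (tensor r \<rho> (basis z))"
    using run_compile_basis[OF wf_const, of "[]" z] assms by (intro tensor_cong eqst_refl) (simp add: beval_const)
  finally show ?thesis .
qed

lemma length_const: "length (compile 0 (const_circ z)) \<le> 7 * length z"
  using length_compile[of 0 "const_circ z"] by (simp add: bsize_const)

text \<open>A product of |+> states, which is not the maximally mixed state. Its diagonal is
  uniform, and the classical evaluation that follows in \<open>sampler\<close> passes only the
  diagonal on to the measurement.\<close>

primrec uniform_circ :: "nat \<Rightarrow> qcirc" where
  "uniform_circ 0 = []"
| "uniform_circ (Suc n) = uniform_circ n @ [Init 0, HG 0]"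

lemma wf_uniform: "wf_qcirc 0 (uniform_circ n) n"
  by (induction n) (auto intro: wf_qcirc_append)

lemma length_uniform: "length (uniform_circ n) = 2 * n"
  by (induction n) simp_all

lemma uniform_diag: "length z = n \<Longrightarrow> run (uniform_circ n) (basis []) z z = 1 / 2 ^ n"
proof (induction n arbitrary: z)
  case 0
  then show ?case by (simp add: basis_def)
next
  case (Suc n)
  then obtain c z' where z: "z = c # z'" "length z' = n"
    by (cases z) auto
  have h: "h_mat c False * cnj (h_mat c False) = 1 / 2"
    by (simp add: h_mat_def complex_eq_iff)
  have "run (uniform_circ (Suc n)) (basis []) z z =
      h_mat c False * cnj (h_mat c False) * run (uniform_circ n) (basis []) z' z'"
    by (simp add: run_append conj1_def UNIV_bool z del_at_def)
  then show ?case
    unfolding h by (simp add: Suc.IH[OF z(2)])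
qed

definition sampler :: "nat \<Rightarrow> bcirc \<Rightarrow> bits \<Rightarrow> qcirc" where
  "sampler n Ev ek = uniform_circ n @ compile n (hardwire ek Ev)"

definition and_circ :: bcirc where
  "and_circ = ([AndG 0 1], [2])"

lemma wf_and: "wf_circ 2 1 and_circ"
  by (simp add: wf_circ_gates_ok and_circ_def bsize_def)

lemma beval_and: "beval and_circ [a, b] = [a \<and> b]"
  by (simp add: beval_wires and_circ_def)

lemma length_and: "length (compile 2 and_circ) \<le> 9"
  using length_compile[of 2 and_circ] by (simp add: and_circ_def bsize_def)

section \<open>The attack at one security parameter, for an arbitrary program state\<close>

locale pirates =
  fixes n m rB rC reg ekl :: nat and A B C :: qcirc and Ev :: bcirc
  assumes wfA: "wf_qcirc (ekl + reg) A (rB + rC)"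
    and wfB: "wf_qcirc (m + rB) B n"
    and wfC: "wf_qcirc (rC + m) C n"
    and wfEv: "wf_circ (n + ekl) m Ev"
begin

abbreviation ev :: "bits \<Rightarrow> bits \<Rightarrow> bits" where
  "ev ek x \<equiv> beval Ev (x @ ek)"

lemma length_outputs_Ev [simp]: "length (snd Ev) = m"
  using wfEv by (simp add: wf_circ_def)

lemma length_ev: "length (ev ek x) = m"
  by simp

definition bipartite :: "bits \<Rightarrow> qstate \<Rightarrow> qstate" where
  "bipartite ek p = run A (tensor ekl (basis ek) p)"

definition challenge :: "bits \<Rightarrow> bits \<Rightarrow> bits \<Rightarrow> qstate \<Rightarrow> qstate" where
  "challenge ek yB yC p = challenge_state m yB (rB + rC) (bipartite ek p) yC"

definition search_dist :: "bits \<Rightarrow> bits \<Rightarrow> bits \<Rightarrow> qstate \<Rightarrow> bits \<Rightarrow> bits \<Rightarrow> real" where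
  "search_dist ek yB yC p x1 x2 = outcome (run (par n B C) (challenge ek yB yC p)) (x1 @ x2)"

definition players :: "bits \<Rightarrow> qcirc" where
  "players ek = par 1 (player_B n m Ev ek B) (player_C n m rC Ev ek C)"

definition check_dist :: "bits \<Rightarrow> bits \<Rightarrow> bits \<Rightarrow> qstate \<Rightarrow> bool \<Rightarrow> bool \<Rightarrow> real" where
  "check_dist ek yB yC p b b' = outcome (run (players ek) (challenge ek yB yC p)) [b, b']"

lemma wf_players: "length ek = ekl \<Longrightarrow> wf_qcirc ((m + rB) + (rC + m)) (players ek) (1 + 1)"
  unfolding players_def using wfEv wfB wfC by (intro wf_qcirc_par wf_player_B wf_player_C) simp_all

lemma check_dist_eq:
  assumes "length ek = ekl" "length yB = m" "length yC = m"
  shows "check_dist ek yB yC p b b' = (\<Sum>x1\<in>bitstrings n. \<Sum>x2\<in>bitstrings n.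
    if (ev ek x1 \<noteq> yB) = b \<and> (ev ek x2 \<noteq> yC) = b' then search_dist ek yB yC p x1 x2 else 0)"
proof -
  have "wf_circ (n + length ek) m Ev"
    using wfEv assms(1) by simp
  from players_diag[OF this wfB wfC assms(2,3)] show ?thesis
    unfolding check_dist_def players_def challenge_def outcome_def search_dist_def
    by (simp only: Re_sum) (intro sum.cong refl, simp)
qed

lemma positive_challenge: "positive p \<Longrightarrow> positive (challenge ek yB yC p)"
  unfolding challenge_def challenge_state_def bipartite_def
  by (intro positive_tensor positive_run positive_basis)

lemma search_dist_nonneg: "positive p \<Longrightarrow> search_dist ek yB yC p x1 x2 \<ge> 0"
  unfolding search_dist_def by (intro positive_outcome positive_run positive_challenge)

lemma check_dist_nonneg: "positive p \<Longrightarrow> check_dist ek yB yC p b b' \<ge> 0"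
  unfolding check_dist_def by (intro positive_outcome positive_run positive_challenge)

lemma search_dist_total:
  assumes "length ek = ekl" "length yB = m" "length yC = m" "qtrace reg p = 1"
  shows "(\<Sum>x1\<in>bitstrings n. \<Sum>x2\<in>bitstrings n. search_dist ek yB yC p x1 x2) = 1"
proof -
  have "(\<Sum>x1\<in>bitstrings n. \<Sum>x2\<in>bitstrings n. search_dist ek yB yC p x1 x2) =
      Re (qtrace (n + n) (run (par n B C) (challenge ek yB yC p)))"
    by (simp only: sum_outcome[symmetric] search_dist_def sum_bitstrings_append)
  also have "\<dots> = Re (qtrace (m + ((rB + rC) + m)) (challenge ek yB yC p))"
    using qtrace_run[OF wf_qcirc_par[OF wfB wfC]] by (simp add: add.assoc)
  also have "qtrace (m + ((rB + rC) + m)) (challenge ek yB yC p) = qtrace (ekl + reg) (tensor ekl (basis ek) p)"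
    unfolding challenge_def challenge_state_def qtrace_tensor bipartite_def qtrace_run[OF wfA]
    using assms by (simp add: qtrace_basis qtrace_tensor)
  finally show ?thesis
    using assms by (simp add: qtrace_tensor qtrace_basis)
qed

text \<open>Correct answers are preimages of the challenges and pass both tests. In general this is
  only an inequality, as the tests accept every preimage.\<close>

lemma search_dist_le_check:
  assumes "length ek = ekl" "length xB = n" "length xC = n" "positive p"
  shows "search_dist ek (ev ek xB) (ev ek xC) p xB xC \<le> check_dist ek (ev ek xB) (ev ek xC) p False False"
proof -
  let ?f = "\<lambda>x1 x2. if (ev ek x1 \<noteq> ev ek xB) = False \<and> (ev ek x2 \<noteq> ev ek xC) = False
    then search_dist ek (ev ek xB) (ev ek xC) p x1 x2 else 0"
  have nonneg: "?f x1 x2 \<ge> 0" for x1 x2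
    using assms(4) by (simp add: search_dist_nonneg)
  have "?f xB xC \<le> (\<Sum>x2\<in>bitstrings n. ?f xB x2)"
    using assms by (intro member_le_sum nonneg) simp_all
  also have "\<dots> \<le> (\<Sum>x1\<in>bitstrings n. \<Sum>x2\<in>bitstrings n. ?f x1 x2)"
    using assms by (intro member_le_sum[of xB _ "\<lambda>x1. \<Sum>x2\<in>bitstrings n. ?f x1 x2"] sum_nonneg nonneg) simp_all
  finally show ?thesis
    using assms by (simp add: check_dist_eq)
qed

text \<open>With injective evaluation, failing the test means answering wrongly, so the complement
  of two failures is the winning event of the one-wayness game. The total probability 1 comes from
  the trace of the program.\<close>

lemma check_dist_complement:
  assumes ek: "length ek = ekl" and x: "length xB = n" "length xC = n" and tr: "qtrace reg p = 1"
    and inj: "inj_on (ev ek) (bitstrings n)"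
  shows "1 - check_dist ek (ev ek xB) (ev ek xC) p True True =
    (\<Sum>x1\<in>bitstrings n. \<Sum>x2\<in>bitstrings n.
       of_bool (x1 = xB \<or> x2 = xC) * search_dist ek (ev ek xB) (ev ek xC) p x1 x2)"
proof -
  have ev_eq: "ev ek x1 = ev ek x2 \<longleftrightarrow> x1 = x2" if "length x1 = n" "length x2 = n" for x1 x2
    using inj_on_eq_iff[OF inj, of x1 x2] that by simp
  let ?s = "search_dist ek (ev ek xB) (ev ek xC) p"
  have "check_dist ek (ev ek xB) (ev ek xC) p True True =
      (\<Sum>x1\<in>bitstrings n. \<Sum>x2\<in>bitstrings n. ?s x1 x2 - of_bool (x1 = xB \<or> x2 = xC) * ?s x1 x2)"
    using ek x by (simp only: check_dist_eq length_ev) (intro sum.cong refl, simp add: ev_eq)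
  then show ?thesis
    using search_dist_total[OF ek _ _ tr, of "ev ek xB" "ev ek xC"] by (simp add: sum_subtractf)
qed

definition prepare :: "bits \<Rightarrow> qcirc" where
  "prepare ek = compile 0 (const_circ ek) @ A"

lemma wf_prepare:
  assumes "length ek = ekl"
  shows "wf_qcirc reg (prepare ek) (rB + rC)"
  unfolding prepare_def
  using wf_qcirc_append[OF wf_qcirc_local[OF wf_compile[OF wf_const[of ek]], of reg]] wfA assms by simp

lemma run_prepare:
  assumes "length ek = ekl"
  shows "eqst (rB + rC) (run (prepare ek) p) (bipartite ek p)"
  unfolding prepare_def run_append bipartite_def by (intro run_cong[OF wfA] run_const assms)

lemma challenge_cong:
  assumes "eqst (rB + rC) \<sigma> (bipartite ek p)"
  shows "eqst ((m + rB) + (rC + m)) (challenge_state m yB (rB + rC) \<sigma> yC) (challenge ek yB yC p)"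
proof -
  have "eqst (m + ((rB + rC) + m)) (challenge_state m yB (rB + rC) \<sigma> yC) (challenge ek yB yC p)"
    unfolding challenge_def challenge_state_def by (intro tensor_cong assms eqst_refl)
  then show ?thesis
    by (simp add: add.assoc)
qed

text \<open>For iO security the whole game becomes one test of the program. The test is non-uniform,
  so keys and challenges may be hard-wired; the conjunction accepts when both players output
  1.\<close>

definition distinguisher :: "bits \<Rightarrow> bits \<Rightarrow> bits \<Rightarrow> qcirc" where
  "distinguisher ek yB yC =
     compile 0 (const_circ yB) @ map (shift_op m) (prepare ek) @
     map (shift_op (m + (rB + rC))) (compile 0 (const_circ yC)) @ players ek @ compile 2 and_circ"

lemma
  assumes ek: "length ek = ekl" and y: "length yB = m" "length yC = m"
  shows wf_distinguisher: "wf_qcirc reg (distinguisher ek yB yC) 1"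
    and distinguisher_accepts:
      "outcome (run (distinguisher ek yB yC) p) [True] = check_dist ek yB yC p True True"
proof -
  let ?P = "map (shift_op m) (prepare ek)"
  let ?Y = "map (shift_op (m + (rB + rC))) (compile 0 (const_circ yC))"
  have w1: "wf_qcirc reg (compile 0 (const_circ yB)) (m + reg)"
    using wf_qcirc_local[OF wf_compile[OF wf_const[of yB]], of reg] y by simp
  have w2: "wf_qcirc (m + reg) ?P (m + (rB + rC))"
    by (rule wf_qcirc_shift[OF wf_prepare[OF ek]])
  have w3: "wf_qcirc (m + (rB + rC)) ?Y ((m + rB) + (rC + m))"
    using wf_qcirc_shift[OF wf_compile[OF wf_const[of yC]], of "m + (rB + rC)"] y by (simp add: add.assoc)
  have w4: "wf_qcirc ((m + rB) + (rC + m)) (players ek) 2"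
    using wf_players[OF ek] by (simp add: numeral_2_eq_2)
  have w5: "wf_qcirc 2 (compile 2 and_circ) 1"
    by (rule wf_compile[OF wf_and])
  show "wf_qcirc reg (distinguisher ek yB yC) 1"
    unfolding distinguisher_def by (intro wf_qcirc_append[OF w1] wf_qcirc_append[OF w2] wf_qcirc_append[OF w3] wf_qcirc_append[OF w4] w5)
  have "eqst (m + (rB + rC)) (run ?P (run (compile 0 (const_circ yB)) p)) (run ?P (tensor m (basis yB) p))"
    by (intro run_cong[OF w2] run_const y)
  also have "eqst (m + (rB + rC)) (run ?P (tensor m (basis yB) p)) (tensor m (basis yB) (run (prepare ek) p))"
    by (rule run_tensor_right[OF wf_prepare[OF ek]])
  also have "eqst (m + (rB + rC)) (tensor m (basis yB) (run (prepare ek) p)) (tensor m (basis yB) (bipartite ek p))"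
    by (intro tensor_cong eqst_refl run_prepare ek)
  finally have 1: "eqst (m + (rB + rC)) (run ?P (run (compile 0 (const_circ yB)) p)) (tensor m (basis yB) (bipartite ek p))" .
  have "eqst ((m + (rB + rC)) + m) (run ?Y (run ?P (run (compile 0 (const_circ yB)) p)))
      (tensor (m + (rB + rC)) (run ?P (run (compile 0 (const_circ yB)) p)) (basis yC))"
    by (intro run_const_right y)
  also have "eqst ((m + (rB + rC)) + m) (tensor (m + (rB + rC)) (run ?P (run (compile 0 (const_circ yB)) p)) (basis yC))
      (challenge ek yB yC p)"
    unfolding challenge_def challenge_state_def tensor_assoc by (intro tensor_cong 1 eqst_refl)
  finally have "eqst ((m + rB) + (rC + m)) (run ?Y (run ?P (run (compile 0 (const_circ yB)) p))) (challenge ek yB yC p)"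
    by (simp add: add.assoc)
  then have "eqst 1 (run (distinguisher ek yB yC) p) (run (compile 2 and_circ) (run (players ek) (challenge ek yB yC p)))"
    unfolding distinguisher_def run_append by (intro run_cong[OF w5] run_cong[OF w4])
  then have "outcome (run (distinguisher ek yB yC) p) [True] =
      Re (run (compile 2 and_circ) (run (players ek) (challenge ek yB yC p)) [True] [True])"
    by (simp add: eqst_outcome[unfolded outcome_def] outcome_def eqstD)
  also have "run (compile 2 and_circ) (run (players ek) (challenge ek yB yC p)) [True] [True] =
      (\<Sum>z\<in>bitstrings (1 + 1). if cl_run (compile 2 and_circ) z = [True] then run (players ek) (challenge ek yB yC p) z z else 0)"
    using run_diag[OF w5 classical_compile, of "[True]"] by (simp add: numeral_2_eq_2)
  also have "\<dots> = run (players ek) (challenge ek yB yC p) [True, True] [True, True]"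
    unfolding sum_bitstrings_append by (simp add: bitstrings_1 compile_correct[OF wf_and] beval_and)
  finally show "outcome (run (distinguisher ek yB yC) p) [True] = check_dist ek yB yC p True True"
    by (simp add: check_dist_def outcome_def)
qed

lemma sampler_prob:
  assumes "length ek = ekl" "length y = m"
  shows "out_prob (sampler n Ev ek) [] y = (\<Sum>x\<in>bitstrings n. if ev ek x = y then 1 / 2 ^ n else 0)"
proof -
  have Ev: "wf_circ (n + length ek) m Ev"
    using wfEv assms(1) by simp
  have "run (sampler n Ev ek) (basis []) y y = (\<Sum>x\<in>bitstrings n. if ev ek x = y then complex_of_real (1 / 2 ^ n) else 0)"
    unfolding sampler_def run_append run_diag[OF hardwire_eval(1)[OF Ev] classical_compile assms(2)]
    by (intro sum.cong refl) (simp add: hardwire_eval(2)[OF Ev] uniform_diag)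
  then show ?thesis
    by (simp add: out_prob_def outcome_def if_distrib[of Re] cong: if_cong)
qed

text \<open>Change of variables: the sampler is the law of \<open>ev ek\<close> on a uniform input.
  This translates challenges of the unclonability game into those of the search game.\<close>

lemma sampler_expectation:
  assumes "length ek = ekl"
  shows "(\<Sum>y\<in>bitstrings m. out_prob (sampler n Ev ek) [] y * g y) = (\<Sum>x\<in>bitstrings n. 1 / 2 ^ n * g (ev ek x))"
proof -
  have "(\<Sum>y\<in>bitstrings m. out_prob (sampler n Ev ek) [] y * g y) =
      (\<Sum>y\<in>bitstrings m. \<Sum>x\<in>bitstrings n. if ev ek x = y then 1 / 2 ^ n * g y else 0)"
    using assms by (intro sum.cong refl) (simp add: sampler_prob sum_distrib_right if_distrib[of "\<lambda>t. t * _"] cong: if_cong)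
  also have "\<dots> = (\<Sum>x\<in>bitstrings n. \<Sum>y\<in>bitstrings m. if ev ek x = y then 1 / 2 ^ n * g y else 0)"
    by (rule sum.swap)
  also have "\<dots> = (\<Sum>x\<in>bitstrings n. 1 / 2 ^ n * g (ev ek x))"
    by (intro sum.cong refl) simp
  finally show ?thesis .
qed

text \<open>By injectivity each image has one preimage and hence weight 2^-n, while all other points
  have weight 0. The maximum is attained at the image of any input, such as the zero string.\<close>

lemma sampler_min_entropy:
  assumes "length ek = ekl" "inj_on (ev ek) (bitstrings n)"
  shows "min_entropy m (out_prob (sampler n Ev ek) []) \<ge> n"
proof -
  let ?p = "out_prob (sampler n Ev ek) []"
  have le: "?p y \<le> 1 / 2 ^ n" if "length y = m" for y
  proof (cases "\<exists>x\<in>bitstrings n. ev ek x = y")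
    case True
    then obtain x where x: "length x = n" "ev ek x = y"
      by auto
    have "?p y = (\<Sum>x'\<in>bitstrings n. if x' = x then 1 / 2 ^ n else 0)"
      unfolding sampler_prob[OF assms(1) that] using x inj_on_eq_iff[OF assms(2), of _ x] by (intro sum.cong refl) auto
    then show ?thesis
      using x by simp
  next
    case False
    then have "?p y = 0"
      unfolding sampler_prob[OF assms(1) that] by (intro sum.neutral) auto
    then show ?thesis by simp
  qed
  let ?x = "replicate n False"
  have "(\<Sum>x\<in>bitstrings n. if x = ?x then 1 / 2 ^ n else (0 :: real)) \<le> ?p (ev ek ?x)"
    unfolding sampler_prob[OF assms(1) length_ev] by (intro sum_mono) auto
  then have "1 / 2 ^ n \<le> ?p (ev ek ?x)"
    by simp
  also have "\<dots> \<le> Max (?p ` bitstrings m)"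
    by (intro Max_ge) auto
  finally have "1 / 2 ^ n \<le> Max (?p ` bitstrings m)" .
  moreover have "Max (?p ` bitstrings m) \<le> 1 / 2 ^ n"
  proof (rule Max.boundedI)
    have "ev ek ?x \<in> bitstrings m"
      by simp
    then show "?p ` bitstrings m \<noteq> {}"
      by blast
  qed (use le in auto)
  ultimately have "Max (?p ` bitstrings m) = 1 / 2 ^ n"
    by simp
  then show ?thesis
    by (simp add: min_entropy_def log_divide log_nat_power)
qed

end

text \<open>
  In the description of \<open>hardwire key C\<close> each key bit appears once, in the code of the gate that
  produces it, and all other bits are independent of the key. Hence the description is obtained
  from the key by wiring alone.
\<close>

definition code_rest :: "nat \<Rightarrow> nat \<Rightarrow> nat \<Rightarrow> bcirc \<Rightarrow> bits" where
  "code_rest lin s k C =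
     concat (map (gate_code (lin + s)) (fst C @ replicate (s - k - bsize C) (ConstG False))) @
     concat (map (onehot (lin + s)) (snd C))"

definition wired_code :: "nat \<Rightarrow> bits \<Rightarrow> bits \<Rightarrow> bits" where
  "wired_code w rest key = concat (map (\<lambda>b. [False, False, b] @ replicate (2 * w) False) key) @ rest"

lemma code_pad_hardwire:
  assumes "length key + bsize C \<le> s"
  shows "code lin (pad s (hardwire key C)) =
    wired_code (lin + s) (code_rest lin s (length key) C) key"
proof -
  have "bsize (pad s (hardwire key C)) = s"
    using assms by (simp add: bsize_pad)
  then show ?thesis
    by (simp add: wired_code_def code_def code_rest_def Let_def pad_def hardwire_def bsize_def o_def)
qed

text \<open>The output list that produces \<open>wired_code\<close>: wires \<open>N\<close> and
  \<open>Suc N\<close> carry the constants 0 and 1, the wires from \<open>off\<close> on carry the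
  key, and the 2 w copies of \<open>N\<close> are the operand fields of a constant gate.\<close>

definition code_wires :: "nat \<Rightarrow> nat \<Rightarrow> nat \<Rightarrow> nat \<Rightarrow> bits \<Rightarrow> nat list" where
  "code_wires off N k w rest =
     concat (map (\<lambda>j. [N, N, off + j] @ replicate (2 * w) N) [0..<k]) @ map (\<lambda>b. if b then Suc N else N) rest"

lemma nth_code_wires:
  assumes "ws ! N = False" "ws ! Suc N = True" "\<And>j. j < k \<Longrightarrow> ws ! (off + j) = key ! j" "length key = k"
  shows "map (\<lambda>i. ws ! i) (code_wires off N k w rest) =
    wired_code w rest key"
proof -
  have "map (\<lambda>i. ws ! i) (concat (map (\<lambda>j. [N, N, off + j] @ replicate (2 * w) N) [0..<k])) =
      concat (map (\<lambda>j. [False, False, key ! j] @ replicate (2 * w) False) [0..<k])"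
    unfolding map_concat map_map
    by (intro arg_cong[of _ _ concat] map_cong refl) (simp add: assms(1,3))
  also have "\<dots> = concat (map (\<lambda>b. [False, False, b] @ replicate (2 * w) False) (map (\<lambda>j. key ! j) [0..<k]))"
    by (simp add: o_def)
  also have "map (\<lambda>j. key ! j) [0..<k] = key"
    using assms(4) map_nth[of key] by simp
  finally have 1: "map (\<lambda>i. ws ! i) (concat (map (\<lambda>j. [N, N, off + j] @ replicate (2 * w) N) [0..<k])) =
      concat (map (\<lambda>b. [False, False, b] @ replicate (2 * w) False) key)" .
  have 2: "map (\<lambda>i. ws ! i) (map (\<lambda>b. if b then Suc N else N) rest) = rest"
    using assms(1,2) by (induction rest) simp_all
  show ?thesis
    unfolding code_wires_def wired_code_def map_append 1 2 ..
qed

lemma set_code_wires: "i \<in> set (code_wires off N k w rest) \<Longrightarrow> off + k \<le> N \<Longrightarrow> i < N + 2"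
  by (auto simp: code_wires_def split: if_splits)

text \<open>Inputs come in the order of the one-wayness game. The outputs have B's challenge first
  and C's last, so that \<open>Obf\<close> can act on the description in the middle, then A on key
  and program, and the result has the qubit order of the search game.\<close>

definition layout_circ :: "nat \<Rightarrow> nat \<Rightarrow> nat \<Rightarrow> nat \<Rightarrow> bits \<Rightarrow> bcirc" where
  "layout_circ e k m w rest =
     ([ConstG False, ConstG True],
      map (\<lambda>i. e + k + i) [0..<m] @ [0..<e] @ code_wires e (e + (k + (m + m))) k w rest @
      map (\<lambda>i. e + k + m + i) [0..<m])"

lemma beval_layout:
  assumes "length ek = e" "length key = k" "length y1 = m" "length y2 = m"
  shows "beval (layout_circ e k m w rest) (ek @ key @ y1 @ y2) =
    y1 @ ek @ wired_code w rest key @ y2"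
proof -
  define ws where "ws = (ek @ key @ y1 @ y2) @ [False, True]"
  have "map (\<lambda>i. ws ! i) (map (\<lambda>i. e + k + i) [0..<m]) = y1"
    using assms by (intro nth_equalityI) (simp_all add: ws_def nth_append)
  moreover have "map (\<lambda>i. ws ! i) [0..<e] = ek"
    using assms by (intro nth_equalityI) (simp_all add: ws_def nth_append)
  moreover have "map (\<lambda>i. ws ! i) (map (\<lambda>i. e + k + m + i) [0..<m]) = y2"
    using assms by (intro nth_equalityI) (simp_all add: ws_def nth_append)
  moreover have "map (\<lambda>i. ws ! i) (code_wires e (e + (k + (m + m))) k w rest) =
      wired_code w rest key"
    using assms by (intro nth_code_wires) (simp_all add: ws_def nth_append)
  moreover have "wires (ek @ key @ y1 @ y2) [ConstG False, ConstG True] = ws"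
    by (simp add: ws_def)
  ultimately show ?thesis
    by (simp only: beval_wires layout_circ_def fst_conv snd_conv map_append)
qed

lemma wf_layout:
  "wf_circ (e + (k + (m + m))) (m + (e + (length (code_wires e (e + (k + (m + m))) k w rest) + m))) (layout_circ e k m w rest)"
proof -
  have "i < e + (k + (m + m)) + 2" if "i \<in> set (code_wires e (e + (k + (m + m))) k w rest)" for i
    using set_code_wires[OF that] by simp
  then show ?thesis
    by (auto simp: wf_circ_gates_ok layout_circ_def bsize_def add.assoc)
qed

lemma bsize_layout: "bsize (layout_circ e k m w rest) = 2"
  by (simp add: layout_circ_def bsize_def)

context pirates
begin

definition inverter :: "nat \<Rightarrow> nat \<Rightarrow> bits \<Rightarrow> qcirc \<Rightarrow> qcirc" where
  "inverter k w rest Ob =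
     compile (ekl + (k + (m + m))) (layout_circ ekl k m w rest) @
     map (shift_op m) (map (shift_op ekl) Ob @ A) @ par n B C"

text \<open>The simulation is exact: from the data that the one-wayness game provides, the inverter
  writes the circuit description, obfuscates it, runs A on the program, and gives the two images to
  B and C as their challenges.\<close>

lemma
  assumes Ob: "wf_qcirc cl Ob reg"
    and key: "length key = k" and cl: "length ((wired_code w rest key)) = cl"
  shows wf_inverter: "wf_qcirc (ekl + (k + (m + m))) (inverter k w rest Ob) (n + n)"
    and inverter_prob:
      "length ek = ekl \<Longrightarrow> length y1 = m \<Longrightarrow> length y2 = m \<Longrightarrow> length x1 = n \<Longrightarrow> length x2 = n \<Longrightarrow>
        out_prob (inverter k w rest Ob) (ek @ key @ y1 @ y2) (x1 @ x2) =
        search_dist ek y1 y2 (run Ob (basis ((wired_code w rest key)))) x1 x2"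
proof -
  let ?L = "layout_circ ekl k m w rest"
  let ?p = "run Ob (basis ((wired_code w rest key)))"
  let ?S = "map (shift_op ekl) Ob @ A"
  have "length (code_wires ekl N k w rest) = cl" for N
    unfolding code_wires_def cl[symmetric] wired_code_def key[symmetric]
    by (simp add: length_concat o_def sum_list_triv)
  then have L: "wf_circ (ekl + (k + (m + m))) (m + (ekl + (cl + m))) ?L"
    using wf_layout[of ekl k m w rest] by simp
  have w0: "wf_qcirc (ekl + cl + m) (map (shift_op ekl) Ob) (ekl + reg + m)"
    by (intro wf_qcirc_local wf_qcirc_shift Ob)
  have w1: "wf_qcirc (ekl + cl + m) ?S (rB + rC + m)"
    by (intro wf_qcirc_append[OF w0] wf_qcirc_local[OF wfA])
  have w2: "wf_qcirc (m + (ekl + (cl + m))) (map (shift_op m) ?S) (m + (rB + rC + m))"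
    using wf_qcirc_shift[OF w1] by (simp only: add.assoc)
  have w3: "wf_qcirc (m + (rB + rC + m)) (par n B C) (n + n)"
    using wf_qcirc_par[OF wfB wfC] by (simp add: add.assoc)
  show "wf_qcirc (ekl + (k + (m + m))) (inverter k w rest Ob) (n + n)"
    unfolding inverter_def by (intro wf_qcirc_append[OF wf_compile[OF L]] wf_qcirc_append[OF w2] w3)
  assume len: "length ek = ekl" "length y1 = m" "length y2 = m" "length x1 = n" "length x2 = n"
  let ?z = "y1 @ ek @ (wired_code w rest key) @ y2"
  have "eqst (m + (ekl + (cl + m))) (run (compile (ekl + (k + (m + m))) ?L) (basis (ek @ key @ y1 @ y2))) (basis ?z)"
    using run_compile_basis[OF L, of "ek @ key @ y1 @ y2"] beval_layout[of ek ekl key k y1 m y2] len key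
    by simp
  also have "eqst (m + (ekl + (cl + m))) (basis ?z) (tensor m (basis y1) (basis (ek @ (wired_code w rest key) @ y2)))"
    by (rule basis_tensor) (rule len)
  also have "eqst (m + (ekl + (cl + m))) (tensor m (basis y1) (basis (ek @ (wired_code w rest key) @ y2)))
      (tensor m (basis y1) (tensor ekl (basis ek) (tensor cl (basis ((wired_code w rest key))) (basis y2))))"
  proof (intro tensor_cong eqst_refl)
    have "eqst (ekl + (cl + m)) (basis (ek @ (wired_code w rest key) @ y2)) (tensor ekl (basis ek) (basis ((wired_code w rest key) @ y2)))"
      by (rule basis_tensor) (rule len)
    also have "eqst (ekl + (cl + m)) (tensor ekl (basis ek) (basis ((wired_code w rest key) @ y2)))
        (tensor ekl (basis ek) (tensor cl (basis ((wired_code w rest key))) (basis y2)))"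
      by (intro tensor_cong eqst_refl basis_tensor) (rule cl)
    finally show "eqst (ekl + (cl + m)) (basis (ek @ (wired_code w rest key) @ y2))
        (tensor ekl (basis ek) (tensor cl (basis ((wired_code w rest key))) (basis y2)))" .
  qed
  finally have 1: "eqst (m + (ekl + (cl + m))) (run (compile (ekl + (k + (m + m))) ?L) (basis (ek @ key @ y1 @ y2)))
      (tensor m (basis y1) (tensor ekl (basis ek) (tensor cl (basis ((wired_code w rest key))) (basis y2))))" .
  have "eqst (ekl + (reg + m)) (run (map (shift_op ekl) Ob) (tensor ekl (basis ek) (tensor cl (basis ((wired_code w rest key))) (basis y2))))
      (tensor ekl (basis ek) (run Ob (tensor cl (basis ((wired_code w rest key))) (basis y2))))"
    by (rule run_tensor_right[OF wf_qcirc_local[OF Ob]])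
  also have "eqst (ekl + (reg + m)) (tensor ekl (basis ek) (run Ob (tensor cl (basis ((wired_code w rest key))) (basis y2))))
      (tensor ekl (basis ek) (tensor reg ?p (basis y2)))"
    by (intro tensor_cong eqst_refl run_tensor_left[OF Ob])
  finally have "eqst (ekl + reg + m) (run (map (shift_op ekl) Ob) (tensor ekl (basis ek) (tensor cl (basis ((wired_code w rest key))) (basis y2))))
      (tensor (ekl + reg) (tensor ekl (basis ek) ?p) (basis y2))"
    by (simp only: add.assoc tensor_assoc[symmetric])
  then have "eqst (rB + rC + m) (run ?S (tensor ekl (basis ek) (tensor cl (basis ((wired_code w rest key))) (basis y2))))
      (run A (tensor (ekl + reg) (tensor ekl (basis ek) ?p) (basis y2)))"
    unfolding run_append by (rule run_cong[OF wf_qcirc_local[OF wfA]])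
  also have "eqst (rB + rC + m) (run A (tensor (ekl + reg) (tensor ekl (basis ek) ?p) (basis y2)))
      (tensor (rB + rC) (bipartite ek ?p) (basis y2))"
    unfolding bipartite_def by (rule run_tensor_left[OF wfA])
  finally have 2: "eqst (rB + rC + m) (run ?S (tensor ekl (basis ek) (tensor cl (basis ((wired_code w rest key))) (basis y2))))
      (tensor (rB + rC) (bipartite ek ?p) (basis y2))" .
  have "eqst (m + (rB + rC + m)) (run (map (shift_op m) ?S) (run (compile (ekl + (k + (m + m))) ?L) (basis (ek @ key @ y1 @ y2))))
      (run (map (shift_op m) ?S) (tensor m (basis y1) (tensor ekl (basis ek) (tensor cl (basis ((wired_code w rest key))) (basis y2)))))"
    by (rule run_cong[OF w2 1])
  also have "eqst (m + (rB + rC + m)) (run (map (shift_op m) ?S) (tensor m (basis y1) (tensor ekl (basis ek) (tensor cl (basis ((wired_code w rest key))) (basis y2)))))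
      (tensor m (basis y1) (run ?S (tensor ekl (basis ek) (tensor cl (basis ((wired_code w rest key))) (basis y2)))))"
    by (rule run_tensor_right[OF w1])
  also have "eqst (m + (rB + rC + m)) (tensor m (basis y1) (run ?S (tensor ekl (basis ek) (tensor cl (basis ((wired_code w rest key))) (basis y2)))))
      (challenge ek y1 y2 ?p)"
    unfolding challenge_def challenge_state_def by (intro tensor_cong eqst_refl 2)
  finally have "eqst (n + n) (run (inverter k w rest Ob) (basis (ek @ key @ y1 @ y2))) (run (par n B C) (challenge ek y1 y2 ?p))"
    unfolding inverter_def run_append by (rule run_cong[OF w3])
  then show "out_prob (inverter k w rest Ob) (ek @ key @ y1 @ y2) (x1 @ x2) = search_dist ek y1 y2 ?p x1 x2"
    unfolding out_prob_def search_dist_def by (rule eqst_outcome) (simp add: len)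
qed

end

section \<open>Puncturable trapdoor functions\<close>

lemma argmax_finite:
  fixes h :: "'a \<Rightarrow> real"
  assumes "finite S" "S \<noteq> {}"
  shows "\<exists>t\<in>S. \<forall>s\<in>S. h s \<le> h t"
proof -
  have "Max (h ` S) \<in> h ` S"
    using assms by (intro Max_in) auto
  then obtain t where "t \<in> S" "Max (h ` S) = h t"
    by auto
  then show ?thesis
    using assms by (metis Max_ge finite_imageI imageI)
qed

lemma negligible_abs: "negligible \<epsilon> \<Longrightarrow> negligible (\<lambda>\<kappa>. \<bar>\<epsilon> \<kappa>\<bar>)"
  by (simp add: negligible_def)

lemma kg_nonneg: "kg_prob P \<kappa> ek td \<ge> 0"
  by (simp add: kg_prob_def out_prob_nonneg)

lemma punc_nonneg: "punc_prob P \<kappa> td y1 y2 ptd \<ge> 0"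
  by (simp add: punc_prob_def out_prob_nonneg)

lemma length_tdf_eval: "tdf_efficient P \<Longrightarrow> length (tdf_eval P \<kappa> ek x) = t_m P \<kappa>"
  by (simp add: tdf_efficient_def tdf_eval_def poly_circ_def wf_circ_def)

lemma kg_total:
  assumes "tdf_efficient P"
  shows "(\<Sum>ek\<in>bitstrings (t_ek P \<kappa>). \<Sum>td\<in>bitstrings (t_td P \<kappa>). kg_prob P \<kappa> ek td) = 1"
proof -
  have "wf_qcirc 0 (t_KG P \<kappa>) (t_ek P \<kappa> + t_td P \<kappa>)"
    using assms by (simp add: tdf_efficient_def qpt_def)
  then show ?thesis
    using sum_out_prob[of 0 "t_KG P \<kappa>" "t_ek P \<kappa> + t_td P \<kappa>" "[]"] by (simp add: kg_prob_def sum_bitstrings_append)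
qed

lemma punc_total:
  assumes "tdf_efficient P" "length td = t_td P \<kappa>" "length y1 = t_m P \<kappa>" "length y2 = t_m P \<kappa>"
  shows "(\<Sum>ptd\<in>bitstrings (t_ptd P \<kappa>). punc_prob P \<kappa> td y1 y2 ptd) = 1"
proof -
  have "wf_qcirc (t_td P \<kappa> + (t_m P \<kappa> + t_m P \<kappa>)) (t_Punc P \<kappa>) (t_ptd P \<kappa>)"
    using assms by (simp add: tdf_efficient_def qpt_def)
  then show ?thesis
    unfolding punc_prob_def by (rule sum_out_prob) (simp add: assms)
qed

lemma sum_uniform: "(\<Sum>x1\<in>bitstrings n. \<Sum>x2\<in>bitstrings n. (1 / 2 ^ n)\<^sup>2 :: real) = 1"
  by (simp add: card_bitstrings power2_eq_square)

text \<open>Key generation starts without qubits and each operation adds at most one, so the number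
  of gates bounds the key lengths.\<close>

lemma poly_bounded_key_lengths:
  assumes "tdf_efficient P"
  shows "poly_bounded (t_ek P)" "poly_bounded (t_td P)"
proof -
  have wf: "wf_qcirc 0 (t_KG P \<kappa>) (t_ek P \<kappa> + t_td P \<kappa>)" for \<kappa>
    using assms by (simp add: tdf_efficient_def qpt_def)
  have pb: "poly_bounded (\<lambda>\<kappa>. length (t_KG P \<kappa>))"
    using assms by (simp add: tdf_efficient_def qpt_def)
  have "t_ek P \<kappa> \<le> length (t_KG P \<kappa>)" "t_td P \<kappa> \<le> length (t_KG P \<kappa>)" for \<kappa>
    using wf_qcirc_width[OF wf[of \<kappa>]] by simp_all
  then show "poly_bounded (t_ek P)" "poly_bounded (t_td P)"
    using poly_bounded_mono[OF pb] by blast+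
qed

text \<open>Guessing shows that one-wayness forces the domain to grow.\<close>

lemma domain_grows:
  assumes P: "tdf_efficient P" "one_way_punctured P" and ptd: "poly_bounded (t_ptd P)"
  shows "eventually (\<lambda>\<kappa>. real (t_n P \<kappa>) \<ge> real \<kappa> powr (1 / 2)) sequentially"
proof -
  define lin where "lin \<kappa> = t_ek P \<kappa> + (t_ptd P \<kappa> + (t_m P \<kappa> + t_m P \<kappa>))" for \<kappa>
  \<comment> \<open>The guess: a single hard-wired 0 on wire \<open>lin \<kappa>\<close>, the first
    one behind the input, is read by all 2 n outputs.\<close>
  define Z where "Z \<kappa> = hardwire [False] (wiring (replicate (t_n P \<kappa> + t_n P \<kappa>) (lin \<kappa>)))" for \<kappa>
  have wfZ: "wf_circ (lin \<kappa>) (t_n P \<kappa> + t_n P \<kappa>) (Z \<kappa>)" for \<kappa>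
    unfolding Z_def by (rule wf_hardwire) (simp add: wf_circ_def wiring_def)
  have len: "length (compile (lin \<kappa>) (Z \<kappa>)) \<le> 5 + 2 * (t_n P \<kappa> + t_n P \<kappa>) + lin \<kappa>" for \<kappa>
    using length_compile[of "lin \<kappa>" "Z \<kappa>"] wfZ[of \<kappa>]
    by (simp add: Z_def wiring_def hardwire_def bsize_def)
  have evalZ: "beval (Z \<kappa>) x = replicate (t_n P \<kappa>) False @ replicate (t_n P \<kappa>) False" if "length x = lin \<kappa>" for \<kappa> x
    using that by (simp add: Z_def beval_hardwire beval_wiring nth_append replicate_add)
  have pb: "poly_bounded (t_n P)" "poly_bounded (t_m P)"
    using P by (auto simp: tdf_efficient_def intro: polynomial_poly_bounded)
  have "qpt lin (\<lambda>\<kappa>. compile (lin \<kappa>) (Z \<kappa>)) (\<lambda>\<kappa>. t_n P \<kappa> + t_n P \<kappa>)"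
    unfolding qpt_def
  proof (intro conjI allI wf_compile wfZ)
    show "poly_bounded (\<lambda>\<kappa>. length (compile (lin \<kappa>) (Z \<kappa>)))"
      by (rule poly_bounded_mono[OF _ len], unfold lin_def)
        (intro poly_bounded_intros pb ptd poly_bounded_key_lengths P)
  qed
  then obtain \<epsilon> where \<epsilon>: "negligible \<epsilon>" "\<And>\<kappa>. ow_win P (\<lambda>\<kappa>. compile (lin \<kappa>) (Z \<kappa>)) \<kappa> \<le> \<epsilon> \<kappa>"
    using P(2) unfolding one_way_punctured_def lin_def by blast
  have "1 / 2 ^ t_n P \<kappa> \<le> ow_win P (\<lambda>\<kappa>. compile (lin \<kappa>) (Z \<kappa>)) \<kappa>" for \<kappa>
  proof -
    let ?n = "t_n P \<kappa>" and ?z = "replicate (t_n P \<kappa>) False"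
    have inner: "of_bool (x1 = ?z) \<le> (\<Sum>x1'\<in>bitstrings ?n. \<Sum>x2'\<in>bitstrings ?n.
        of_bool (x1' = x1 \<or> x2' = x2) * out_prob (compile (lin \<kappa>) (Z \<kappa>)) x (x1' @ x2'))"
      if "length x = lin \<kappa>" for x x1 x2
    proof -
      let ?f = "\<lambda>x1' x2'. of_bool (x1' = x1 \<or> x2' = x2) * out_prob (compile (lin \<kappa>) (Z \<kappa>)) x (x1' @ x2')"
      have nonneg: "?f x1' x2' \<ge> 0" for x1' x2'
        by (simp add: out_prob_nonneg)
      have "out_prob (compile (lin \<kappa>) (Z \<kappa>)) x (?z @ ?z) = 1"
        using eqstD[OF run_compile_basis[OF wfZ that], of "?z @ ?z" "?z @ ?z"]
        by (simp add: out_prob_def outcome_def evalZ[OF that] basis_def)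
      then have "of_bool (x1 = ?z) \<le> ?f ?z ?z"
        by simp
      also have "\<dots> \<le> (\<Sum>x2'\<in>bitstrings ?n. ?f ?z x2')"
        by (intro member_le_sum[of ?z _ "?f ?z"] nonneg) simp_all
      also have "\<dots> \<le> (\<Sum>x1'\<in>bitstrings ?n. \<Sum>x2'\<in>bitstrings ?n. ?f x1' x2')"
        by (intro member_le_sum[of ?z _ "\<lambda>x1'. \<Sum>x2'\<in>bitstrings ?n. ?f x1' x2'"] sum_nonneg nonneg) simp_all
      finally show ?thesis .
    qed
    have "1 / 2 ^ ?n = (\<Sum>ek\<in>bitstrings (t_ek P \<kappa>). \<Sum>td\<in>bitstrings (t_td P \<kappa>). kg_prob P \<kappa> ek td * (1 / 2 ^ ?n))"
      by (simp only: sum_distrib_right[symmetric] kg_total[OF P(1)] mult_1)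
    also have "\<dots> \<le> ow_win P (\<lambda>\<kappa>. compile (lin \<kappa>) (Z \<kappa>)) \<kappa>"
      unfolding ow_win_def
    proof (intro sum_mono mult_left_mono kg_nonneg)
      fix ek td assume ek: "ek \<in> bitstrings (t_ek P \<kappa>)" and td: "td \<in> bitstrings (t_td P \<kappa>)"
      have "(1::real) / 2 ^ ?n = (\<Sum>x1\<in>bitstrings ?n. \<Sum>x2\<in>bitstrings ?n. (1 / 2 ^ ?n)\<^sup>2 * of_bool (x1 = ?z))"
        by (simp add: sum_distrib_left[symmetric] sum_divide_distrib[symmetric] of_bool_def card_bitstrings power2_eq_square)
      also have "\<dots> \<le> (\<Sum>x1\<in>bitstrings ?n. \<Sum>x2\<in>bitstrings ?n. (1 / 2 ^ ?n)\<^sup>2 *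
         (let y1 = tdf_eval P \<kappa> ek x1; y2 = tdf_eval P \<kappa> ek x2 in
          \<Sum>ptd\<in>bitstrings (t_ptd P \<kappa>). punc_prob P \<kappa> td y1 y2 ptd *
            (\<Sum>x1'\<in>bitstrings ?n. \<Sum>x2'\<in>bitstrings ?n.
               of_bool (x1' = x1 \<or> x2' = x2) *
               out_prob (compile (lin \<kappa>) (Z \<kappa>)) (ek @ ptd @ y1 @ y2) (x1' @ x2'))))"
        unfolding Let_def
      proof (intro sum_mono mult_left_mono)
        fix x1 x2
        let ?y1 = "tdf_eval P \<kappa> ek x1" and ?y2 = "tdf_eval P \<kappa> ek x2"
        have "of_bool (x1 = ?z) = (\<Sum>ptd\<in>bitstrings (t_ptd P \<kappa>). punc_prob P \<kappa> td ?y1 ?y2 ptd * of_bool (x1 = ?z))"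
          using td by (simp only: sum_distrib_right[symmetric]) (simp add: punc_total P length_tdf_eval)
        also have "\<dots> \<le> (\<Sum>ptd\<in>bitstrings (t_ptd P \<kappa>). punc_prob P \<kappa> td ?y1 ?y2 ptd *
            (\<Sum>x1'\<in>bitstrings ?n. \<Sum>x2'\<in>bitstrings ?n.
               of_bool (x1' = x1 \<or> x2' = x2) *
               out_prob (compile (lin \<kappa>) (Z \<kappa>)) (ek @ ptd @ ?y1 @ ?y2) (x1' @ x2')))"
          using ek by (intro sum_mono mult_left_mono punc_nonneg inner) (simp add: lin_def length_tdf_eval P)
        finally show "of_bool (x1 = ?z) \<le> \<dots>" .
      qed simp
      finally show "(1::real) / 2 ^ ?n \<le> \<dots>" .
    qed
    finally show ?thesis .
  qed
  then have "1 / 2 ^ t_n P \<kappa> \<le> \<epsilon> \<kappa>" for \<kappa>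
    using \<epsilon>(2) order_trans by blast
  then show ?thesis
    using P(1) \<epsilon>(1) unfolding tdf_efficient_def by (blast intro: polynomial_ge_sqrt)
qed

section \<open>The unclonability game\<close>

lemma positive_obfuscated: "positive (obfuscated U \<kappa> K)"
  unfolding obfuscated_def by (intro positive_run positive_basis)

context pirates
begin

text \<open>The weight 1/2 of each bit b gives the factor 2. \<open>A1\<close> outputs
  \<open>K0\<close> with certainty, and the terms of the other circuits are nonnegative and dropped.
  The data of the game are families with values prescribed at this \<kappa>, so that a locale for
  one parameter can speak about the asymptotic game.\<close>

lemma upo_win_ge:
  fixes U :: upo and \<kappa> :: nat
  assumes ek: "length ek = ekl" and K0: "K0 \<in> u_class U \<kappa>" and m: "u_in U \<kappa> = m"
    and D: "DB \<kappa> = sampler n Ev ek" "DC \<kappa> = sampler n Ev ek"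
    and aux: "aux \<kappa> = 0" and regs: "rB' \<kappa> = rB" "rC' \<kappa> = rC"
    and A1: "A1 \<kappa> = compile 0 (const_circ (code m K0))"
    and A2: "A2 \<kappa> = prepare ek"
    and BC: "B' \<kappa> = player_B n m Ev ek B" "C' \<kappa> = player_C n m rC Ev ek C"
  shows "(\<Sum>xB\<in>bitstrings n. \<Sum>xC\<in>bitstrings n. (1 / 2 ^ n)\<^sup>2 *
      (check_dist ek (ev ek xB) (ev ek xC) (obfuscated U \<kappa> K0) False False +
       check_dist ek (ev ek xB) (ev ek xC) (obfuscated U \<kappa> (puncture_circ m K0 (ev ek xB) (ev ek xC))) True True))
    \<le> 2 * upo_win U DB DC aux rB' rC' A1 A2 B' C' \<kappa>"
proof -
  define p where "p b yB yC = obfuscated U \<kappa> (if b then puncture_circ m K0 yB yC else K0)" for b yB yC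
  define T where "T b yB yC K =
    (let st = measured (code m K) (run (A1 \<kappa>) (basis []));
         p = obfuscated U \<kappa> (if b then puncture_circ m K yB yC else K);
         bip = run (A2 \<kappa>) (tensor (aux \<kappa>) st p);
         fin = run (par 1 (B' \<kappa>) (C' \<kappa>)) (tensor m (basis yB) (tensor (rB' \<kappa> + rC' \<kappa>) bip (basis yC)))
     in outcome fin [b, b])" for b yB yC K
  let ?D = "out_prob (sampler n Ev ek) []"
  have win: "upo_win U DB DC aux rB' rC' A1 A2 B' C' \<kappa> =
      (\<Sum>b\<in>UNIV. 1 / 2 * (\<Sum>yB\<in>bitstrings m. \<Sum>yC\<in>bitstrings m. ?D yB * ?D yC * (\<Sum>K\<in>u_class U \<kappa>. T b yB yC K)))"
    unfolding upo_win_def T_def m D ..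
  have T_nonneg: "T b yB yC K \<ge> 0" for b yB yC K
    unfolding T_def Let_def
    by (intro positive_outcome positive_run positive_tensor positive_measured positive_basis positive_obfuscated)
  have T_K0: "T b yB yC K0 = check_dist ek yB yC (p b yB yC) b b" for b yB yC
  proof -
    have "eqst (length (code m K0)) (run (A1 \<kappa>) (basis [])) (basis (code m K0))"
      unfolding A1 using run_compile_basis[OF wf_const, of "[]" "code m K0"] by (simp add: beval_const)
    then have "measured (code m K0) (run (A1 \<kappa>) (basis [])) [] [] = 1"
      by (simp add: measured_def eqstD basis_def)
    then have "tensor (aux \<kappa>) (measured (code m K0) (run (A1 \<kappa>) (basis []))) q = q" for q
      by (simp add: aux tensor_0)
    then have "T b yB yC K0 = outcome (run (players ek) (challenge_state m yB (rB + rC) (run (prepare ek) (p b yB yC)) yC)) [b, b]"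
      by (simp add: T_def Let_def A2 BC regs players_def p_def challenge_state_def)
    also have "\<dots> = check_dist ek yB yC (p b yB yC) b b"
      unfolding check_dist_def
      by (rule eqst_outcome[OF run_cong[OF wf_players[OF ek] challenge_cong[OF run_prepare[OF ek]]]]) simp
    finally show ?thesis .
  qed
  have fin: "finite (u_class U \<kappa>)"
    by (simp add: u_class_def finite_circuits)
  have T_sum: "check_dist ek yB yC (p b yB yC) b b \<le> (\<Sum>K\<in>u_class U \<kappa>. T b yB yC K)" for b yB yC
    unfolding T_K0[symmetric] by (rule member_le_sum[OF K0 T_nonneg fin])
  define h where "h b = (\<Sum>xB\<in>bitstrings n. \<Sum>xC\<in>bitstrings n.
      (1 / 2 ^ n)\<^sup>2 * check_dist ek (ev ek xB) (ev ek xC) (p b (ev ek xB) (ev ek xC)) b b)" for b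
  have "h b \<le> (\<Sum>yB\<in>bitstrings m. \<Sum>yC\<in>bitstrings m. ?D yB * ?D yC * (\<Sum>K\<in>u_class U \<kappa>. T b yB yC K))" for b
  proof -
    have "h b = (\<Sum>xB\<in>bitstrings n. 1 / 2 ^ n * (\<Sum>xC\<in>bitstrings n. 1 / 2 ^ n *
        check_dist ek (ev ek xB) (ev ek xC) (p b (ev ek xB) (ev ek xC)) b b))"
      unfolding h_def by (simp add: sum_distrib_left power2_eq_square)
    also have "\<dots> = (\<Sum>yB\<in>bitstrings m. ?D yB * (\<Sum>yC\<in>bitstrings m. ?D yC * check_dist ek yB yC (p b yB yC) b b))"
      by (simp only: sampler_expectation[OF ek])
    also have "\<dots> = (\<Sum>yB\<in>bitstrings m. \<Sum>yC\<in>bitstrings m. ?D yB * ?D yC * check_dist ek yB yC (p b yB yC) b b)"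
      by (simp only: sum_distrib_left mult.assoc)
    also have "\<dots> \<le> (\<Sum>yB\<in>bitstrings m. \<Sum>yC\<in>bitstrings m. ?D yB * ?D yC * (\<Sum>K\<in>u_class U \<kappa>. T b yB yC K))"
      by (intro sum_mono mult_left_mono T_sum mult_nonneg_nonneg out_prob_nonneg)
    finally show ?thesis .
  qed
  from this[of False] this[of True] have "h False + h True \<le> 2 * upo_win U DB DC aux rB' rC' A1 A2 B' C' \<kappa>"
    unfolding win UNIV_bool by simp
  then show ?thesis
    by (simp add: h_def p_def sum.distrib distrib_left)
qed

end

section \<open>Search anti-piracy\<close>

lemma outputs_hardwire: "length (snd (hardwire key K)) = length (snd K)"
  by (simp add: hardwire_def)

lemma length_player_B:
  "length (player_B n m Ev ek B) \<le> length B + (5 * (length ek + bsize Ev) + 2 * length (snd Ev) + n) + 35 * m + 12"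
  using length_compile[of m "dup_circ m"] length_compile[of n "hardwire ek Ev"] length_compile[of "2 * m" "neq_circ m"]
  by (simp add: player_B_def bsize_neq bsize_dup outputs_hardwire)

lemma length_player_C:
  "length (player_C n m r Ev ek C) \<le> length C + (5 * (length ek + bsize Ev) + 2 * length (snd Ev) + n) + 35 * m + 12"
  using length_compile[of m "dup_circ m"] length_compile[of n "hardwire ek Ev"] length_compile[of "2 * m" "neq_circ m"]
  by (simp add: player_C_def bsize_neq bsize_dup outputs_hardwire)

lemma length_sampler:
  "length (sampler n Ev ek) \<le> 3 * n + 5 * (length ek + bsize Ev) + 2 * length (snd Ev)"
  using length_compile[of n "hardwire ek Ev"]
  by (simp add: sampler_def length_uniform hardwire_def bsize_def)

section \<open>The reductions as families in the security parameter\<close>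

locale attack =
  fixes P :: ptdf and U :: upo and rB rC :: "nat \<Rightarrow> nat" and A B C :: "nat \<Rightarrow> qcirc"
  assumes P: "puncturable_tdf P"
    and U: "is_upo (1 / 2) U"
    and fits: "upo_fits P U"
    and A: "qpt (\<lambda>\<kappa>. t_ek P \<kappa> + u_reg U \<kappa>) A (\<lambda>\<kappa>. rB \<kappa> + rC \<kappa>)"
    and B: "qpt (\<lambda>\<kappa>. t_m P \<kappa> + rB \<kappa>) B (t_n P)"
    and C: "qpt (\<lambda>\<kappa>. rC \<kappa> + t_m P \<kappa>) C (t_n P)"
begin

lemma P_eff: "tdf_efficient P" and P_inv: "inversion_correct P" and P_punc: "puncturing_correct P"
  and P_ow: "one_way_punctured P"
  using P by (simp_all add: puncturable_tdf_def)

lemma U_eff: "upo_efficient U" and U_sec: "upo_secure (1 / 2) U" and U_io: "io_secure U"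
  using U by (simp_all add: is_upo_def)

lemma u_in [simp]: "u_in U \<kappa> = t_m P \<kappa>" and u_out [simp]: "u_out U \<kappa> = t_n P \<kappa> + 1"
  and inv_fits: "bsize (t_Inv P \<kappa>) + t_td P \<kappa> \<le> u_size U \<kappa>"
  and punc_inv_fits: "bsize (t_PuncInv P \<kappa>) + t_ptd P \<kappa> \<le> u_size U \<kappa>"
  using fits by (simp_all add: upo_fits_def)

lemma size_le_full: "u_size U \<kappa> \<le> u_full U \<kappa>"
  by (simp add: u_full_def)

lemma pb_n: "poly_bounded (t_n P)" and pb_m: "poly_bounded (t_m P)"
  using P_eff by (auto simp: tdf_efficient_def intro: polynomial_poly_bounded)

lemma pb_ek: "poly_bounded (t_ek P)"
  by (rule poly_bounded_key_lengths[OF P_eff])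

lemma pb_size: "poly_bounded (u_size U)"
  using U_eff by (simp add: upo_efficient_def)

lemma pb_ptd: "poly_bounded (t_ptd P)"
  by (rule poly_bounded_mono[OF pb_size]) (use punc_inv_fits in \<open>meson add_leD2\<close>)

lemma pb_code_len:
  assumes "poly_bounded s"
  shows "poly_bounded (\<lambda>\<kappa>. code_len (t_m P \<kappa>) (t_n P \<kappa> + 1) (s \<kappa>))"
  unfolding code_len_def by (intro poly_bounded_intros assms pb_n pb_m)

lemma pb_full: "poly_bounded (u_full U)"
proof -
  have "poly_bounded (\<lambda>\<kappa>. u_size U \<kappa> + puncture_overhead (t_m P \<kappa>) (t_n P \<kappa> + 1))"
    unfolding puncture_overhead_def by (intro poly_bounded_intros pb_size pb_n pb_m)
  then show ?thesis
    by (rule poly_bounded_mono) (simp add: u_full_def)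
qed

lemma pb_circuits:
  "poly_bounded (\<lambda>\<kappa>. length (A \<kappa>))" "poly_bounded (\<lambda>\<kappa>. length (B \<kappa>))" "poly_bounded (\<lambda>\<kappa>. length (C \<kappa>))"
  "poly_bounded (\<lambda>\<kappa>. bsize (t_Eval P \<kappa>))" "poly_bounded (\<lambda>\<kappa>. length (u_Obf U \<kappa>))"
  using A B C P_eff U_eff by (simp_all add: qpt_def tdf_efficient_def poly_circ_def upo_efficient_def)

lemma wf_Eval: "wf_circ (t_n P \<kappa> + t_ek P \<kappa>) (t_m P \<kappa>) (t_Eval P \<kappa>)"
  using P_eff by (simp add: tdf_efficient_def poly_circ_def)

lemma wf_Obf: "wf_qcirc (code_len (t_m P \<kappa>) (t_n P \<kappa> + 1) (u_full U \<kappa>)) (u_Obf U \<kappa>) (u_reg U \<kappa>)"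
  using U_eff by (simp add: upo_efficient_def qpt_def)

sublocale pir: pirates "t_n P \<kappa>" "t_m P \<kappa>" "rB \<kappa>" "rC \<kappa>" "u_reg U \<kappa>" "t_ek P \<kappa>" "A \<kappa>" "B \<kappa>" "C \<kappa>" "t_Eval P \<kappa>" for \<kappa>
  using A B C wf_Eval by unfold_locales (simp_all add: qpt_def)

abbreviation N :: "nat \<Rightarrow> nat" where "N \<equiv> t_n P"
abbreviation M :: "nat \<Rightarrow> nat" where "M \<equiv> t_m P"

abbreviation ev :: "nat \<Rightarrow> bits \<Rightarrow> bits \<Rightarrow> bits" where
  "ev \<equiv> tdf_eval P"

text \<open>Padding to \<open>u_size\<close> gives membership in the class; puncturing then adds
  exactly the overhead up to \<open>u_full\<close>. In \<open>punc_inv_padded\<close> the padding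
  goes to \<open>u_full\<close> at once, since iO security compares circuits of equal size.\<close>

definition inv_padded :: "nat \<Rightarrow> bits \<Rightarrow> bcirc" where
  "inv_padded \<kappa> td = pad (u_size U \<kappa>) (inv_circ P \<kappa> td)"

definition inv_punctured :: "nat \<Rightarrow> bits \<Rightarrow> bits \<Rightarrow> bits \<Rightarrow> bcirc" where
  "inv_punctured \<kappa> td y1 y2 = puncture_circ (M \<kappa>) (inv_padded \<kappa> td) y1 y2"

definition punc_inv_padded :: "nat \<Rightarrow> bits \<Rightarrow> bcirc" where
  "punc_inv_padded \<kappa> ptd = pad (u_full U \<kappa>) (punc_inv_circ P \<kappa> ptd)"

lemma wf_inv_circ: "length td = t_td P \<kappa> \<Longrightarrow> wf_circ (M \<kappa>) (N \<kappa> + 1) (inv_circ P \<kappa> td)"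
  unfolding inv_circ_def using P_eff by (intro wf_hardwire) (simp add: tdf_efficient_def poly_circ_def)

lemma wf_punc_inv_circ: "length ptd = t_ptd P \<kappa> \<Longrightarrow> wf_circ (M \<kappa>) (N \<kappa> + 1) (punc_inv_circ P \<kappa> ptd)"
  unfolding punc_inv_circ_def using P_eff by (intro wf_hardwire) (simp add: tdf_efficient_def poly_circ_def)

lemma bsize_inv_circ: "length td = t_td P \<kappa> \<Longrightarrow> bsize (inv_circ P \<kappa> td) \<le> u_size U \<kappa>"
  using inv_fits[of \<kappa>] by (simp add: inv_circ_def add.commute)

lemma bsize_punc_inv_circ: "length ptd = t_ptd P \<kappa> \<Longrightarrow> bsize (punc_inv_circ P \<kappa> ptd) \<le> u_size U \<kappa>"
  using punc_inv_fits[of \<kappa>] by (simp add: punc_inv_circ_def add.commute)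

lemma inv_padded_class: "length td = t_td P \<kappa> \<Longrightarrow> inv_padded \<kappa> td \<in> u_class U \<kappa>"
  using wf_inv_circ[of td \<kappa>] by (simp add: inv_padded_def u_class_def circuits_def wf_pad bsize_pad bsize_inv_circ)

lemma wf_inv_punctured:
  assumes "length td = t_td P \<kappa>" "length y1 = M \<kappa>" "length y2 = M \<kappa>"
  shows "wf_circ (M \<kappa>) (N \<kappa> + 1) (inv_punctured \<kappa> td y1 y2)" "bsize (inv_punctured \<kappa> td y1 y2) = u_full U \<kappa>"
proof -
  have wf: "wf_circ (M \<kappa>) (N \<kappa> + 1) (inv_padded \<kappa> td)"
    unfolding inv_padded_def by (intro wf_pad wf_inv_circ assms)
  then show "wf_circ (M \<kappa>) (N \<kappa> + 1) (inv_punctured \<kappa> td y1 y2)"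
    unfolding inv_punctured_def by (intro wf_puncture assms)
  have "length (snd (inv_padded \<kappa> td)) = N \<kappa> + 1"
    using wf by (simp add: wf_circ_def)
  moreover have "bsize (inv_padded \<kappa> td) = u_size U \<kappa>"
    unfolding inv_padded_def using assms by (simp add: bsize_pad bsize_inv_circ)
  ultimately show "bsize (inv_punctured \<kappa> td y1 y2) = u_full U \<kappa>"
    using assms by (simp add: inv_punctured_def bsize_puncture u_full_def)
qed

lemma wf_punc_inv_padded:
  assumes "length ptd = t_ptd P \<kappa>"
  shows "wf_circ (M \<kappa>) (N \<kappa> + 1) (punc_inv_padded \<kappa> ptd)" "bsize (punc_inv_padded \<kappa> ptd) = u_full U \<kappa>"
proof -
  show "wf_circ (M \<kappa>) (N \<kappa> + 1) (punc_inv_padded \<kappa> ptd)"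
    unfolding punc_inv_padded_def by (intro wf_pad wf_punc_inv_circ assms)
  show "bsize (punc_inv_padded \<kappa> ptd) = u_full U \<kappa>"
    unfolding punc_inv_padded_def using bsize_punc_inv_circ[OF assms] size_le_full[of \<kappa>] by (simp add: bsize_pad)
qed

lemma punctured_equiv:
  assumes "length td = t_td P \<kappa>" "length ptd = t_ptd P \<kappa>" "length y1 = M \<kappa>" "length y2 = M \<kappa>" "length y = M \<kappa>"
    and "punctured_correct_at P \<kappa> td y1 y2 ptd"
  shows "beval (inv_punctured \<kappa> td y1 y2) y = beval (punc_inv_padded \<kappa> ptd) y"
proof -
  have "wf_circ (M \<kappa>) (N \<kappa> + 1) (inv_padded \<kappa> td)"
    unfolding inv_padded_def by (intro wf_pad wf_inv_circ assms)
  then have "beval (inv_punctured \<kappa> td y1 y2) y = (if y \<in> {y1, y2} then bot_out (N \<kappa> + 1) else beval (inv_padded \<kappa> td) y)"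
    unfolding inv_punctured_def using assms by (intro beval_puncture)
  also have "beval (inv_padded \<kappa> td) y = beval (inv_circ P \<kappa> td) y"
    unfolding inv_padded_def using wf_inv_circ[OF assms(1)] assms by (intro beval_pad) simp
  also have "(if y \<in> {y1, y2} then bot_out (N \<kappa> + 1) else beval (inv_circ P \<kappa> td) y) = beval (punc_inv_circ P \<kappa> ptd) y"
    using assms(5,6) by (simp add: punctured_correct_at_def)
  also have "\<dots> = beval (punc_inv_padded \<kappa> ptd) y"
    unfolding punc_inv_padded_def using wf_punc_inv_circ[OF assms(2)] assms by (intro beval_pad[symmetric]) simp
  finally show ?thesis .
qed

text \<open>The scheme obfuscates the unpadded circuit, while the player of the unclonability game
  must submit one of the class. As \<open>Obf\<close> pads its input anyway, and padding in two
  stages is padding once, both give the same state.\<close>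

lemma obfuscated_inv_padded: "length td = t_td P \<kappa> \<Longrightarrow> obfuscated U \<kappa> (inv_padded \<kappa> td) = obfuscated U \<kappa> (inv_circ P \<kappa> td)"
  unfolding obfuscated_def inv_padded_def by (simp add: pad_pad bsize_inv_circ size_le_full)

lemma qtrace_obfuscated:
  assumes "wf_circ (M \<kappa>) (N \<kappa> + 1) K" "bsize K \<le> u_full U \<kappa>"
  shows "qtrace (u_reg U \<kappa>) (obfuscated U \<kappa> K) = 1"
proof -
  have "length (snd (pad (u_full U \<kappa>) K)) = N \<kappa> + 1"
    using wf_pad[OF assms(1)] by (simp add: wf_circ_def)
  then have "length (code (M \<kappa>) (pad (u_full U \<kappa>) K)) = code_len (M \<kappa>) (N \<kappa> + 1) (u_full U \<kappa>)"
    using assms(2) by (simp add: length_code bsize_pad)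
  then show ?thesis
    by (simp add: obfuscated_def qtrace_run[OF wf_Obf] qtrace_basis)
qed

definition good :: "nat \<Rightarrow> bits \<Rightarrow> bits \<Rightarrow> bool" where
  "good \<kappa> ek td \<longleftrightarrow> (\<forall>x\<in>bitstrings (N \<kappa>). beval (inv_circ P \<kappa> td) (ev \<kappa> ek x) = val x)"

lemma good_inj: "good \<kappa> ek td \<Longrightarrow> inj_on (ev \<kappa> ek) (bitstrings (N \<kappa>))"
  unfolding good_def by (rule inj_onI) (metis list.inject val_def)

lemma pir_ev: "pir.ev \<kappa> ek x = ev \<kappa> ek x"
  by (simp add: tdf_eval_def)

text \<open>For fixed keys, the sum of the probabilities of the two ways to win the unclonability
  game: both output 0 on the intact program, both output 1 on the punctured one. It is at most twice
  the winning probability.\<close>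

definition gap :: "nat \<Rightarrow> bits \<times> bits \<Rightarrow> real" where
  "gap \<kappa> = (\<lambda>(ek, td). \<Sum>xB\<in>bitstrings (N \<kappa>). \<Sum>xC\<in>bitstrings (N \<kappa>). (1 / 2 ^ N \<kappa>)\<^sup>2 *
     (pir.check_dist \<kappa> ek (ev \<kappa> ek xB) (ev \<kappa> ek xC) (obfuscated U \<kappa> (inv_circ P \<kappa> td)) False False +
      pir.check_dist \<kappa> ek (ev \<kappa> ek xB) (ev \<kappa> ek xC) (obfuscated U \<kappa> (inv_punctured \<kappa> td (ev \<kappa> ek xB) (ev \<kappa> ek xC))) True True))"

lemma length_prepare: "length (pir.prepare \<kappa> ek) \<le> 7 * length ek + length (A \<kappa>)"
  using length_const[of ek] by (simp add: pir.prepare_def)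

lemma wf_sampler: "length ek = t_ek P \<kappa> \<Longrightarrow> wf_qcirc 0 (sampler (N \<kappa>) (t_Eval P \<kappa>) ek) (M \<kappa>)"
  unfolding sampler_def using wf_Eval[of \<kappa>] by (intro wf_qcirc_append[OF wf_uniform] hardwire_eval(1)) simp

text \<open>Almost-all-keys correctness gives good keys positive probability once its error is below
  1. The entropy condition on the hard-wired challenge distribution relies on them for almost all
  \<kappa>.\<close>

lemma good_keys_exist: "eventually (\<lambda>\<kappa>. \<exists>ek td. length ek = t_ek P \<kappa> \<and> length td = t_td P \<kappa> \<and> good \<kappa> ek td) sequentially"
proof -
  obtain \<epsilon> where \<epsilon>: "negligible \<epsilon>" and le: "\<And>\<kappa>.
      (\<Sum>ek\<in>bitstrings (t_ek P \<kappa>). \<Sum>td\<in>bitstrings (t_td P \<kappa>). kg_prob P \<kappa> ek td * of_bool (good \<kappa> ek td)) \<ge> 1 - \<epsilon> \<kappa>"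
    using P_inv unfolding inversion_correct_def good_def by blast
  have "eventually (\<lambda>\<kappa>. \<bar>\<epsilon> \<kappa>\<bar> < 1 / real \<kappa> ^ 0) sequentially"
    using \<epsilon> unfolding negligible_def by blast
  then show ?thesis
  proof eventually_elim
    case (elim \<kappa>)
    show ?case
    proof (rule ccontr)
      assume "\<not> ?case"
      then have "(\<Sum>ek\<in>bitstrings (t_ek P \<kappa>). \<Sum>td\<in>bitstrings (t_td P \<kappa>). kg_prob P \<kappa> ek td * of_bool (good \<kappa> ek td)) = 0"
        by (intro sum.neutral ballI) simp
      then show False
        using le[of \<kappa>] elim by simp
    qed
  qed
qed

text \<open>
  Unclonability holds for key-independent input distributions only. Non-uniformity removes
  the obstacle: fix keys that maximize the adversary's gap and hard-wire them.
\<close>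

lemma upo_step:
  "\<exists>\<epsilon>. negligible \<epsilon> \<and> (\<forall>\<kappa> ek td. length ek = t_ek P \<kappa> \<and> length td = t_td P \<kappa> \<and> good \<kappa> ek td \<longrightarrow>
     gap \<kappa> (ek, td) \<le> 1 + \<epsilon> \<kappa>)"
proof -
  define L where "L \<kappa> = bitstrings (t_ek P \<kappa>) \<times> bitstrings (t_td P \<kappa>)" for \<kappa>
  define G where "G \<kappa> = {k \<in> L \<kappa>. good \<kappa> (fst k) (snd k)}" for \<kappa>
  \<comment> \<open>Only good keys compete, as their injectivity yields the entropy. Where there are
    none, any keys of the right length are taken, which keeps the circuits well-formed for every
    \<kappa>.\<close>
  have "\<exists>k\<in>L \<kappa>. G \<kappa> \<noteq> {} \<longrightarrow> k \<in> G \<kappa> \<and> (\<forall>k'\<in>G \<kappa>. gap \<kappa> k' \<le> gap \<kappa> k)" for \<kappa>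
  proof (cases "G \<kappa> = {}")
    case True
    have "(replicate (t_ek P \<kappa>) False, replicate (t_td P \<kappa>) False) \<in> L \<kappa>"
      by (simp add: L_def)
    with True show ?thesis by blast
  next
    case False
    have "finite (G \<kappa>)"
      by (simp add: G_def L_def)
    from argmax_finite[OF this False, of "gap \<kappa>"] obtain k where "k \<in> G \<kappa>" "\<forall>k'\<in>G \<kappa>. gap \<kappa> k' \<le> gap \<kappa> k"
      by blast
    then show ?thesis
      by (intro bexI[of _ k]) (simp_all add: G_def)
  qed
  then obtain k where k: "\<And>\<kappa>. k \<kappa> \<in> L \<kappa>"
    and k_max: "\<And>\<kappa>. G \<kappa> \<noteq> {} \<Longrightarrow> k \<kappa> \<in> G \<kappa> \<and> (\<forall>k'\<in>G \<kappa>. gap \<kappa> k' \<le> gap \<kappa> (k \<kappa>))"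
    by metis
  define ek where "ek \<kappa> = fst (k \<kappa>)" for \<kappa>
  define td where "td \<kappa> = snd (k \<kappa>)" for \<kappa>
  have len: "length (ek \<kappa>) = t_ek P \<kappa>" "length (td \<kappa>) = t_td P \<kappa>" for \<kappa>
    using k[of \<kappa>] by (auto simp: L_def ek_def td_def)
  let ?D = "\<lambda>\<kappa>. sampler (N \<kappa>) (t_Eval P \<kappa>) (ek \<kappa>)"
  let ?A1 = "\<lambda>\<kappa>. compile 0 (const_circ (code (M \<kappa>) (inv_padded \<kappa> (td \<kappa>))))"
  let ?A2 = "\<lambda>\<kappa>. pir.prepare \<kappa> (ek \<kappa>)"
  let ?B = "\<lambda>\<kappa>. player_B (N \<kappa>) (M \<kappa>) (t_Eval P \<kappa>) (ek \<kappa>) (B \<kappa>)"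
  let ?C = "\<lambda>\<kappa>. player_C (N \<kappa>) (M \<kappa>) (rC \<kappa>) (t_Eval P \<kappa>) (ek \<kappa>) (C \<kappa>)"
  have Ev: "wf_circ (N \<kappa> + length (ek \<kappa>)) (M \<kappa>) (t_Eval P \<kappa>)" for \<kappa>
    using wf_Eval[of \<kappa>] by (simp add: len)
  have outs: "length (snd (t_Eval P \<kappa>)) = M \<kappa>" for \<kappa>
    using wf_Eval[of \<kappa>] by (simp add: wf_circ_def)
  have code_length: "length (code (M \<kappa>) (inv_padded \<kappa> (td \<kappa>))) = code_len (M \<kappa>) (N \<kappa> + 1) (u_size U \<kappa>)" for \<kappa>
    using inv_padded_class[OF len(2)] by (simp add: length_code u_class_def circuits_def wf_circ_def)
  have pb_sampler: "poly_bounded (\<lambda>\<kappa>. length (?D \<kappa>))"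
    by (rule poly_bounded_mono[OF _ length_sampler], unfold len outs)
      (intro poly_bounded_intros pb_n pb_m pb_ek pb_circuits)
  have qD: "qpt (\<lambda>\<kappa>. 0) ?D (u_in U)"
    unfolding qpt_def using wf_sampler len pb_sampler by simp
  have entropy: "high_min_entropy (1 / 2) (u_in U) ?D"
    unfolding high_min_entropy_def
    using good_keys_exist domain_grows[OF P_eff P_ow pb_ptd]
  proof eventually_elim
    case (elim \<kappa>)
    then have "G \<kappa> \<noteq> {}"
      by (auto simp: G_def L_def)
    then have "inj_on (pir.ev \<kappa> (ek \<kappa>)) (bitstrings (N \<kappa>))"
      using k_max[of \<kappa>] good_inj by (auto simp: G_def ek_def pir_ev)
    from pir.sampler_min_entropy[OF len(1) this] show ?case
      using elim(2) by simp
  qed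
  have qA1: "qpt (\<lambda>\<kappa>. 0) ?A1 (\<lambda>\<kappa>. code_len (u_in U \<kappa>) (u_out U \<kappa>) (u_size U \<kappa>) + 0)"
    unfolding qpt_def
  proof (intro conjI allI)
    show "wf_qcirc 0 (?A1 \<kappa>) (code_len (u_in U \<kappa>) (u_out U \<kappa>) (u_size U \<kappa>) + 0)" for \<kappa>
      using wf_compile[OF wf_const[of "code (M \<kappa>) (inv_padded \<kappa> (td \<kappa>))"]] by (simp add: code_length)
    show "poly_bounded (\<lambda>\<kappa>. length (?A1 \<kappa>))"
      by (rule poly_bounded_mono[OF _ length_const], unfold code_length) (intro poly_bounded_intros pb_code_len pb_size)
  qed
  have qA2: "qpt (\<lambda>\<kappa>. 0 + u_reg U \<kappa>) ?A2 (\<lambda>\<kappa>. rB \<kappa> + rC \<kappa>)"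
    unfolding qpt_def
  proof (intro conjI allI)
    show "wf_qcirc (0 + u_reg U \<kappa>) (?A2 \<kappa>) (rB \<kappa> + rC \<kappa>)" for \<kappa>
      using pir.wf_prepare[OF len(1)] by simp
    show "poly_bounded (\<lambda>\<kappa>. length (?A2 \<kappa>))"
      by (rule poly_bounded_mono[OF _ length_prepare], unfold len) (intro poly_bounded_intros pb_ek pb_circuits)
  qed
  have qB: "qpt (\<lambda>\<kappa>. u_in U \<kappa> + rB \<kappa>) ?B (\<lambda>\<kappa>. 1)"
    unfolding qpt_def
  proof (intro conjI allI)
    show "wf_qcirc (u_in U \<kappa> + rB \<kappa>) (?B \<kappa>) 1" for \<kappa>
      using wf_player_B[OF Ev pir.wfB] by simp
    show "poly_bounded (\<lambda>\<kappa>. length (?B \<kappa>))"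
      by (rule poly_bounded_mono[OF _ length_player_B], unfold len outs) (intro poly_bounded_intros pb_n pb_m pb_ek pb_circuits)
  qed
  have qC: "qpt (\<lambda>\<kappa>. rC \<kappa> + u_in U \<kappa>) ?C (\<lambda>\<kappa>. 1)"
    unfolding qpt_def
  proof (intro conjI allI)
    show "wf_qcirc (rC \<kappa> + u_in U \<kappa>) (?C \<kappa>) 1" for \<kappa>
      using wf_player_C[OF Ev pir.wfC] by simp
    show "poly_bounded (\<lambda>\<kappa>. length (?C \<kappa>))"
      by (rule poly_bounded_mono[OF _ length_player_C], unfold len outs) (intro poly_bounded_intros pb_n pb_m pb_ek pb_circuits)
  qed
  obtain \<epsilon> where \<epsilon>: "negligible \<epsilon>" and win: "\<And>\<kappa>. upo_win U ?D ?D (\<lambda>\<kappa>. 0) rB rC ?A1 ?A2 ?B ?C \<kappa> \<le> 1 / 2 + \<epsilon> \<kappa>"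
    using U_sec[unfolded upo_secure_def, rule_format, of ?D ?D ?A1 "\<lambda>\<kappa>. 0" ?A2 rB rC ?B ?C]
      qD entropy qA1 qA2 qB qC by blast
  have le: "gap \<kappa> (k \<kappa>) \<le> 1 + (\<epsilon> \<kappa> + \<epsilon> \<kappa>)" for \<kappa>
  proof -
    have "gap \<kappa> (k \<kappa>) \<le> 2 * upo_win U ?D ?D (\<lambda>\<kappa>. 0) rB rC ?A1 ?A2 ?B ?C \<kappa>"
      using pir.upo_win_ge[OF len(1)[of \<kappa>] inv_padded_class[OF len(2)[of \<kappa>]], where DB = ?D and DC = ?D and aux = "\<lambda>\<kappa>. 0"
        and rB' = rB and rC' = rC and ?A1.0 = ?A1 and ?A2.0 = ?A2 and B' = ?B and C' = ?C]
      by (simp add: gap_def case_prod_beta ek_def[symmetric] td_def[symmetric] pir_ev inv_punctured_def[symmetric]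
          obfuscated_inv_padded[OF len(2)])
    then show ?thesis
      using win[of \<kappa>] by simp
  qed
  have "gap \<kappa> (ek', td') \<le> 1 + (\<epsilon> \<kappa> + \<epsilon> \<kappa>)" if "length ek' = t_ek P \<kappa>" "length td' = t_td P \<kappa>" "good \<kappa> ek' td'" for \<kappa> ek' td'
  proof -
    have "(ek', td') \<in> G \<kappa>"
      using that by (simp add: G_def L_def)
    then have "gap \<kappa> (ek', td') \<le> gap \<kappa> (k \<kappa>)"
      using k_max[of \<kappa>] by blast
    also have "\<dots> \<le> 1 + (\<epsilon> \<kappa> + \<epsilon> \<kappa>)"
      by (rule le)
    finally show ?thesis .
  qed
  then show ?thesis
    using negligible_add[OF \<epsilon> \<epsilon>] by blast
qed

definition keys_ok :: "nat \<Rightarrow> bits \<Rightarrow> bits \<Rightarrow> bits \<Rightarrow> bits \<Rightarrow> bits \<Rightarrow> bool" where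
  "keys_ok \<kappa> ek td y1 y2 ptd \<longleftrightarrow> length ek = t_ek P \<kappa> \<and> length td = t_td P \<kappa> \<and>
     length y1 = M \<kappa> \<and> length y2 = M \<kappa> \<and> length ptd = t_ptd P \<kappa>"

definition io_gap :: "nat \<Rightarrow> bits \<times> bits \<times> bits \<times> bits \<times> bits \<Rightarrow> real" where
  "io_gap \<kappa> = (\<lambda>(ek, td, y1, y2, ptd).
     pir.check_dist \<kappa> ek y1 y2 (obfuscated U \<kappa> (punc_inv_padded \<kappa> ptd)) True True -
     pir.check_dist \<kappa> ek y1 y2 (obfuscated U \<kappa> (inv_punctured \<kappa> td y1 y2)) True True)"

lemma length_distinguisher:
  assumes "length ek = t_ek P \<kappa>" "length y1 = M \<kappa>" "length y2 = M \<kappa>"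
  shows "length (pir.distinguisher \<kappa> ek y1 y2) \<le> 14 * M \<kappa> + (7 * t_ek P \<kappa> + length (A \<kappa>)) +
    (length (B \<kappa>) + (5 * (t_ek P \<kappa> + bsize (t_Eval P \<kappa>)) + 2 * M \<kappa> + N \<kappa>) + 35 * M \<kappa> + 12) +
    (length (C \<kappa>) + (5 * (t_ek P \<kappa> + bsize (t_Eval P \<kappa>)) + 2 * M \<kappa> + N \<kappa>) + 35 * M \<kappa> + 12) + 9"
proof -
  have outs: "length (snd (t_Eval P \<kappa>)) = M \<kappa>"
    using wf_Eval[of \<kappa>] by (simp add: wf_circ_def)
  show ?thesis
    using length_const[of y1] length_const[of y2] length_prepare[of \<kappa> ek] length_and
      length_player_B[of "N \<kappa>" "M \<kappa>" "t_Eval P \<kappa>" ek "B \<kappa>"]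
      length_player_C[of "N \<kappa>" "M \<kappa>" "rC \<kappa>" "t_Eval P \<kappa>" ek "C \<kappa>"]
    unfolding pir.distinguisher_def pir.players_def par_def length_append length_map assms outs
    by linarith
qed

text \<open>iO security concerns one pair of circuit families at a time, while the bound is wanted
  for all keys, points and punctured trapdoors at once. Hence again a tuple with the largest gap is
  hard-wired, here among those where puncturing was correct, so that the two circuits are
  equivalent.\<close>

lemma io_step:
  "\<exists>\<epsilon>. negligible \<epsilon> \<and> (\<forall>\<kappa> ek td y1 y2 ptd. keys_ok \<kappa> ek td y1 y2 ptd \<and> punctured_correct_at P \<kappa> td y1 y2 ptd \<longrightarrow>
     io_gap \<kappa> (ek, td, y1, y2, ptd) \<le> \<epsilon> \<kappa>)"
proof -
  define L where "L \<kappa> = {(ek, td, y1, y2, ptd). keys_ok \<kappa> ek td y1 y2 ptd}" for \<kappa>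
  define V where "V \<kappa> = {(ek, td, y1, y2, ptd). keys_ok \<kappa> ek td y1 y2 ptd \<and> punctured_correct_at P \<kappa> td y1 y2 ptd}" for \<kappa>
  have L_prod: "L \<kappa> = bitstrings (t_ek P \<kappa>) \<times> bitstrings (t_td P \<kappa>) \<times> bitstrings (M \<kappa>) \<times> bitstrings (M \<kappa>) \<times> bitstrings (t_ptd P \<kappa>)" for \<kappa>
    by (auto simp: L_def keys_ok_def)
  have VL: "V \<kappa> \<subseteq> L \<kappa>" for \<kappa>
    by (auto simp: V_def L_def)
  have "\<exists>k\<in>L \<kappa>. V \<kappa> \<noteq> {} \<longrightarrow> k \<in> V \<kappa> \<and> (\<forall>k'\<in>V \<kappa>. io_gap \<kappa> k' \<le> io_gap \<kappa> k)" for \<kappa>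
  proof (cases "V \<kappa> = {}")
    case True
    have "(replicate (t_ek P \<kappa>) False, replicate (t_td P \<kappa>) False, replicate (M \<kappa>) False,
        replicate (M \<kappa>) False, replicate (t_ptd P \<kappa>) False) \<in> L \<kappa>"
      by (simp add: L_prod)
    with True show ?thesis by blast
  next
    case False
    have "finite (V \<kappa>)"
      by (rule finite_subset[OF VL]) (simp add: L_prod)
    from argmax_finite[OF this False, of "io_gap \<kappa>"] show ?thesis
      using VL by blast
  qed
  then obtain k where k: "\<And>\<kappa>. k \<kappa> \<in> L \<kappa>"
    and k_max: "\<And>\<kappa>. V \<kappa> \<noteq> {} \<Longrightarrow> k \<kappa> \<in> V \<kappa> \<and> (\<forall>k'\<in>V \<kappa>. io_gap \<kappa> k' \<le> io_gap \<kappa> (k \<kappa>))"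
    by metis
  define ek where "ek \<kappa> = fst (k \<kappa>)" for \<kappa>
  define td where "td \<kappa> = fst (snd (k \<kappa>))" for \<kappa>
  define y1 where "y1 \<kappa> = fst (snd (snd (k \<kappa>)))" for \<kappa>
  define y2 where "y2 \<kappa> = fst (snd (snd (snd (k \<kappa>))))" for \<kappa>
  define ptd where "ptd \<kappa> = snd (snd (snd (snd (k \<kappa>))))" for \<kappa>
  have k_eq: "k \<kappa> = (ek \<kappa>, td \<kappa>, y1 \<kappa>, y2 \<kappa>, ptd \<kappa>)" for \<kappa>
    by (simp add: ek_def td_def y1_def y2_def ptd_def)
  have len: "length (ek \<kappa>) = t_ek P \<kappa>" "length (td \<kappa>) = t_td P \<kappa>" "length (y1 \<kappa>) = M \<kappa>"
    "length (y2 \<kappa>) = M \<kappa>" "length (ptd \<kappa>) = t_ptd P \<kappa>" for \<kappa>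
    using k[of \<kappa>] by (simp_all add: k_eq L_prod)
  define C1 where "C1 \<kappa> = punc_inv_padded \<kappa> (ptd \<kappa>)" for \<kappa>
  \<comment> \<open>If there is no valid tuple at \<kappa>, the two circuits are made equal, since
    iO security demands equivalence at every \<kappa>.\<close>
  define C0 where "C0 \<kappa> = (if k \<kappa> \<in> V \<kappa> then inv_punctured \<kappa> (td \<kappa>) (y1 \<kappa>) (y2 \<kappa>) else C1 \<kappa>)" for \<kappa>
  let ?D = "\<lambda>\<kappa>. pir.distinguisher \<kappa> (ek \<kappa>) (y1 \<kappa>) (y2 \<kappa>)"
  have wfC1: "wf_circ (M \<kappa>) (N \<kappa> + 1) (C1 \<kappa>) \<and> bsize (C1 \<kappa>) = u_full U \<kappa>" for \<kappa>
    unfolding C1_def using wf_punc_inv_padded len by simp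
  have wfC0: "wf_circ (M \<kappa>) (N \<kappa> + 1) (C0 \<kappa>) \<and> bsize (C0 \<kappa>) = u_full U \<kappa>" for \<kappa>
    unfolding C0_def using wfC1 wf_inv_punctured len by simp
  have equiv: "beval (C0 \<kappa>) y = beval (C1 \<kappa>) y" if "length y = M \<kappa>" for \<kappa> y
  proof (cases "k \<kappa> \<in> V \<kappa>")
    case True
    then have "punctured_correct_at P \<kappa> (td \<kappa>) (y1 \<kappa>) (y2 \<kappa>) (ptd \<kappa>)"
      by (simp add: V_def k_eq)
    with True show ?thesis
      using that len by (simp add: C0_def C1_def punctured_equiv)
  qed (simp add: C0_def)
  have qD: "qpt (u_reg U) ?D (\<lambda>\<kappa>. 1)"
    unfolding qpt_def
  proof (intro conjI allI)
    show "wf_qcirc (u_reg U \<kappa>) (?D \<kappa>) 1" for \<kappa>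
      using pir.wf_distinguisher len by simp
    show "poly_bounded (\<lambda>\<kappa>. length (?D \<kappa>))"
      by (rule poly_bounded_mono[OF _ length_distinguisher[OF len(1,3,4)]])
        (intro poly_bounded_intros pb_n pb_m pb_ek pb_circuits)
  qed
  define \<epsilon> where "\<epsilon> \<kappa> = outcome (run (?D \<kappa>) (obfuscated U \<kappa> (C1 \<kappa>))) [True] -
      outcome (run (?D \<kappa>) (obfuscated U \<kappa> (C0 \<kappa>))) [True]" for \<kappa>
  have neg: "negligible \<epsilon>"
    unfolding \<epsilon>_def
    by (rule U_io[unfolded io_secure_def, rule_format]) (use qD wfC0 wfC1 equiv in simp)
  have "io_gap \<kappa> t \<le> \<epsilon> \<kappa>" if "t \<in> V \<kappa>" for \<kappa> t
  proof -
    have kV: "k \<kappa> \<in> V \<kappa>" and le: "io_gap \<kappa> t \<le> io_gap \<kappa> (k \<kappa>)"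
      using k_max[of \<kappa>] that by auto
    have "io_gap \<kappa> (k \<kappa>) = \<epsilon> \<kappa>"
      unfolding \<epsilon>_def pir.distinguisher_accepts[OF len(1,3,4)]
      by (simp add: io_gap_def k_eq C0_def C1_def kV[unfolded k_eq])
    with le show ?thesis by simp
  qed
  then show ?thesis
    using neg by (auto simp: V_def)
qed

text \<open>No keys are fixed here: keys, points and punctured trapdoor are sampled as in
  \<open>ow_win\<close>, and by the exact simulation the sum is \<open>ow_win\<close> of the
  inverter.\<close>

lemma ow_step:
  "\<exists>\<epsilon>. negligible \<epsilon> \<and> (\<forall>\<kappa>.
     (\<Sum>ek\<in>bitstrings (t_ek P \<kappa>). \<Sum>td\<in>bitstrings (t_td P \<kappa>). kg_prob P \<kappa> ek td *
       (\<Sum>x1\<in>bitstrings (N \<kappa>). \<Sum>x2\<in>bitstrings (N \<kappa>). (1 / 2 ^ N \<kappa>)\<^sup>2 *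
         (\<Sum>ptd\<in>bitstrings (t_ptd P \<kappa>). punc_prob P \<kappa> td (ev \<kappa> ek x1) (ev \<kappa> ek x2) ptd *
            (\<Sum>x1'\<in>bitstrings (N \<kappa>). \<Sum>x2'\<in>bitstrings (N \<kappa>).
               of_bool (x1' = x1 \<or> x2' = x2) *
               pir.search_dist \<kappa> ek (ev \<kappa> ek x1) (ev \<kappa> ek x2) (obfuscated U \<kappa> (punc_inv_padded \<kappa> ptd)) x1' x2'))))
     \<le> \<epsilon> \<kappa>)"
proof -
  define w where "w \<kappa> = M \<kappa> + u_full U \<kappa>" for \<kappa>
  define rest where "rest \<kappa> = code_rest (M \<kappa>) (u_full U \<kappa>) (t_ptd P \<kappa>) (t_PuncInv P \<kappa>)" for \<kappa>
  define cl where "cl \<kappa> = code_len (M \<kappa>) (N \<kappa> + 1) (u_full U \<kappa>)" for \<kappa>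
  define I where "I \<kappa> = pir.inverter \<kappa> (t_ptd P \<kappa>) (w \<kappa>) (rest \<kappa>) (u_Obf U \<kappa>)" for \<kappa>
  \<comment> \<open>Apart from the trapdoor bits the description is a string depending on \<kappa>
    only, which the inverter holds as advice.\<close>
  have code: "code (M \<kappa>) (punc_inv_padded \<kappa> ptd) = wired_code (w \<kappa>) (rest \<kappa>) ptd"
    if "length ptd = t_ptd P \<kappa>" for \<kappa> ptd
  proof -
    have "length ptd + bsize (t_PuncInv P \<kappa>) \<le> u_full U \<kappa>"
      using that punc_inv_fits[of \<kappa>] size_le_full[of \<kappa>] by simp
    from code_pad_hardwire[OF this, of "M \<kappa>"] show ?thesis
      by (simp add: punc_inv_padded_def punc_inv_circ_def w_def rest_def that)
  qed
  have code_length: "length (wired_code (w \<kappa>) (rest \<kappa>) ptd) = cl \<kappa>" if "length ptd = t_ptd P \<kappa>" for \<kappa> ptd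
    using wf_punc_inv_padded[OF that] by (simp add: code[OF that, symmetric] length_code wf_circ_def cl_def)
  have Ob: "wf_qcirc (cl \<kappa>) (u_Obf U \<kappa>) (u_reg U \<kappa>)" for \<kappa>
    unfolding cl_def by (rule wf_Obf)
  have obf: "obfuscated U \<kappa> (punc_inv_padded \<kappa> ptd) = run (u_Obf U \<kappa>) (basis (wired_code (w \<kappa>) (rest \<kappa>) ptd))"
    if "length ptd = t_ptd P \<kappa>" for \<kappa> ptd
  proof -
    have "pad (u_full U \<kappa>) (punc_inv_padded \<kappa> ptd) = punc_inv_padded \<kappa> ptd"
      using wf_punc_inv_padded(2)[OF that] by (simp add: pad_def)
    then show ?thesis
      by (simp add: obfuscated_def code[OF that])
  qed
  define lay where "lay \<kappa> = layout_circ (t_ek P \<kappa>) (t_ptd P \<kappa>) (M \<kappa>) (w \<kappa>) (rest \<kappa>)" for \<kappa>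
  define lin where "lin \<kappa> = t_ek P \<kappa> + (t_ptd P \<kappa> + (M \<kappa> + M \<kappa>))" for \<kappa>
  have "length (code_wires (t_ek P \<kappa>) K (t_ptd P \<kappa>) (w \<kappa>) (rest \<kappa>)) = cl \<kappa>" for \<kappa> K
    using code_length[of "replicate (t_ptd P \<kappa>) False" \<kappa>]
    by (simp add: code_wires_def wired_code_def length_concat o_def sum_list_triv sum_list_replicate)
  then have lay_outs: "length (snd (lay \<kappa>)) = M \<kappa> + (t_ek P \<kappa> + (cl \<kappa> + M \<kappa>))" for \<kappa>
    by (simp add: lay_def layout_circ_def)
  have len: "length (I \<kappa>) \<le> 10 + 2 * (M \<kappa> + (t_ek P \<kappa> + (cl \<kappa> + M \<kappa>))) + lin \<kappa> +
      length (u_Obf U \<kappa>) + length (A \<kappa>) + length (B \<kappa>) + length (C \<kappa>)" for \<kappa>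
    using length_compile[of "lin \<kappa>" "lay \<kappa>"]
    by (simp add: I_def pir.inverter_def lay_def[symmetric] lin_def[symmetric] lay_outs par_def)
      (simp add: lay_def bsize_layout)
  have q: "qpt lin I (\<lambda>\<kappa>. N \<kappa> + N \<kappa>)"
    unfolding qpt_def
  proof (intro conjI allI)
    show "wf_qcirc (lin \<kappa>) (I \<kappa>) (N \<kappa> + N \<kappa>)" for \<kappa>
      unfolding I_def lin_def
      \<comment> \<open>Well-formedness depends on the trapdoor through its length alone; any string
        of that length instantiates the rule.\<close>
      by (rule pir.wf_inverter[OF Ob, of "replicate (t_ptd P \<kappa>) False"]) (simp_all add: code_length)
    show "poly_bounded (\<lambda>\<kappa>. length (I \<kappa>))"
      by (rule poly_bounded_mono[OF _ len], unfold lin_def cl_def)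
        (intro poly_bounded_intros pb_code_len pb_full pb_n pb_m pb_ek pb_ptd pb_circuits)
  qed
  then obtain \<epsilon> where \<epsilon>: "negligible \<epsilon>" and win: "\<And>\<kappa>. ow_win P I \<kappa> \<le> \<epsilon> \<kappa>"
    using P_ow unfolding one_way_punctured_def lin_def by blast
  have prob: "out_prob (I \<kappa>) (ek @ ptd @ ev \<kappa> ek x1 @ ev \<kappa> ek x2) (x1' @ x2') =
      pir.search_dist \<kappa> ek (ev \<kappa> ek x1) (ev \<kappa> ek x2) (obfuscated U \<kappa> (punc_inv_padded \<kappa> ptd)) x1' x2'"
    if "length ek = t_ek P \<kappa>" "length ptd = t_ptd P \<kappa>" "length x1' = N \<kappa>" "length x2' = N \<kappa>" for \<kappa> ek ptd x1 x2 x1' x2'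
    unfolding I_def obf[OF that(2)]
    by (rule pir.inverter_prob[OF Ob that(2) code_length[OF that(2)] that(1) _ _ that(3,4)])
      (simp_all add: length_tdf_eval P_eff)
  show ?thesis
  proof (intro exI conjI allI)
    show "negligible \<epsilon>" by (rule \<epsilon>)
    fix \<kappa>
    show "(\<Sum>ek\<in>bitstrings (t_ek P \<kappa>). \<Sum>td\<in>bitstrings (t_td P \<kappa>). kg_prob P \<kappa> ek td *
       (\<Sum>x1\<in>bitstrings (N \<kappa>). \<Sum>x2\<in>bitstrings (N \<kappa>). (1 / 2 ^ N \<kappa>)\<^sup>2 *
         (\<Sum>ptd\<in>bitstrings (t_ptd P \<kappa>). punc_prob P \<kappa> td (ev \<kappa> ek x1) (ev \<kappa> ek x2) ptd *
            (\<Sum>x1'\<in>bitstrings (N \<kappa>). \<Sum>x2'\<in>bitstrings (N \<kappa>).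
               of_bool (x1' = x1 \<or> x2' = x2) *
               pir.search_dist \<kappa> ek (ev \<kappa> ek x1) (ev \<kappa> ek x2) (obfuscated U \<kappa> (punc_inv_padded \<kappa> ptd)) x1' x2'))))
     \<le> \<epsilon> \<kappa>"
      by (rule order_trans[OF _ win[of \<kappa>]], unfold ow_win_def Let_def)
        (rule eq_refl, intro sum.cong refl arg_cong2[where f = "(*)"], simp_all add: prob)
  qed
qed

text \<open>The points depend on \<open>ek\<close> through the evaluation, so correctness is applied
  to key-dependent points. The inputs are fixed before the keys and the bound is uniform in them, so
  it survives averaging over inputs.\<close>

lemma punc_step:
  "\<exists>\<epsilon>. negligible \<epsilon> \<and> (\<forall>\<kappa> x1 x2.
     (\<Sum>ek\<in>bitstrings (t_ek P \<kappa>). \<Sum>td\<in>bitstrings (t_td P \<kappa>). kg_prob P \<kappa> ek td *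
       (\<Sum>ptd\<in>bitstrings (t_ptd P \<kappa>). punc_prob P \<kappa> td (ev \<kappa> ek x1) (ev \<kappa> ek x2) ptd *
          of_bool (\<not> punctured_correct_at P \<kappa> td (ev \<kappa> ek x1) (ev \<kappa> ek x2) ptd))) \<le> \<epsilon> \<kappa>)"
proof -
  obtain \<epsilon> where neg: "negligible \<epsilon>" and \<epsilon>: "\<And>\<kappa> Y1 Y2.
     (\<forall>ek td. Y1 ek td \<in> bitstrings (M \<kappa>) \<and> Y2 ek td \<in> bitstrings (M \<kappa>)) \<Longrightarrow>
     (\<Sum>ek\<in>bitstrings (t_ek P \<kappa>). \<Sum>td\<in>bitstrings (t_td P \<kappa>). \<Sum>ptd\<in>bitstrings (t_ptd P \<kappa>).
        kg_prob P \<kappa> ek td * punc_prob P \<kappa> td (Y1 ek td) (Y2 ek td) ptd *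
        of_bool (punctured_correct_at P \<kappa> td (Y1 ek td) (Y2 ek td) ptd)) \<ge> 1 - \<epsilon> \<kappa>"
    using P_punc unfolding puncturing_correct_def by blast
  show ?thesis
  proof (intro exI conjI allI)
    show "negligible \<epsilon>" by (rule neg)
    fix \<kappa> x1 x2
    let ?ok = "\<lambda>ek td ptd. punctured_correct_at P \<kappa> td (ev \<kappa> ek x1) (ev \<kappa> ek x2) ptd"
    let ?p = "\<lambda>ek td ptd. punc_prob P \<kappa> td (ev \<kappa> ek x1) (ev \<kappa> ek x2) ptd"
    have split: "kg_prob P \<kappa> ek td * (\<Sum>ptd\<in>bitstrings (t_ptd P \<kappa>). ?p ek td ptd * of_bool (\<not> ?ok ek td ptd)) =
        kg_prob P \<kappa> ek td - (\<Sum>ptd\<in>bitstrings (t_ptd P \<kappa>). kg_prob P \<kappa> ek td * ?p ek td ptd * of_bool (?ok ek td ptd))"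
      if "td \<in> bitstrings (t_td P \<kappa>)" for ek td
    proof -
      have "(\<Sum>ptd\<in>bitstrings (t_ptd P \<kappa>). ?p ek td ptd * of_bool (\<not> ?ok ek td ptd)) =
          (\<Sum>ptd\<in>bitstrings (t_ptd P \<kappa>). ?p ek td ptd - ?p ek td ptd * of_bool (?ok ek td ptd))"
        by (intro sum.cong refl) simp
      also have "\<dots> = 1 - (\<Sum>ptd\<in>bitstrings (t_ptd P \<kappa>). ?p ek td ptd * of_bool (?ok ek td ptd))"
        using that by (simp only: sum_subtractf) (simp add: punc_total P_eff length_tdf_eval)
      finally show ?thesis
        by (simp only: right_diff_distrib sum_distrib_left mult.assoc mult_1_right)
    qed
    have "(\<Sum>ek\<in>bitstrings (t_ek P \<kappa>). \<Sum>td\<in>bitstrings (t_td P \<kappa>). kg_prob P \<kappa> ek td *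
        (\<Sum>ptd\<in>bitstrings (t_ptd P \<kappa>). ?p ek td ptd * of_bool (\<not> ?ok ek td ptd))) =
      1 - (\<Sum>ek\<in>bitstrings (t_ek P \<kappa>). \<Sum>td\<in>bitstrings (t_td P \<kappa>). \<Sum>ptd\<in>bitstrings (t_ptd P \<kappa>).
        kg_prob P \<kappa> ek td * ?p ek td ptd * of_bool (?ok ek td ptd))"
      by (simp only: split sum_subtractf kg_total[OF P_eff] cong: sum.cong)
    also have "\<dots> \<le> \<epsilon> \<kappa>"
      using \<epsilon>[where \<kappa> = \<kappa> and ?Y1.0 = "\<lambda>ek td. ev \<kappa> ek x1" and ?Y2.0 = "\<lambda>ek td. ev \<kappa> ek x2"]
      by (simp add: length_tdf_eval P_eff)
    finally show "(\<Sum>ek\<in>bitstrings (t_ek P \<kappa>). \<Sum>td\<in>bitstrings (t_td P \<kappa>). kg_prob P \<kappa> ek td *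
       (\<Sum>ptd\<in>bitstrings (t_ptd P \<kappa>). ?p ek td ptd * of_bool (\<not> ?ok ek td ptd))) \<le> \<epsilon> \<kappa>" .
  qed
qed

lemma inv_step:
  "\<exists>\<epsilon>. negligible \<epsilon> \<and> (\<forall>\<kappa>.
     (\<Sum>ek\<in>bitstrings (t_ek P \<kappa>). \<Sum>td\<in>bitstrings (t_td P \<kappa>). kg_prob P \<kappa> ek td * of_bool (\<not> good \<kappa> ek td)) \<le> \<epsilon> \<kappa>)"
proof -
  obtain \<epsilon> where \<epsilon>: "negligible \<epsilon>" and le: "\<And>\<kappa>.
      (\<Sum>ek\<in>bitstrings (t_ek P \<kappa>). \<Sum>td\<in>bitstrings (t_td P \<kappa>). kg_prob P \<kappa> ek td * of_bool (good \<kappa> ek td)) \<ge> 1 - \<epsilon> \<kappa>"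
    using P_inv unfolding inversion_correct_def good_def by blast
  have "(\<Sum>ek\<in>bitstrings (t_ek P \<kappa>). \<Sum>td\<in>bitstrings (t_td P \<kappa>). kg_prob P \<kappa> ek td * of_bool (\<not> good \<kappa> ek td)) \<le> \<epsilon> \<kappa>" for \<kappa>
  proof -
    have "(\<Sum>ek\<in>bitstrings (t_ek P \<kappa>). \<Sum>td\<in>bitstrings (t_td P \<kappa>). kg_prob P \<kappa> ek td * of_bool (\<not> good \<kappa> ek td)) =
        (\<Sum>ek\<in>bitstrings (t_ek P \<kappa>). \<Sum>td\<in>bitstrings (t_td P \<kappa>). kg_prob P \<kappa> ek td - kg_prob P \<kappa> ek td * of_bool (good \<kappa> ek td))"
      by (intro sum.cong refl) simp
    then show ?thesis
      using le[of \<kappa>] by (simp only: sum_subtractf kg_total[OF P_eff])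
  qed
  with \<epsilon> show ?thesis by blast
qed

text \<open>For good keys, winning the search game implies passing both tests with the intact
  program. Up to \<open>e1\<close>, unclonability bounds this by the probability that some player
  passes with the punctured program, which is charged to iO security (\<open>e2\<close>),
  one-wayness (\<open>e3\<close>) and incorrect puncturing (\<open>e4\<close>). Bad keys cost
  \<open>e5\<close>.\<close>

lemma search_negligible: "\<exists>\<epsilon>. negligible \<epsilon> \<and> (\<forall>\<kappa>. search_win (TDFCP P U) rB rC A B C \<kappa> \<le> \<epsilon> \<kappa>)"
proof -
  obtain e1 where e1: "negligible e1" and upo: "\<And>\<kappa> ek td. length ek = t_ek P \<kappa> \<Longrightarrow> length td = t_td P \<kappa> \<Longrightarrow>
      good \<kappa> ek td \<Longrightarrow> gap \<kappa> (ek, td) \<le> 1 + e1 \<kappa>"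
    using upo_step by blast
  obtain e2 where e2: "negligible e2" and io: "\<And>\<kappa> ek td y1 y2 ptd. keys_ok \<kappa> ek td y1 y2 ptd \<Longrightarrow>
      punctured_correct_at P \<kappa> td y1 y2 ptd \<Longrightarrow> io_gap \<kappa> (ek, td, y1, y2, ptd) \<le> e2 \<kappa>"
    using io_step by blast
  define ow where "ow \<kappa> ek x1 x2 ptd = (\<Sum>x1'\<in>bitstrings (N \<kappa>). \<Sum>x2'\<in>bitstrings (N \<kappa>).
      of_bool (x1' = x1 \<or> x2' = x2) *
      pir.search_dist \<kappa> ek (ev \<kappa> ek x1) (ev \<kappa> ek x2) (obfuscated U \<kappa> (punc_inv_padded \<kappa> ptd)) x1' x2')" for \<kappa> ek x1 x2 ptd
  define bad where "bad \<kappa> ek td x1 x2 ptd = (of_bool (\<not> punctured_correct_at P \<kappa> td (ev \<kappa> ek x1) (ev \<kappa> ek x2) ptd) :: real)" for \<kappa> ek td x1 x2 ptd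
  define q where "q \<kappa> = (1 / 2 ^ N \<kappa> :: real)\<^sup>2" for \<kappa>
  define pp where "pp \<kappa> ek td x1 x2 ptd = punc_prob P \<kappa> td (ev \<kappa> ek x1) (ev \<kappa> ek x2) ptd" for \<kappa> ek td x1 x2 ptd
  obtain e3 where e3: "negligible e3" and owle: "\<And>\<kappa>.
      (\<Sum>ek\<in>bitstrings (t_ek P \<kappa>). \<Sum>td\<in>bitstrings (t_td P \<kappa>). kg_prob P \<kappa> ek td *
        (\<Sum>x1\<in>bitstrings (N \<kappa>). \<Sum>x2\<in>bitstrings (N \<kappa>). q \<kappa> *
          (\<Sum>ptd\<in>bitstrings (t_ptd P \<kappa>). pp \<kappa> ek td x1 x2 ptd * ow \<kappa> ek x1 x2 ptd))) \<le> e3 \<kappa>"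
    using ow_step unfolding ow_def q_def pp_def by blast
  obtain e4 where e4: "negligible e4" and punc: "\<And>\<kappa> x1 x2.
      (\<Sum>ek\<in>bitstrings (t_ek P \<kappa>). \<Sum>td\<in>bitstrings (t_td P \<kappa>). kg_prob P \<kappa> ek td *
        (\<Sum>ptd\<in>bitstrings (t_ptd P \<kappa>). pp \<kappa> ek td x1 x2 ptd * bad \<kappa> ek td x1 x2 ptd)) \<le> e4 \<kappa>"
    using punc_step unfolding bad_def pp_def by blast
  obtain e5 where e5: "negligible e5" and inv: "\<And>\<kappa>.
      (\<Sum>ek\<in>bitstrings (t_ek P \<kappa>). \<Sum>td\<in>bitstrings (t_td P \<kappa>). kg_prob P \<kappa> ek td * of_bool (\<not> good \<kappa> ek td)) \<le> e5 \<kappa>"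
    using inv_step by blast
  define F where "F \<kappa> ek td x1 x2 = pir.search_dist \<kappa> ek (ev \<kappa> ek x1) (ev \<kappa> ek x2) (obfuscated U \<kappa> (inv_circ P \<kappa> td)) x1 x2" for \<kappa> ek td x1 x2
  define R where "R \<kappa> ek td = (\<Sum>x1\<in>bitstrings (N \<kappa>). \<Sum>x2\<in>bitstrings (N \<kappa>). q \<kappa> *
      (\<Sum>ptd\<in>bitstrings (t_ptd P \<kappa>). pp \<kappa> ek td x1 x2 ptd * (bad \<kappa> ek td x1 x2 ptd + ow \<kappa> ek x1 x2 ptd)))" for \<kappa> ek td
  have q_nonneg: "q \<kappa> \<ge> 0" for \<kappa>
    by (simp add: q_def)
  have q_total: "(\<Sum>x1\<in>bitstrings (N \<kappa>). \<Sum>x2\<in>bitstrings (N \<kappa>). q \<kappa>) = 1" for \<kappa>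
    unfolding q_def by (rule sum_uniform)
  have pp_nonneg: "pp \<kappa> ek td x1 x2 ptd \<ge> 0" for \<kappa> ek td x1 x2 ptd
    by (simp add: pp_def punc_nonneg)
  have ow_nonneg: "ow \<kappa> ek x1 x2 ptd \<ge> 0" for \<kappa> ek x1 x2 ptd
    unfolding ow_def by (intro sum_nonneg mult_nonneg_nonneg pir.search_dist_nonneg positive_obfuscated) simp
  have R_nonneg: "R \<kappa> ek td \<ge> 0" for \<kappa> ek td
    unfolding R_def by (intro sum_nonneg mult_nonneg_nonneg add_nonneg_nonneg q_nonneg pp_nonneg ow_nonneg) (simp add: bad_def)
  \<comment> \<open>On bad keys the first term alone bounds the sum, provided that the others are
    nonnegative: hence the absolute values.\<close>
  have key: "(\<Sum>x1\<in>bitstrings (N \<kappa>). \<Sum>x2\<in>bitstrings (N \<kappa>). q \<kappa> * F \<kappa> ek td x1 x2) \<le>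
      of_bool (\<not> good \<kappa> ek td) + \<bar>e1 \<kappa>\<bar> + \<bar>e2 \<kappa>\<bar> + R \<kappa> ek td"
    if ek: "length ek = t_ek P \<kappa>" and td: "length td = t_td P \<kappa>" for \<kappa> ek td
  proof (cases "good \<kappa> ek td")
    case False
    have F_le: "F \<kappa> ek td x1 x2 \<le> 1" if x: "length x1 = N \<kappa>" "length x2 = N \<kappa>" for x1 x2
    proof -
      let ?s = "pir.search_dist \<kappa> ek (ev \<kappa> ek x1) (ev \<kappa> ek x2) (obfuscated U \<kappa> (inv_circ P \<kappa> td))"
      have nonneg: "?s a b \<ge> 0" for a b
        by (intro pir.search_dist_nonneg positive_obfuscated)
      have "?s x1 x2 \<le> (\<Sum>b\<in>bitstrings (N \<kappa>). ?s x1 b)"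
        using x by (intro member_le_sum[of x2 _ "?s x1"] nonneg) simp_all
      also have "\<dots> \<le> (\<Sum>a\<in>bitstrings (N \<kappa>). \<Sum>b\<in>bitstrings (N \<kappa>). ?s a b)"
        using x by (intro member_le_sum[of x1 _ "\<lambda>a. \<Sum>b\<in>bitstrings (N \<kappa>). ?s a b"] sum_nonneg nonneg) simp_all
      also have "\<dots> = 1"
        using bsize_inv_circ[OF td] size_le_full[of \<kappa>]
        by (intro pir.search_dist_total ek length_tdf_eval P_eff qtrace_obfuscated wf_inv_circ td) simp
      finally show ?thesis
        by (simp add: F_def)
    qed
    have "(\<Sum>x1\<in>bitstrings (N \<kappa>). \<Sum>x2\<in>bitstrings (N \<kappa>). q \<kappa> * F \<kappa> ek td x1 x2) \<le>
        (\<Sum>x1\<in>bitstrings (N \<kappa>). \<Sum>x2\<in>bitstrings (N \<kappa>). q \<kappa>)"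
      by (intro sum_mono mult_left_le F_le q_nonneg) simp_all
    then show ?thesis
      using False q_total[of \<kappa>] R_nonneg[of \<kappa> ek td] by simp
  next
    case True
    define cI where "cI x1 x2 = pir.check_dist \<kappa> ek (ev \<kappa> ek x1) (ev \<kappa> ek x2) (obfuscated U \<kappa> (inv_circ P \<kappa> td)) False False" for x1 x2
    define c0 where "c0 x1 x2 = pir.check_dist \<kappa> ek (ev \<kappa> ek x1) (ev \<kappa> ek x2)
        (obfuscated U \<kappa> (inv_punctured \<kappa> td (ev \<kappa> ek x1) (ev \<kappa> ek x2))) True True" for x1 x2
    \<comment> \<open>The left side does not mention the punctured trapdoor. The bound is shown for
      each \<open>ptd\<close>, trivially where puncturing failed, and then averaged with weights of
      total 1.\<close>
    have c0: "1 - c0 x1 x2 \<le> \<bar>e2 \<kappa>\<bar> + (\<Sum>ptd\<in>bitstrings (t_ptd P \<kappa>).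
        pp \<kappa> ek td x1 x2 ptd * (bad \<kappa> ek td x1 x2 ptd + ow \<kappa> ek x1 x2 ptd))"
      if x: "length x1 = N \<kappa>" "length x2 = N \<kappa>" for x1 x2
    proof -
      have total: "(\<Sum>ptd\<in>bitstrings (t_ptd P \<kappa>). pp \<kappa> ek td x1 x2 ptd) = 1"
        unfolding pp_def by (intro punc_total P_eff td length_tdf_eval)
      have "c0 x1 x2 \<ge> 0"
        unfolding c0_def by (intro pir.check_dist_nonneg positive_obfuscated)
      have "1 - c0 x1 x2 \<le> \<bar>e2 \<kappa>\<bar> + (bad \<kappa> ek td x1 x2 ptd + ow \<kappa> ek x1 x2 ptd)" if ptd: "length ptd = t_ptd P \<kappa>" for ptd
      proof (cases "punctured_correct_at P \<kappa> td (ev \<kappa> ek x1) (ev \<kappa> ek x2) ptd")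
        case False
        then show ?thesis
          using \<open>c0 x1 x2 \<ge> 0\<close> ow_nonneg[of \<kappa> ek x1 x2 ptd] by (simp add: bad_def)
      next
        case True
        have inj: "inj_on (pir.ev \<kappa> ek) (bitstrings (N \<kappa>))"
          using good_inj[OF \<open>good \<kappa> ek td\<close>] by (simp add: inj_on_def tdf_eval_def)
        have tr: "qtrace (u_reg U \<kappa>) (obfuscated U \<kappa> (punc_inv_padded \<kappa> ptd)) = 1"
          using wf_punc_inv_padded[OF ptd] by (intro qtrace_obfuscated) simp_all
        have ow: "1 - pir.check_dist \<kappa> ek (ev \<kappa> ek x1) (ev \<kappa> ek x2) (obfuscated U \<kappa> (punc_inv_padded \<kappa> ptd)) True True =
            ow \<kappa> ek x1 x2 ptd"
          using pir.check_dist_complement[OF ek x tr inj] by (simp add: ow_def tdf_eval_def)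
        have "io_gap \<kappa> (ek, td, ev \<kappa> ek x1, ev \<kappa> ek x2, ptd) \<le> e2 \<kappa>"
          by (rule io[OF _ True]) (simp add: keys_ok_def ek td ptd length_tdf_eval P_eff)
        then show ?thesis
          using ow True abs_ge_self[of "e2 \<kappa>"] by (simp add: io_gap_def c0_def bad_def)
      qed
      then have "(\<Sum>ptd\<in>bitstrings (t_ptd P \<kappa>). pp \<kappa> ek td x1 x2 ptd * (1 - c0 x1 x2)) \<le>
          (\<Sum>ptd\<in>bitstrings (t_ptd P \<kappa>). pp \<kappa> ek td x1 x2 ptd * (\<bar>e2 \<kappa>\<bar> + (bad \<kappa> ek td x1 x2 ptd + ow \<kappa> ek x1 x2 ptd)))"
        by (intro sum_mono mult_left_mono pp_nonneg) simp
      then show ?thesis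
        unfolding distrib_left[of _ "\<bar>e2 \<kappa>\<bar>"] sum.distrib[of "\<lambda>ptd. _ ptd * \<bar>e2 \<kappa>\<bar>"] sum_distrib_right[symmetric] total by simp
    qed
    have "gap \<kappa> (ek, td) = (\<Sum>x1\<in>bitstrings (N \<kappa>). \<Sum>x2\<in>bitstrings (N \<kappa>). q \<kappa> * (cI x1 x2 + c0 x1 x2))"
      by (simp add: gap_def q_def cI_def c0_def)
    \<comment> \<open>Writing \<open>c0\<close> as 1 - (1 - c0) isolates a 1 that cancels the 1 in
      the bound on the gap.\<close>
    also have "\<dots> = (\<Sum>x1\<in>bitstrings (N \<kappa>). \<Sum>x2\<in>bitstrings (N \<kappa>). q \<kappa> * cI x1 x2) + 1 -
        (\<Sum>x1\<in>bitstrings (N \<kappa>). \<Sum>x2\<in>bitstrings (N \<kappa>). q \<kappa> * (1 - c0 x1 x2))"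
      using q_total[of \<kappa>] by (simp add: distrib_left right_diff_distrib sum.distrib sum_subtractf)
    finally have gap: "(\<Sum>x1\<in>bitstrings (N \<kappa>). \<Sum>x2\<in>bitstrings (N \<kappa>). q \<kappa> * cI x1 x2) \<le>
        e1 \<kappa> + (\<Sum>x1\<in>bitstrings (N \<kappa>). \<Sum>x2\<in>bitstrings (N \<kappa>). q \<kappa> * (1 - c0 x1 x2))"
      using upo[OF ek td True] by simp
    have "(\<Sum>x1\<in>bitstrings (N \<kappa>). \<Sum>x2\<in>bitstrings (N \<kappa>). q \<kappa> * (1 - c0 x1 x2)) \<le>
        (\<Sum>x1\<in>bitstrings (N \<kappa>). \<Sum>x2\<in>bitstrings (N \<kappa>). q \<kappa> * (\<bar>e2 \<kappa>\<bar> + (\<Sum>ptd\<in>bitstrings (t_ptd P \<kappa>).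
          pp \<kappa> ek td x1 x2 ptd * (bad \<kappa> ek td x1 x2 ptd + ow \<kappa> ek x1 x2 ptd))))"
      by (intro sum_mono mult_left_mono c0 q_nonneg) simp_all
    also have "\<dots> = (\<Sum>x1\<in>bitstrings (N \<kappa>). \<Sum>x2\<in>bitstrings (N \<kappa>). q \<kappa>) * \<bar>e2 \<kappa>\<bar> + R \<kappa> ek td"
      unfolding R_def by (simp only: distrib_left[of "q \<kappa>"] sum.distrib sum_distrib_right)
    finally have R: "(\<Sum>x1\<in>bitstrings (N \<kappa>). \<Sum>x2\<in>bitstrings (N \<kappa>). q \<kappa> * (1 - c0 x1 x2)) \<le> \<bar>e2 \<kappa>\<bar> + R \<kappa> ek td"
      by (simp only: q_total mult_1)
    have "(\<Sum>x1\<in>bitstrings (N \<kappa>). \<Sum>x2\<in>bitstrings (N \<kappa>). q \<kappa> * F \<kappa> ek td x1 x2) \<le>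
        (\<Sum>x1\<in>bitstrings (N \<kappa>). \<Sum>x2\<in>bitstrings (N \<kappa>). q \<kappa> * cI x1 x2)"
    proof (intro sum_mono mult_left_mono q_nonneg)
      fix x1 x2 assume "x1 \<in> bitstrings (N \<kappa>)" "x2 \<in> bitstrings (N \<kappa>)"
      then show "F \<kappa> ek td x1 x2 \<le> cI x1 x2"
        using pir.search_dist_le_check[OF ek, of x1 x2 "obfuscated U \<kappa> (inv_circ P \<kappa> td)"] positive_obfuscated
        by (simp add: F_def cI_def tdf_eval_def)
    qed
    with gap R show ?thesis
      using abs_ge_self[of "e1 \<kappa>"] True by simp
  qed
  have main: "search_win (TDFCP P U) rB rC A B C \<kappa> \<le> e5 \<kappa> + \<bar>e1 \<kappa>\<bar> + \<bar>e2 \<kappa>\<bar> + (e4 \<kappa> + e3 \<kappa>)" for \<kappa>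
  proof -
    let ?sum = "\<lambda>f. \<Sum>ek\<in>bitstrings (t_ek P \<kappa>). \<Sum>td\<in>bitstrings (t_td P \<kappa>). kg_prob P \<kappa> ek td * f ek td"
    have sum_add: "?sum (\<lambda>ek td. f ek td + g ek td) = ?sum f + ?sum g" for f g
      by (simp only: distrib_left sum.distrib)
    have sum_const: "?sum (\<lambda>ek td. c) = c" for c
      by (simp only: sum_distrib_right[symmetric] kg_total[OF P_eff] mult_1)
    \<comment> \<open>The averages over keys and inputs are exchanged because \<open>punc\<close>
      bounds the average over keys for fixed inputs.\<close>
    have swap: "?sum (\<lambda>ek td. \<Sum>x1\<in>bitstrings (N \<kappa>). \<Sum>x2\<in>bitstrings (N \<kappa>). q \<kappa> * g ek td x1 x2) =
        (\<Sum>x1\<in>bitstrings (N \<kappa>). \<Sum>x2\<in>bitstrings (N \<kappa>). q \<kappa> * ?sum (\<lambda>ek td. g ek td x1 x2))" for g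
      unfolding sum_distrib_left mult.left_commute[of "q \<kappa>"] by (rule sum_swap_pairs)
    have "search_win (TDFCP P U) rB rC A B C \<kappa> =
        ?sum (\<lambda>ek td. \<Sum>x1\<in>bitstrings (N \<kappa>). \<Sum>x2\<in>bitstrings (N \<kappa>). q \<kappa> * F \<kappa> ek td x1 x2)"
      by (simp add: search_win_def TDFCP_def Let_def F_def q_def pir.search_dist_def pir.challenge_def
          pir.bipartite_def challenge_state_def)
    also have "\<dots> \<le> ?sum (\<lambda>ek td. of_bool (\<not> good \<kappa> ek td) + \<bar>e1 \<kappa>\<bar> + \<bar>e2 \<kappa>\<bar> + R \<kappa> ek td)"
      by (intro sum_mono mult_left_mono key kg_nonneg) simp_all
    also have "\<dots> = ?sum (\<lambda>ek td. of_bool (\<not> good \<kappa> ek td)) + \<bar>e1 \<kappa>\<bar> + \<bar>e2 \<kappa>\<bar> + ?sum (R \<kappa>)"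
      by (simp only: sum_add sum_const)
    also have "?sum (R \<kappa>) =
        ?sum (\<lambda>ek td. \<Sum>x1\<in>bitstrings (N \<kappa>). \<Sum>x2\<in>bitstrings (N \<kappa>). q \<kappa> *
          (\<Sum>ptd\<in>bitstrings (t_ptd P \<kappa>). pp \<kappa> ek td x1 x2 ptd * bad \<kappa> ek td x1 x2 ptd)) +
        ?sum (\<lambda>ek td. \<Sum>x1\<in>bitstrings (N \<kappa>). \<Sum>x2\<in>bitstrings (N \<kappa>). q \<kappa> *
          (\<Sum>ptd\<in>bitstrings (t_ptd P \<kappa>). pp \<kappa> ek td x1 x2 ptd * ow \<kappa> ek x1 x2 ptd))"
      unfolding R_def by (simp only: distrib_left sum.distrib)
    also have "?sum (\<lambda>ek td. \<Sum>x1\<in>bitstrings (N \<kappa>). \<Sum>x2\<in>bitstrings (N \<kappa>). q \<kappa> *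
          (\<Sum>ptd\<in>bitstrings (t_ptd P \<kappa>). pp \<kappa> ek td x1 x2 ptd * bad \<kappa> ek td x1 x2 ptd)) =
        (\<Sum>x1\<in>bitstrings (N \<kappa>). \<Sum>x2\<in>bitstrings (N \<kappa>). q \<kappa> *
          ?sum (\<lambda>ek td. \<Sum>ptd\<in>bitstrings (t_ptd P \<kappa>). pp \<kappa> ek td x1 x2 ptd * bad \<kappa> ek td x1 x2 ptd))"
      by (rule swap)
    also have "\<dots> \<le> (\<Sum>x1\<in>bitstrings (N \<kappa>). \<Sum>x2\<in>bitstrings (N \<kappa>). q \<kappa> * e4 \<kappa>)"
      by (intro sum_mono mult_left_mono punc q_nonneg)
    also have "\<dots> = e4 \<kappa>"
      by (simp only: sum_distrib_right[symmetric] q_total mult_1)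
    finally show ?thesis
      using inv[of \<kappa>] owle[of \<kappa>] by simp
  qed
  have "negligible (\<lambda>\<kappa>. e5 \<kappa> + \<bar>e1 \<kappa>\<bar> + \<bar>e2 \<kappa>\<bar> + (e4 \<kappa> + e3 \<kappa>))"
    by (intro negligible_add negligible_abs e1 e2 e3 e4 e5)
  with main show ?thesis by blast
qed

end

theorem lemma5p10:
  fixes P :: ptdf
  assumes "puncturable_tdf P"
  shows "\<exists>c > 0. \<forall>U :: upo. is_upo c U \<and> upo_fits P U \<longrightarrow> search_secure (TDFCP P U)"
\<comment> \<open>The exponent that \<open>domain_grows\<close> delivers: the challenge distribution
  has min-entropy n, which is eventually at least the square root of \<kappa>.\<close>
proof (intro exI[of _ "1 / 2"] conjI allI impI)
  fix U assume U: "is_upo (1 / 2) U \<and> upo_fits P U"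
  show "search_secure (TDFCP P U)"
    unfolding search_secure_def
  proof (intro allI impI)
    fix rB rC A B C
    assume "qpt (\<lambda>\<kappa>. s_ek (TDFCP P U) \<kappa> + s_key (TDFCP P U) \<kappa>) A (\<lambda>\<kappa>. rB \<kappa> + rC \<kappa>) \<and>
      qpt (\<lambda>\<kappa>. s_m (TDFCP P U) \<kappa> + rB \<kappa>) B (s_n (TDFCP P U)) \<and>
      qpt (\<lambda>\<kappa>. rC \<kappa> + s_m (TDFCP P U) \<kappa>) C (s_n (TDFCP P U))"
    then interpret attack P U rB rC A B C
      using assms U by unfold_locales (simp_all add: TDFCP_def)
    show "\<exists>\<epsilon>. negligible \<epsilon> \<and> (\<forall>\<kappa>. search_win (TDFCP P U) rB rC A B C \<kappa> \<le> \<epsilon> \<kappa>)"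
      by (rule search_negligible)
  qed
qed simp

end
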